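(* Let $y\ge3$, let $\chi\pmod q$ be a primitive Dirichlet character of odd order $g$, let $A>0$, and let $\xi\pmod m$ be any odd Dirichlet character with $m<(\log y)^A$. Then $$\mathbb{M}(\chi\overline{\xi};\,y,\,\log^2y)\ge(\delta_g+o(1))\log\log y,$$ where $\delta_g=1-\frac{g}{\pi}\sin\frac{\pi}{g}$ and $o(1)\to0$ as $y\to\infty$ for any fixed values of $g$ and $A$.
   Context: For completely multiplicative $h$ with $|h|\le1$, $\mathbb{M}(h;X,T)=\min_{|t|\le T}\sum_{p\le X}\frac{1-\mathrm{Re}\, h(p)p^{-it}}{p}$, the sum over primes. A character $\xi$ is odd if $\xi(-1)=-1$. *)

theory Defs
  imports "HOL-Analysis.Analysis" "HOL-Computational_Algebra.Primes"
begin

text \<open>Characters live on \<^typ>\<open>int\<close>, extended by zero off the residues coprime to the modulus,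
  so that \<open>chi (-1)\<close> makes sense literally.\<close>

definition dirichlet_character :: "nat \<Rightarrow> (int \<Rightarrow> complex) \<Rightarrow> bool" where
  "dirichlet_character n chi \<longleftrightarrow>
     n > 0 \<and>
     (\<forall>a. chi (a + int n) = chi a) \<and>
     (\<forall>a b. chi (a * b) = chi a * chi b) \<and>
     (\<forall>a. chi a \<noteq> 0 \<longleftrightarrow> coprime a (int n))"

definition principal_character :: "nat \<Rightarrow> int \<Rightarrow> complex" where
  "principal_character n a = (if coprime a (int n) then 1 else 0)"

definition primitive_character :: "nat \<Rightarrow> (int \<Rightarrow> complex) \<Rightarrow> bool" where
  "primitive_character n chi \<longleftrightarrow>
     dirichlet_character n chi \<and>
     \<not> (\<exists>d \<psi>. d dvd n \<and> d < n \<and> dirichlet_character d \<psi> \<and>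
              (\<forall>a. chi a = \<psi> a * principal_character n a))"

text \<open>The minimum below is over a nonempty set for every character modulo \<open>n\<close>, since
  \<open>\<phi>(n)\<close> belongs to it.\<close>

definition character_order :: "nat \<Rightarrow> (int \<Rightarrow> complex) \<Rightarrow> nat" where
  "character_order n chi = (LEAST k. k > 0 \<and> (\<lambda>a. chi a ^ k) = principal_character n)"

definition odd_character :: "(int \<Rightarrow> complex) \<Rightarrow> bool" where
  "odd_character \<xi> \<longleftrightarrow> \<xi> (-1) = -1"

definition pretentious_sum :: "(nat \<Rightarrow> complex) \<Rightarrow> real \<Rightarrow> real \<Rightarrow> real" where
  "pretentious_sum h X t =
     (\<Sum>p | prime p \<and> real p \<le> X. (1 - Re (h p * of_nat p powr (- (\<i> * of_real t)))) / real p)"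

text \<open>Written as an infimum; it is an attained minimum, see \<open>pretentious_min_attained\<close>.\<close>

definition pretentious_min :: "(nat \<Rightarrow> complex) \<Rightarrow> real \<Rightarrow> real \<Rightarrow> real" where
  "pretentious_min h X T = (INF t\<in>{t. \<bar>t\<bar> \<le> T}. pretentious_sum h X t)"

lemma pretentious_min_attained:
  assumes "T \<ge> 0"
  shows "\<exists>t. \<bar>t\<bar> \<le> T \<and> pretentious_min h X T = pretentious_sum h X t \<and>
             (\<forall>s. \<bar>s\<bar> \<le> T \<longrightarrow> pretentious_sum h X t \<le> pretentious_sum h X s)"
proof -
  have eq: "{t. \<bar>t\<bar> \<le> T} = {-T..T}"
    by auto
  have "continuous_on {-T..T} (pretentious_sum h X)"
    unfolding pretentious_sum_def by (auto intro!: continuous_intros simp: prime_gt_0_nat)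
  then obtain t where t: "t \<in> {-T..T}"
      "\<And>s. s \<in> {-T..T} \<Longrightarrow> pretentious_sum h X t \<le> pretentious_sum h X s"
    using continuous_attains_inf[of "{-T..T}" "pretentious_sum h X"] assms by auto
  have "pretentious_min h X T = pretentious_sum h X t"
    unfolding pretentious_min_def eq
    by (rule cInf_eq_minimum) (use t in auto)
  with t show ?thesis
    by (intro exI[of _ t]) (auto simp: abs_le_iff)
qed

definition delta :: "nat \<Rightarrow> real" where
  "delta g = 1 - real g / pi * sin (pi / real g)"

end

(* Since chi takes values in the g-th roots of unity, the pretentious sum is at least the sum over primes
   p <= y of (1 - F(cnj xi(p) * p^(-it))) / p, where F(w) is the maximum of Re(z * w) over z^g = 1.
   The Fourier series of F has mean 1 - delta g and its nonconstant terms are c_l * Re(w^(g*l)) with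
   c_l >= 0 for odd l and c_l <= 0 for even l.  As xi is odd and g is odd, xi^(g*l) is nonprincipal for
   odd l, and there log |L(s, cnj xi^(g*l))| is bounded above by O(log log log y).  For even l a lower bound
   suffices, which allows the principal character; it comes from the 3-4-1 inequality and, for real
   characters and small t, from Siegel's theorem.  No continuation to the left of the line Re s = 1 is
   needed except in Siegel's theorem, which is proved by Estermann's method. *)

theory Submission
  imports Defs "HOL-Complex_Analysis.Complex_Analysis" "HOL-Number_Theory.Number_Theory"
    "HOL-Real_Asymp.Real_Asymp"
begin

text \<open>The scale is T = ln y. An error \<epsilon> * ln T is allowed, so L-values matter only up
  to factors T^\<epsilon>. Crude tools therefore suffice: the modulus m (at most T^A) as a bound for
  character sums, Euler products compared with prime sums up to an absolute constant, and finitely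
  many harmonics l, because the Fourier series converges uniformly. Near the line, L-functions are
  replaced by Dirichlet polynomials whose length is a power of T. The obstacle is uniformity. The
  modulus q is not bounded in terms of y, so the primes dividing q, where chi vanishes, cannot be
  discarded. At such a prime the truncated series must itself be nonnegative up to a small error.
  For g >= 3 this holds because cos (x / g) >= 0 for |x| <= pi; for g = 1 primitivity forces q = 1.
  In m, uniformity rests on Siegel's bound, which has to cover imprimitive real characters:
  essentially the same L-function recurs for infinitely many moduli, and these repetitions are
  compared through the primes dividing the modulus.\<close>

section \<open>Euler products\<close>

text \<open>The term for \<open>n = 0\<close> vanishes, because \<open>0 powr z = 0\<close>.\<close>

definition dirser :: "(nat \<Rightarrow> complex) \<Rightarrow> complex \<Rightarrow> complex" where
  "dirser f s = (\<Sum>\<^sub>\<infinity>n. f n * of_nat n powr (-s))"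

definition on_primes :: "(nat \<Rightarrow> complex) \<Rightarrow> nat \<Rightarrow> complex" where
  "on_primes f n = (if prime n then f n else 0)"

abbreviation primeser :: "(nat \<Rightarrow> complex) \<Rightarrow> complex \<Rightarrow> complex" where
  "primeser f \<equiv> dirser (on_primes f)"

definition completely_mult :: "(nat \<Rightarrow> complex) \<Rightarrow> bool" where
  "completely_mult f \<longleftrightarrow> f 1 = 1 \<and> (\<forall>a b. f (a * b) = f a * f b) \<and> (\<forall>n. norm (f n) \<le> 1)"

lemma norm_nat_powr: "norm (of_nat n powr (-s) :: complex) = real n powr (- Re s)"
  using norm_powr_real_powr[of "of_nat n" "-s"] by (cases "n = 0") auto

lemma nat_powr_summable_on:
  assumes "\<sigma> > (1::real)" shows "(\<lambda>n::nat. real n powr (-\<sigma>)) summable_on A"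
proof -
  have "summable (\<lambda>n::nat. real n powr (-\<sigma>))" using assms by (simp add: summable_real_powr_iff)
  hence "(\<lambda>n::nat. real n powr (-\<sigma>)) summable_on UNIV"
    by (subst summable_on_UNIV_nonneg_real_iff) auto
  thus ?thesis using summable_on_subset_banach by blast
qed

lemma dirser_abs_summable:
  assumes "\<And>n. norm (f n) \<le> 1" "Re s > 1"
  shows "(\<lambda>n. norm (f n * of_nat n powr (-s))) summable_on A"
proof (rule Infinite_Sum.abs_summable_on_comparison_test'[OF nat_powr_summable_on[OF assms(2)]])
  fix n assume "n \<in> A"
  show "norm (f n * of_nat n powr (-s)) \<le> real n powr (- Re s)"
    using mult_right_mono[OF assms(1), of "real n powr (- Re s)" n] by (simp add: norm_mult norm_nat_powr)
qed

lemma dirser_summable: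
  assumes "\<And>n. norm (f n) \<le> 1" "Re s > 1"
  shows "(\<lambda>n. f n * of_nat n powr (-s)) summable_on A"
  using dirser_abs_summable[OF assms] by (rule Infinite_Sum.abs_summable_summable)

lemma dirser_sums:
  assumes "\<And>n. norm (f n) \<le> 1" "Re s > 1"
  shows "(\<lambda>n. f n * of_nat n powr (-s)) sums dirser f s"
  unfolding dirser_def using dirser_summable[OF assms]
  by (intro has_sum_imp_sums has_sum_infsum)

lemma norm_on_primes: "(\<And>n. norm (f n) \<le> 1) \<Longrightarrow> norm (on_primes f n) \<le> 1"
  by (simp add: on_primes_def)

section \<open>Sieving by finitely many primes\<close>

definition rough :: "nat set \<Rightarrow> nat set" where
  "rough S = {n. \<forall>p\<in>S. \<not> p dvd n}"

text \<open>Sieve of Eratosthenes: the multiples of \<open>p\<close> among the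
  \<open>S\<close>-rough numbers are exactly \<open>p\<close> times the \<open>S\<close>-rough
  numbers, so by complete multiplicativity each new prime multiplies the sum by 1 - f(p)
  p^(-s).\<close>

lemma infsum_rough:
  assumes f: "completely_mult f" and s: "Re s > 1" and S: "finite S" "\<And>p. p \<in> S \<Longrightarrow> prime p"
  shows "(\<Sum>\<^sub>\<infinity>n\<in>rough S. f n * of_nat n powr (-s))
           = (\<Prod>p\<in>S. 1 - f p * of_nat p powr (-s)) * dirser f s"
  using S
proof (induction S rule: finite_induct)
  case empty
  thus ?case by (simp add: rough_def dirser_def)
next
  case (insert p S)
  define h where "h = (\<lambda>n. f n * of_nat n powr (-s) :: complex)"
  have fm: "f (a * b) = f a * f b" for a b using f by (simp add: completely_mult_def)
  have sm: "h summable_on A" for A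
    unfolding h_def using f s by (intro dirser_summable) (auto simp: completely_mult_def)
  have p: "prime p" using insert by simp
  have hm: "h (p * n) = h p * h n" for n
    by (cases "n = 0") (use p in \<open>auto simp: h_def fm powr_times_real[of "of_nat p" "of_nat n"] prime_gt_0_nat\<close>)
  have ndvd: "q dvd p * n \<longleftrightarrow> q dvd n" if "q \<in> S" for q n
  proof -
    have "prime q" "q \<noteq> p" using insert that by auto
    hence "\<not> q dvd p" using p primes_dvd_imp_eq by blast
    thus ?thesis using \<open>prime q\<close> by (auto simp: prime_dvd_mult_iff)
  qed
  have split: "rough S = rough (insert p S) \<union> (\<lambda>n. p * n) ` rough S"
  proof (intro equalityI subsetI)
    fix n assume n: "n \<in> rough S"
    show "n \<in> rough (insert p S) \<union> (\<lambda>n. p * n) ` rough S"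
    proof (cases "p dvd n")
      case True
      then obtain k where k: "n = p * k" by (auto simp: dvd_def)
      have "k \<in> rough S" using n ndvd k unfolding rough_def by blast
      thus ?thesis using k by blast
    qed (use n in \<open>auto simp: rough_def\<close>)
  next
    fix n assume "n \<in> rough (insert p S) \<union> (\<lambda>n. p * n) ` rough S"
    thus "n \<in> rough S"
    proof
      assume "n \<in> (\<lambda>n. p * n) ` rough S"
      then obtain k where "n = p * k" "k \<in> rough S" by blast
      thus ?thesis using ndvd unfolding rough_def by blast
    qed (simp add: rough_def)
  qed
  have disj: "rough (insert p S) \<inter> (\<lambda>n. p * n) ` rough S = {}"
    by (auto simp: rough_def)
  have inj: "inj_on (\<lambda>n. p * n) (rough S)"
    using p by (auto simp: inj_on_def prime_gt_0_nat)
  have "infsum h (rough S) = infsum h (rough (insert p S)) + infsum h ((\<lambda>n. p * n) ` rough S)"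
    by (subst split, subst infsum_Un_disjoint) (use sm disj in auto)
  also have "infsum h ((\<lambda>n. p * n) ` rough S) = infsum (\<lambda>n. h p * h n) (rough S)"
    by (subst infsum_reindex[OF inj]) (simp add: o_def hm)
  also have "\<dots> = h p * infsum h (rough S)"
    by (rule infsum_cmult_right) (use sm in auto)
  finally have "infsum h (rough (insert p S)) = infsum h (rough S) - h p * infsum h (rough S)"
    by (metis add_diff_cancel_right')
  hence "infsum h (rough (insert p S)) = (1 - h p) * infsum h (rough S)"
    by (simp add: left_diff_distrib)
  thus ?case using insert by (simp add: h_def mult_ac)
qed

text \<open>The reciprocal of a partial Euler product, which keeps the sieve identity free of
  division.\<close>

definition euler_den :: "(nat \<Rightarrow> complex) \<Rightarrow> complex \<Rightarrow> nat \<Rightarrow> complex" where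
  "euler_den f s N = (\<Prod>p | prime p \<and> p \<le> N. 1 - f p * of_nat p powr (-s))"

definition powr_tail :: "real \<Rightarrow> nat \<Rightarrow> real" where
  "powr_tail \<sigma> N = (\<Sum>\<^sub>\<infinity>n\<in>{N<..}. real n powr (-\<sigma>))"

lemma powr_tail_tendsto: assumes "\<sigma> > 1" shows "powr_tail \<sigma> \<longlonglongrightarrow> 0"
proof -
  let ?h = "\<lambda>n::nat. real n powr (-\<sigma>)"
  have sm: "?h summable_on A" for A by (rule nat_powr_summable_on[OF assms])
  have eq: "powr_tail \<sigma> N = infsum ?h UNIV - sum ?h {..N}" for N
  proof -
    have "infsum ?h UNIV = infsum ?h ({..N} \<union> {N<..})" by (rule arg_cong[where f = "infsum ?h"]) auto
    also have "\<dots> = infsum ?h {..N} + infsum ?h {N<..}" by (rule infsum_Un_disjoint) (use sm in auto)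
    finally show ?thesis by (simp add: powr_tail_def)
  qed
  have "?h sums infsum ?h UNIV" using sm by (intro has_sum_imp_sums has_sum_infsum)
  hence "(\<lambda>N. sum ?h {..N}) \<longlonglongrightarrow> infsum ?h UNIV" by (simp add: sums_def_le)
  from tendsto_diff[OF tendsto_const this, of "infsum ?h UNIV"] show ?thesis by (simp add: eq[abs_def])
qed

lemma powr_tail_antimono:
  assumes "1 < \<sigma>" "\<sigma> \<le> \<sigma>'" shows "powr_tail \<sigma>' N \<le> powr_tail \<sigma> N"
  unfolding powr_tail_def
  by (rule infsum_mono) (use assms nat_powr_summable_on in \<open>auto intro!: powr_mono\<close>)

text \<open>After sieving by all primes up to \<open>N\<close>, only 1 and numbers beyond
  \<open>N\<close> survive. The bound does not depend on \<open>f\<close>, and on \<open>s\<close>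
  only through its real part; uniform convergence of Euler products follows from this.\<close>

lemma euler_den_dirser:
  assumes f: "completely_mult f" and s: "Re s > 1" and N: "N \<ge> 2"
  shows "norm (euler_den f s N * dirser f s - 1) \<le> powr_tail (Re s) N"
proof -
  define S where "S = {p. prime p \<and> p \<le> N}"
  define h where "h = (\<lambda>n. f n * of_nat n powr (-s) :: complex)"
  have f1: "\<And>n. norm (f n) \<le> 1" "f 1 = 1" using f by (auto simp: completely_mult_def)
  have fin: "finite S" by (rule finite_subset[of _ "{..N}"]) (auto simp: S_def)
  have sm: "h summable_on A" for A
    unfolding h_def using f1 s by (intro dirser_summable) auto
  have asm: "(\<lambda>n. norm (h n)) summable_on A" for A
    unfolding h_def using f1 s by (intro dirser_abs_summable) auto
  \<comment> \<open>Here \<open>N\<close> >= 2 matters: as soon as one prime is sieved out, 0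
    disappears as well.\<close>
  have "2 \<in> S" using N by (auto simp: S_def)
  hence z: "0 \<notin> rough S" by (auto simp: rough_def)
  have one: "1 \<in> rough S" by (auto simp: rough_def S_def)
  define B where "B = rough S - {1}"
  have B: "B \<subseteq> {N<..}"
  proof
    fix n assume n: "n \<in> B"
    hence "n \<noteq> 1" by (auto simp: B_def)
    then obtain p where p: "prime p" "p dvd n" using prime_factor_nat by blast
    have "n > 0" using n z by (cases n) (auto simp: B_def)
    hence "p \<le> n" using p by (intro dvd_imp_le) auto
    moreover have "p \<notin> S" using n p by (auto simp: B_def rough_def)
    ultimately show "n \<in> {N<..}" using p by (auto simp: S_def)
  qed
  have "infsum h (rough S) = infsum h ({1} \<union> B)" using one by (simp add: B_def insert_absorb)
  also have "\<dots> = infsum h {1} + infsum h B" by (rule infsum_Un_disjoint) (use sm in \<open>auto simp: B_def\<close>)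
  finally have "infsum h (rough S) - 1 = infsum h B" using f1 by (simp add: h_def)
  hence "norm (infsum h (rough S) - 1) \<le> infsum (\<lambda>n. norm (h n)) B"
    using norm_infsum_bound[OF asm] by simp
  also have "\<dots> \<le> infsum (\<lambda>n::nat. real n powr (- Re s)) {N<..}"
  proof (rule infsum_mono_neutral[OF asm nat_powr_summable_on[OF s]])
    fix n show "norm (h n) \<le> real n powr (- Re s)"
      using mult_right_mono[OF f1(1), of "real n powr (- Re s)" n] by (simp add: h_def norm_mult norm_nat_powr)
  qed (use B in auto)
  finally show ?thesis
    using infsum_rough[OF f s fin] unfolding h_def powr_tail_def euler_den_def S_def by simp
qed

lemma euler_den_dirser_tendsto:
  assumes f: "completely_mult f" and s: "Re s > 1"
  shows "(\<lambda>N. euler_den f s N * dirser f s) \<longlonglongrightarrow> 1"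
proof -
  have "(\<lambda>N. euler_den f s N * dirser f s - 1) \<longlonglongrightarrow> 0"
    by (rule Lim_null_comparison[OF _ powr_tail_tendsto[OF s]])
       (intro eventually_sequentiallyI[of 2] euler_den_dirser[OF f s])
  thus ?thesis by (simp add: LIM_zero_iff)
qed

text \<open>Squaring gives 1 - 2 Re z + |z|^2, and 1 + x <= exp x does the rest; no complex
  logarithm is involved. The factor 5 matches the lower bound that follows.\<close>

lemma norm_one_minus_upper: "norm (1 - z) \<le> exp (- Re z + 5 * (norm z)\<^sup>2)"
proof -
  have "(norm (1 - z))\<^sup>2 = 1 + (- 2 * Re z + (norm z)\<^sup>2)"
    unfolding cmod_power2 by (simp add: power2_diff)
  also have "\<dots> \<le> exp (- 2 * Re z + (norm z)\<^sup>2)" by (rule exp_ge_add_one_self)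
  also have "\<dots> \<le> exp (2 * (- Re z + 5 * (norm z)\<^sup>2))" by simp
  also have "\<dots> = (exp (- Re z + 5 * (norm z)\<^sup>2))\<^sup>2" by (rule exp_double)
  finally show ?thesis by (rule power2_le_imp_le) simp
qed

text \<open>The reciprocal 1 / (1 - z) = 1 + z + z^2 / (1 - z) is bounded from above. The 5 is 1 +
  4: the 1 comes from |1 + z|, and the remainder 2 |z|^2 becomes a factor exp (4 |z|^2) because the
  main factor is at least 1/2.\<close>

lemma norm_one_minus_lower:
  assumes "norm z \<le> 1/2"
  shows "exp (- Re z - 5 * (norm z)\<^sup>2) \<le> norm (1 - z)"
proof -
  define r where "r = norm z"
  have nz: "norm (1 - z) \<ge> 1/2" using norm_triangle_ineq2[of 1 z] assms by simp
  hence z1: "1 - z \<noteq> 0" by auto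
  have eq: "1 / (1 - z) = 1 - (-z) + z\<^sup>2 / (1 - z)"
    using z1 by (simp add: field_simps power2_eq_square)
  have "norm (1 / (1 - z)) \<le> norm (1 - (-z)) + norm (z\<^sup>2 / (1 - z))" unfolding eq by (rule norm_triangle_ineq)
  also have "norm (z\<^sup>2 / (1 - z)) \<le> 2 * r\<^sup>2"
  proof -
    have "(norm z)\<^sup>2 / norm (1 - z) \<le> (norm z)\<^sup>2 / (1/2)"
      by (rule divide_left_mono[OF nz]) (use nz in auto)
    thus ?thesis by (simp add: norm_divide norm_power r_def)
  qed
  also have "norm (1 - (-z)) \<le> exp (Re z + r\<^sup>2)"
  proof -
    have "(norm (1 - (-z)))\<^sup>2 = 1 + (2 * Re z + r\<^sup>2)"
      unfolding r_def cmod_power2 by (simp add: power2_sum)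
    also have "\<dots> \<le> exp (2 * Re z + r\<^sup>2)" by (rule exp_ge_add_one_self)
    also have "\<dots> \<le> exp (2 * (Re z + r\<^sup>2))" by simp
    also have "\<dots> = (exp (Re z + r\<^sup>2))\<^sup>2" by (rule exp_double)
    finally show ?thesis by (rule power2_le_imp_le) simp
  qed
  also have "exp (Re z + r\<^sup>2) + 2 * r\<^sup>2 \<le> exp (Re z + r\<^sup>2) * exp (4 * r\<^sup>2)"
  proof -
    have "Re z \<ge> - (1/2)" using abs_Re_le_cmod[of z] assms by linarith
    hence "Re z + r\<^sup>2 \<ge> -1/2" using zero_le_power2[of r] by linarith
    hence "1 + (Re z + r\<^sup>2) \<ge> 1/2" by simp
    hence e1: "exp (Re z + r\<^sup>2) \<ge> 1/2" using exp_ge_add_one_self[of "Re z + r\<^sup>2"] by linarith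
    have "exp (4 * r\<^sup>2) \<ge> 1 + 4 * r\<^sup>2" by (rule exp_ge_add_one_self)
    hence "exp (Re z + r\<^sup>2) * exp (4 * r\<^sup>2) \<ge> exp (Re z + r\<^sup>2) * (1 + 4 * r\<^sup>2)" by simp
    moreover have "exp (Re z + r\<^sup>2) * (4 * r\<^sup>2) \<ge> 1/2 * (4 * r\<^sup>2)" using e1 by (intro mult_right_mono) auto
    ultimately show ?thesis by (simp add: algebra_simps)
  qed
  finally have "norm (1 / (1 - z)) \<le> exp (Re z + 5 * r\<^sup>2)" by (simp add: exp_add[symmetric] algebra_simps)
  hence "1 / norm (1 - z) \<le> exp (Re z + 5 * r\<^sup>2)" by (simp add: norm_divide)
  hence "1 \<le> norm (1 - z) * exp (Re z + 5 * r\<^sup>2)" using z1 by (simp add: divide_le_eq mult.commute)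
  hence "1 / exp (Re z + 5 * r\<^sup>2) \<le> norm (1 - z)" by (simp add: divide_le_eq)
  hence "exp (- (Re z + 5 * r\<^sup>2)) \<le> norm (1 - z)" by (simp only: exp_minus inverse_eq_divide)
  thus ?thesis by (simp add: r_def algebra_simps)
qed

lemma sum_inverse_squares_le: "(\<Sum>n=2..N. 1 / (real n)\<^sup>2) \<le> 1"
proof -
  have "(\<Sum>n=2..N. 1 / (real n)\<^sup>2) \<le> 1 - 1 / real N" if "N \<ge> 1"
    using that
  proof (induction N rule: nat_induct_at_least)
    case (Suc n)
    have "1 / (real (Suc n))\<^sup>2 \<le> 1 / real n - 1 / real (Suc n)"
    proof -
      have "1 / real n - 1 / real (Suc n) = 1 / (real n * real (Suc n))"
        using Suc.hyps by (simp add: field_simps)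
      moreover have "1 / (real (Suc n))\<^sup>2 \<le> 1 / (real n * real (Suc n))"
        unfolding power2_eq_square using Suc.hyps by (intro divide_left_mono mult_right_mono) auto
      ultimately show ?thesis by simp
    qed
    moreover have "(\<Sum>k=2..Suc n. 1 / (real k)\<^sup>2) = (\<Sum>k=2..n. 1 / (real k)\<^sup>2) + 1 / (real (Suc n))\<^sup>2"
      using Suc.hyps by (simp add: sum.cl_ivl_Suc)
    ultimately show ?case using Suc.IH by linarith
  qed simp
  moreover have "1 - 1 / real N \<le> 1" by simp
  ultimately show ?thesis by (cases "N \<ge> 1") (use order_trans in blast, simp)
qed

text \<open>Since |z p| <= 1 / p, the quadratic errors add up to at most 5 times the sum of 1 / n^2
  over n >= 2, which is at most 1. Hence one constant 5 for all \<open>f\<close>, \<open>s\<close>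
  and \<open>N\<close>.\<close>

lemma norm_euler_den:
  assumes f: "\<And>n. norm (f n) \<le> 1" and s: "Re s > 1"
  defines "z \<equiv> \<lambda>n. on_primes f n * of_nat n powr (-s)"
  shows "exp (- (\<Sum>n\<le>N. Re (z n)) - 5) \<le> norm (euler_den f s N)"
    and "norm (euler_den f s N) \<le> exp (- (\<Sum>n\<le>N. Re (z n)) + 5)"
proof -
  define S where "S = {p. prime p \<and> p \<le> N}"
  have fin: "finite S" by (rule finite_subset[of _ "{..N}"]) (auto simp: S_def)
  have zb: "norm (z p) \<le> 1 / real p" if "p \<in> S" for p
  proof -
    have "p > 0" using that by (auto simp: S_def prime_gt_0_nat)
    have "norm (z p) \<le> real p powr (- Re s)"
      using mult_right_mono[OF f, of "real p powr (- Re s)" p] by (simp add: z_def on_primes_def norm_mult norm_nat_powr)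
    also have "\<dots> \<le> real p powr (-1)" using \<open>p > 0\<close> s by (intro powr_mono) auto
    finally show ?thesis using \<open>p > 0\<close> by (simp add: powr_minus_divide)
  qed
  have z2: "norm (z p) \<le> 1/2" if "p \<in> S" for p
  proof -
    have "p \<ge> 2" using that by (auto simp: S_def prime_ge_2_nat)
    hence "1 / real p \<le> 1 / 2" by (intro divide_left_mono) auto
    thus ?thesis using zb[OF that] by linarith
  qed
  have eq: "euler_den f s N = (\<Prod>p\<in>S. 1 - z p)"
    unfolding euler_den_def S_def by (intro prod.cong) (auto simp: z_def on_primes_def)
  have sre: "(\<Sum>n\<le>N. Re (z n)) = (\<Sum>p\<in>S. Re (z p))"
    by (rule sum.mono_neutral_right) (auto simp: S_def z_def on_primes_def)
  have "(\<Sum>p\<in>S. (norm (z p))\<^sup>2) \<le> (\<Sum>p\<in>S. 1 / (real p)\<^sup>2)"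
  proof (rule sum_mono)
    fix p assume "p \<in> S"
    from power_mono[OF zb[OF this], of 2] show "(norm (z p))\<^sup>2 \<le> 1 / (real p)\<^sup>2" by (simp add: power_divide)
  qed
  also have "\<dots> \<le> (\<Sum>n=2..N. 1 / (real n)\<^sup>2)"
    by (rule sum_mono2) (auto simp: S_def prime_ge_2_nat)
  also note sum_inverse_squares_le
  finally have sq: "(\<Sum>p\<in>S. (norm (z p))\<^sup>2) \<le> 1" .
  have "exp (- (\<Sum>p\<in>S. Re (z p)) - 5) \<le> exp (\<Sum>p\<in>S. - Re (z p) - 5 * (norm (z p))\<^sup>2)"
    using sq unfolding sum_subtractf sum_negf sum_distrib_left[symmetric] by simp
  also have "\<dots> = (\<Prod>p\<in>S. exp (- Re (z p) - 5 * (norm (z p))\<^sup>2))" by (rule exp_sum[OF fin])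
  also have "\<dots> \<le> (\<Prod>p\<in>S. norm (1 - z p))"
    by (intro prod_mono conjI norm_one_minus_lower z2 exp_ge_zero)
  finally show "exp (- (\<Sum>n\<le>N. Re (z n)) - 5) \<le> norm (euler_den f s N)"
    by (simp add: eq prod_norm sre)
  have "norm (euler_den f s N) \<le> (\<Prod>p\<in>S. exp (- Re (z p) + 5 * (norm (z p))\<^sup>2))"
    unfolding eq prod_norm[symmetric] by (intro prod_mono conjI norm_one_minus_upper norm_ge_zero)
  also have "\<dots> = exp (\<Sum>p\<in>S. - Re (z p) + 5 * (norm (z p))\<^sup>2)" by (rule exp_sum[OF fin, symmetric])
  also have "\<dots> \<le> exp (- (\<Sum>p\<in>S. Re (z p)) + 5)"
    using sq unfolding sum.distrib sum_negf sum_distrib_left[symmetric] by simp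
  finally show "norm (euler_den f s N) \<le> exp (- (\<Sum>n\<le>N. Re (z n)) + 5)" by (simp add: sre)
qed


text \<open>The two-way bridge between L-values and prime sums: ln |L(s)| and the real part of the
  sum over primes differ by at most 5 everywhere to the right of 1. It is the limit of the bounds
  for \<open>euler_den\<close>, whose product with the series tends to 1.\<close>

theorem dirser_euler_bounds:
  assumes f: "completely_mult f" and s: "Re s > 1"
  shows "exp (Re (primeser f s) - 5) \<le> norm (dirser f s)"
    and "norm (dirser f s) \<le> exp (Re (primeser f s) + 5)"
proof -
  have fb: "\<And>n. norm (f n) \<le> 1" using f by (auto simp: completely_mult_def)
  define z where "z = (\<lambda>n. on_primes f n * of_nat n powr (-s))"
  have nb: "exp (- (\<Sum>n\<le>N. Re (z n)) - 5) \<le> norm (euler_den f s N)"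
           "norm (euler_den f s N) \<le> exp (- (\<Sum>n\<le>N. Re (z n)) + 5)" for N
    using norm_euler_den[OF fb s] by (simp_all add: z_def)
  have "z sums primeser f s" unfolding z_def using norm_on_primes[of f, OF fb] s by (rule dirser_sums)
  hence "(\<lambda>N. \<Sum>n\<le>N. z n) \<longlonglongrightarrow> primeser f s" by (simp add: sums_def_le)
  from tendsto_Re[OF this] have lim: "(\<lambda>N. \<Sum>n\<le>N. Re (z n)) \<longlonglongrightarrow> Re (primeser f s)" by simp
  have lim1: "(\<lambda>N. norm (euler_den f s N) * norm (dirser f s)) \<longlonglongrightarrow> 1"
    using tendsto_norm[OF euler_den_dirser_tendsto[OF f s]] by (simp add: norm_mult)
  have l2: "(\<lambda>N. exp (- (\<Sum>n\<le>N. Re (z n)) + 5) * norm (dirser f s)) \<longlonglongrightarrow> exp (- Re (primeser f s) + 5) * norm (dirser f s)"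
    by (intro tendsto_intros lim)
  have "1 \<le> exp (- Re (primeser f s) + 5) * norm (dirser f s)"
    by (rule LIMSEQ_le[OF lim1 l2])
       (intro exI[of _ 0] allI impI mult_right_mono nb(2) norm_ge_zero)
  hence "exp (Re (primeser f s) - 5) * 1 \<le> exp (Re (primeser f s) - 5) * (exp (- Re (primeser f s) + 5) * norm (dirser f s))"
    by (intro mult_left_mono) auto
  thus "exp (Re (primeser f s) - 5) \<le> norm (dirser f s)"
    by (simp add: mult.assoc[symmetric] exp_add[symmetric])
  have l3: "(\<lambda>N. exp (- (\<Sum>n\<le>N. Re (z n)) - 5) * norm (dirser f s)) \<longlonglongrightarrow> exp (- Re (primeser f s) - 5) * norm (dirser f s)"
    by (intro tendsto_intros lim)
  have "exp (- Re (primeser f s) - 5) * norm (dirser f s) \<le> 1"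
    by (rule LIMSEQ_le[OF l3 lim1])
       (intro exI[of _ 0] allI impI mult_right_mono nb(1) norm_ge_zero)
  hence "exp (Re (primeser f s) + 5) * (exp (- Re (primeser f s) - 5) * norm (dirser f s)) \<le> exp (Re (primeser f s) + 5) * 1"
    by (intro mult_left_mono) auto
  thus "norm (dirser f s) \<le> exp (Re (primeser f s) + 5)"
    by (simp add: mult.assoc[symmetric] exp_add[symmetric])
qed


section \<open>Continuation to the right half plane\<close>

text \<open>The derivative of x^(-s) has norm |s| x^(-Re s - 1), which is |s| / Re s times the rate
  at which x^(-Re s) decreases. In this shape the bounds telescope when summed over consecutive
  integers.\<close>

lemma powr_diff_bound:
  assumes "0 < a" "a \<le> b" "Re s > 0"
  shows "norm (of_real a powr (-s) - of_real b powr (-s) :: complex)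
           \<le> norm s / Re s * (a powr (- Re s) - b powr (- Re s))"
proof (cases "a = b")
  case False
  hence ab: "a < b" using assms by simp
  have "norm (of_real b powr (-s) - of_real a powr (-s) :: complex)
          \<le> (- (norm s / Re s * b powr (- Re s))) - (- (norm s / Re s * a powr (- Re s)))"
  proof (rule differentiable_bound_general[OF ab])
    show "continuous_on {a..b} (\<lambda>x. - (norm s / Re s * x powr (- Re s)))"
      using assms by (intro continuous_intros) auto
    show "continuous_on {a..b} (\<lambda>x. of_real x powr (-s) :: complex)"
      using assms by (intro continuous_intros) (auto simp: complex_nonpos_Reals_iff)
    fix x assume x: "a < x" "x < b"
    hence "x > 0" using assms by simp
    have "((\<lambda>z. z powr (-s)) has_field_derivative (-s) * of_real x powr (-s-1)) (at (of_real x))"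
      using \<open>x > 0\<close> by (auto intro!: derivative_eq_intros simp: complex_nonpos_Reals_iff)
    from has_vector_derivative_real_field[OF this]
    show "((\<lambda>x. of_real x powr (-s)) has_vector_derivative (-s) * of_real x powr (-s-1)) (at x)" .
    show "((\<lambda>x. - (norm s / Re s * x powr (- Re s))) has_vector_derivative norm s * x powr (- Re s - 1)) (at x)"
      unfolding has_real_derivative_iff_has_vector_derivative[symmetric]
      using \<open>x > 0\<close> assms by (auto intro!: derivative_eq_intros)
    show "norm ((-s) * of_real x powr (-s-1)) \<le> norm s * x powr (- Re s - 1)"
      using \<open>x > 0\<close> by (simp add: norm_mult norm_powr_real_powr)
  qed
  thus ?thesis by (simp add: norm_minus_commute algebra_simps)
qed simp

abbreviation pos_half :: "complex set" where "pos_half \<equiv> {s. Re s > 0}"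

lemma open_pos_half: "open pos_half" by (rule open_halfspace_Re_gt)

section \<open>Series majorised by telescoping differences\<close>

definition ndrop :: "nat \<Rightarrow> real \<Rightarrow> real" where
  "ndrop n \<sigma> = real (Suc n) powr (-\<sigma>) - real (Suc (Suc n)) powr (-\<sigma>)"

lemma ndrop_sums: assumes "\<sigma> > 0" shows "(\<lambda>n. ndrop (n + N) \<sigma>) sums (real (Suc N) powr (-\<sigma>))"
proof -
  have "(\<lambda>n. real (Suc (n + N)) powr (-\<sigma>)) \<longlonglongrightarrow> 0" using assms by real_asymp
  from telescope_sums'[OF this] show ?thesis by (simp add: ndrop_def)
qed

context
  fixes t :: "nat \<Rightarrow> complex \<Rightarrow> complex" and B :: "complex \<Rightarrow> real"
  assumes tB: "\<And>n s. Re s > 0 \<Longrightarrow> norm (t n s) \<le> B s * ndrop n (Re s)"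
begin

lemma telescoping_summable: assumes "Re s > 0" shows "summable (\<lambda>n. t n s)"
proof (rule summable_comparison_test')
  show "summable (\<lambda>n. B s * ndrop n (Re s))"
    using ndrop_sums[OF assms, of 0] by (intro summable_mult) (simp add: sums_iff)
  show "norm (t n s) \<le> B s * ndrop n (Re s)" for n by (rule tB[OF assms])
qed

lemma telescoping_tail:
  assumes "Re s > 0"
  shows "norm ((\<Sum>n. t n s) - (\<Sum>n<N. t n s)) \<le> B s * real (Suc N) powr (- Re s)"
proof -
  have s1: "(\<lambda>n. B s * ndrop (n + N) (Re s)) sums (B s * real (Suc N) powr (- Re s))"
    by (intro sums_mult ndrop_sums assms)
  have "(\<Sum>n. t n s) - (\<Sum>n<N. t n s) = (\<Sum>n. t (n + N) s)"
    using suminf_split_initial_segment[OF telescoping_summable[OF assms], of N] by simp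
  also have "norm \<dots> \<le> (\<Sum>n. B s * ndrop (n + N) (Re s))"
    by (rule norm_suminf_le) (use s1 tB assms in \<open>auto simp: sums_iff\<close>)
  finally show ?thesis using s1 by (simp add: sums_iff)
qed

lemma telescoping_bound: assumes "Re s > 0" shows "norm (\<Sum>n. t n s) \<le> B s"
  using telescoping_tail[OF assms, of 0] by simp

text \<open>On the closed disc around x of radius Re x / 2 the real part stays at least Re x / 2 and
  \<open>B\<close> is bounded by compactness, so the explicit tails are uniformly small.\<close>

lemma telescoping_holomorphic:
  assumes hol: "\<And>n. t n holomorphic_on pos_half" and contB: "continuous_on pos_half B"
  shows "(\<lambda>s. \<Sum>n. t n s) holomorphic_on pos_half"
proof (rule holomorphic_uniform_sequence[OF open_pos_half, where f = "\<lambda>N s. \<Sum>n<N. t n s"])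
  show "(\<lambda>s. \<Sum>n<N. t n s) holomorphic_on pos_half" for N by (intro holomorphic_intros hol)
  fix x :: complex assume x: "x \<in> pos_half"
  define d where "d = Re x / 2"
  have d: "d > 0" using x by (simp add: d_def)
  have re: "Re s \<ge> d" if "s \<in> cball x d" for s
    using that abs_Re_le_cmod[of "x - s"] by (simp add: dist_norm d_def)
  hence sub: "cball x d \<subseteq> pos_half" using d by force
  have "compact (B ` cball x d)"
    by (rule compact_continuous_image[OF continuous_on_subset[OF contB sub] compact_cball])
  hence "bounded (B ` cball x d)" by (rule compact_imp_bounded)
  then obtain M where "\<forall>y\<in>B ` cball x d. norm y \<le> M" unfolding bounded_iff ..
  hence M: "\<And>s. s \<in> cball x d \<Longrightarrow> norm (B s) \<le> M" by simp
  have M0: "M \<ge> 0" using order_trans[OF norm_ge_zero M[of x]] d by simp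
  have "uniform_limit (cball x d) (\<lambda>N s. \<Sum>n<N. t n s) (\<lambda>s. \<Sum>n. t n s) sequentially"
  proof (rule uniform_limitI)
    fix e :: real assume e: "e > 0"
    have "(\<lambda>N. M * real (Suc N) powr (-d)) \<longlonglongrightarrow> 0" using d by real_asymp
    hence "\<forall>\<^sub>F N in sequentially. M * real (Suc N) powr (-d) < e" using e by (rule order_tendstoD)
    thus "\<forall>\<^sub>F N in sequentially. \<forall>s\<in>cball x d. dist (\<Sum>n<N. t n s) (\<Sum>n. t n s) < e"
    proof eventually_elim
      case (elim N)
      show ?case
      proof
        fix s assume s: "s \<in> cball x d"
        have "norm ((\<Sum>n. t n s) - (\<Sum>n<N. t n s)) \<le> B s * real (Suc N) powr (- Re s)"
          using s sub by (intro telescoping_tail) auto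
        also have "\<dots> \<le> M * real (Suc N) powr (-d)"
          using M[OF s] re[OF s] M0 by (intro mult_mono powr_mono) auto
        finally show "dist (\<Sum>n<N. t n s) (\<Sum>n. t n s) < e" using elim by (simp add: dist_norm norm_minus_commute)
      qed
    qed
  qed
  thus "\<exists>d>0. cball x d \<subseteq> pos_half \<and> uniform_limit (cball x d) (\<lambda>N s. \<Sum>n<N. t n s) (\<lambda>s. \<Sum>n. t n s) sequentially"
    using d sub by blast
qed

end

section \<open>Summation by parts for L-functions\<close>

definition partial_sum :: "(nat \<Rightarrow> complex) \<Rightarrow> nat \<Rightarrow> complex" where
  "partial_sum f n = (\<Sum>k=1..n. f k)"

definition dirser_upto :: "(nat \<Rightarrow> complex) \<Rightarrow> nat \<Rightarrow> complex \<Rightarrow> complex" where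
  "dirser_upto f N s = (\<Sum>k=1..N. f k * of_nat k powr (-s))"

text \<open>The term of the Abel summation that belongs to the integer n + 1. With bounded partial
  sums the resulting series converges for Re s > 0, not just for Re s > 1.\<close>

definition L_term :: "(nat \<Rightarrow> complex) \<Rightarrow> nat \<Rightarrow> complex \<Rightarrow> complex" where
  "L_term f n s = partial_sum f (Suc n) * (of_nat (Suc n) powr (-s) - of_nat (Suc (Suc n)) powr (-s))"

definition Lfun :: "(nat \<Rightarrow> complex) \<Rightarrow> complex \<Rightarrow> complex" where
  "Lfun f s = (\<Sum>n. L_term f n s)"

lemma nat_powr_diff_bound:
  assumes "Re s > 0"
  shows "norm (of_nat (Suc n) powr (-s) - of_nat (Suc (Suc n)) powr (-s) :: complex)
           \<le> norm s / Re s * ndrop n (Re s)"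
  using powr_diff_bound[of "real (Suc n)" "real (Suc (Suc n))" s] assms
  unfolding ndrop_def of_real_of_nat_eq by simp

lemma one_le_norm_div_Re: "Re s > 0 \<Longrightarrow> 1 \<le> norm s / Re s"
  using complex_Re_le_cmod[of s] by simp

context
  fixes f :: "nat \<Rightarrow> complex" and m :: real
  assumes ps: "\<And>n. norm (partial_sum f n) \<le> m"
begin

lemma partial_sum_bound_nonneg: "m \<ge> 0" using ps[of 0] by (simp add: partial_sum_def)

lemma norm_L_term: assumes "Re s > 0" shows "norm (L_term f n s) \<le> m * (norm s / Re s) * ndrop n (Re s)"
  using mult_mono[OF ps[of "Suc n"] nat_powr_diff_bound[OF assms, of n]] partial_sum_bound_nonneg
  unfolding L_term_def norm_mult by (simp add: mult.assoc)

lemma norm_Lfun: "Re s > 0 \<Longrightarrow> norm (Lfun f s) \<le> m * (norm s / Re s)"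
  unfolding Lfun_def by (rule telescoping_bound[OF norm_L_term])

lemma Lfun_holomorphic: "Lfun f holomorphic_on pos_half"
  unfolding Lfun_def[abs_def]
proof (rule telescoping_holomorphic[where B = "\<lambda>s. m * (norm s / Re s)"])
  show "Re s > 0 \<Longrightarrow> norm (L_term f n s) \<le> m * (norm s / Re s) * ndrop n (Re s)" for n s
    by (rule norm_L_term)
  show "L_term f n holomorphic_on pos_half" for n
    unfolding L_term_def[abs_def] by (intro holomorphic_intros) (auto simp del: of_nat_Suc)
  show "continuous_on pos_half (\<lambda>s. m * (norm s / Re s))"
    by (intro continuous_intros) auto
qed

lemma dirser_upto_eq_L_terms: "dirser_upto f N s = (\<Sum>n<N. L_term f n s) + partial_sum f N * of_nat (Suc N) powr (-s)"
  by (induction N) (simp_all add: dirser_upto_def partial_sum_def L_term_def algebra_simps del: of_nat_Suc)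

text \<open>Half of the bound is the tail of the Abel-summed series, the other half its boundary
  term at \<open>N\<close>; since |s| / Re s >= 1, the boundary term fits the same shape.\<close>

lemma Lfun_dirser_upto:
  assumes "Re s > 0"
  shows "norm (Lfun f s - dirser_upto f N s) \<le> 2 * m * (norm s / Re s) * real (Suc N) powr (- Re s)"
proof -
  have "norm (Lfun f s - dirser_upto f N s)
          = norm ((Lfun f s - (\<Sum>n<N. L_term f n s)) - partial_sum f N * of_nat (Suc N) powr (-s))"
    unfolding dirser_upto_eq_L_terms by (simp add: algebra_simps)
  also have "\<dots> \<le> norm (Lfun f s - (\<Sum>n<N. L_term f n s)) + norm (partial_sum f N * of_nat (Suc N) powr (-s))"
    by (rule norm_triangle_ineq4)
  also have "norm (Lfun f s - (\<Sum>n<N. L_term f n s)) \<le> m * (norm s / Re s) * real (Suc N) powr (- Re s)"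
    unfolding Lfun_def by (rule telescoping_tail[OF norm_L_term assms])
  also have "norm (partial_sum f N * of_nat (Suc N) powr (-s)) \<le> m * real (Suc N) powr (- Re s)"
    unfolding norm_mult norm_nat_powr by (rule mult_right_mono[OF ps]) simp
  also have "m * real (Suc N) powr (- Re s) \<le> m * (norm s / Re s) * real (Suc N) powr (- Re s)"
    using mult_left_mono[OF one_le_norm_div_Re[OF assms] partial_sum_bound_nonneg] by (intro mult_right_mono) auto
  finally show ?thesis by simp
qed

lemma dirser_upto_tendsto_Lfun: assumes "Re s > 0" shows "(\<lambda>N. dirser_upto f N s) \<longlonglongrightarrow> Lfun f s"
proof -
  have "(\<lambda>N. 2 * m * (norm s / Re s) * real (Suc N) powr (- Re s)) \<longlonglongrightarrow> 0"
    using assms by real_asymp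
  hence "(\<lambda>N. Lfun f s - dirser_upto f N s) \<longlonglongrightarrow> 0"
    by (rule Lim_null_comparison[rotated]) (intro always_eventually allI Lfun_dirser_upto assms)
  from tendsto_diff[OF tendsto_const[of "Lfun f s"] this] show ?thesis by simp
qed

end

lemma dirser_upto_tendsto_dirser:
  assumes "\<And>n. norm (f n) \<le> 1" "Re s > 1"
  shows "(\<lambda>N. dirser_upto f N s) \<longlonglongrightarrow> dirser f s"
proof -
  have "dirser_upto f N s = (\<Sum>k\<le>N. f k * of_nat k powr (-s))" for N
    unfolding dirser_upto_def by (rule sum.mono_neutral_left) (auto simp: not_le)
  thus ?thesis using dirser_sums[OF assms] by (simp add: sums_def_le)
qed

lemma Lfun_eq_dirser:
  assumes "\<And>n. norm (partial_sum f n) \<le> m" "\<And>n. norm (f n) \<le> 1" "Re s > 1"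
  shows "Lfun f s = dirser f s"
  using dirser_upto_tendsto_Lfun[of f m s, OF assms(1)] dirser_upto_tendsto_dirser[of f s, OF assms(2,3)] assms(3)
  by (intro LIMSEQ_unique[of "\<lambda>N. dirser_upto f N s"]) auto

text \<open>This is (s - 1) times the integral of (n + 1)^(-s) - x^(-s) over [n + 1, n + 2]. For Re
  s > 1 the subtracted brackets telescope to 1, which \<open>zeta_reg\<close> puts back.\<close>

definition zeta_term :: "nat \<Rightarrow> complex \<Rightarrow> complex" where
  "zeta_term n s = (s - 1) * of_nat (Suc n) powr (-s) - (of_nat (Suc n) powr (1 - s) - of_nat (Suc (Suc n)) powr (1 - s))"

text \<open>This is \<open>(s - 1) * \<zeta>(s)\<close>, continued to the right half plane.\<close>

definition zeta_reg :: "complex \<Rightarrow> complex" where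
  "zeta_reg s = 1 + (\<Sum>n. zeta_term n s)"

text \<open>The factor |s - 1| is kept because it makes \<open>zeta_reg\<close> equal to 1 at s = 1,
  that is, the residue of zeta equal to 1, and controls \<open>zeta_reg\<close> near that
  point.\<close>

lemma norm_zeta_term:
  assumes "Re s > 0"
  shows "norm (zeta_term n s) \<le> norm (s - 1) * (norm s / Re s) * ndrop n (Re s)"
proof -
  define a where "a = real (Suc n)"
  have a: "a > 0" by (simp add: a_def)
  \<comment> \<open>The increment of \<open>g\<close> over [a, a + 1] is
    \<open>zeta_term n s\<close>, and its derivative is (s - 1) * (a^(-s) - x^(-s)), so a mean value
    bound takes the place of the integral.\<close>
  define g where "g = (\<lambda>x::real. (s - 1) * of_real a powr (-s) * of_real x + of_real x powr (1 - s) :: complex)"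
  define M where "M = norm (s - 1) * (norm s / Re s) * ndrop n (Re s)"
  have "norm (g (a + 1) - g a) \<le> M * (a + 1) - M * a"
  proof (rule differentiable_bound_general)
    show "continuous_on {a..a+1} g"
      unfolding g_def using a by (intro continuous_intros) (auto simp: complex_nonpos_Reals_iff)
    show "continuous_on {a..a+1} (\<lambda>x. M * x)" by (intro continuous_intros)
    fix x assume x: "a < x" "x < a + 1"
    hence "x > 0" using a by simp
    show "((\<lambda>x. M * x) has_vector_derivative M) (at x)"
      unfolding has_real_derivative_iff_has_vector_derivative[symmetric] by (auto intro!: derivative_eq_intros)
    have "((\<lambda>z. (s - 1) * of_real a powr (-s) * z + z powr (1-s)) has_field_derivative
             ((s - 1) * of_real a powr (-s) + (1-s) * of_real x powr (-s))) (at (of_real x))"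
      using \<open>x > 0\<close> by (auto intro!: derivative_eq_intros simp: complex_nonpos_Reals_iff)
    from has_vector_derivative_real_field[OF this]
    show "(g has_vector_derivative ((s - 1) * of_real a powr (-s) + (1-s) * of_real x powr (-s))) (at x)"
      unfolding g_def .
    have "(s - 1) * of_real a powr (-s) + (1-s) * of_real x powr (-s) = (s - 1) * (of_real a powr (-s) - of_real x powr (-s))"
      by (simp add: algebra_simps)
    also have "norm \<dots> \<le> norm (s - 1) * (norm s / Re s * (a powr (- Re s) - x powr (- Re s)))"
      unfolding norm_mult using x a assms by (intro mult_left_mono powr_diff_bound) auto
    also have "\<dots> \<le> norm (s - 1) * (norm s / Re s * ndrop n (Re s))"
    proof (intro mult_left_mono)
      show "a powr (- Re s) - x powr (- Re s) \<le> ndrop n (Re s)"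
        unfolding ndrop_def using x a assms powr_mono2'[of "- Re s" x "a + 1"] by (simp add: a_def add.commute)
    qed (use assms in auto)
    finally show "norm ((s - 1) * of_real a powr (-s) + (1-s) * of_real x powr (-s)) \<le> M"
      by (simp add: M_def mult.assoc)
  qed auto
  moreover have "g (a + 1) - g a = zeta_term n s"
    by (simp add: g_def zeta_term_def a_def algebra_simps)
  moreover have "M * (a + 1) - M * a = M" by (simp add: algebra_simps)
  ultimately show ?thesis unfolding M_def by simp
qed

lemma zeta_reg_holomorphic: "zeta_reg holomorphic_on pos_half"
  unfolding zeta_reg_def[abs_def]
proof (intro holomorphic_intros telescoping_holomorphic[where B = "\<lambda>s. norm (s - 1) * (norm s / Re s)"])
  show "Re s > 0 \<Longrightarrow> norm (zeta_term n s) \<le> norm (s - 1) * (norm s / Re s) * ndrop n (Re s)" for n s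
    by (rule norm_zeta_term)
  show "zeta_term n holomorphic_on pos_half" for n
    unfolding zeta_term_def[abs_def] by (intro holomorphic_intros) (auto simp del: of_nat_Suc)
  show "continuous_on pos_half (\<lambda>s. norm (s - 1) * (norm s / Re s))"
    by (intro continuous_intros) auto
qed

lemma norm_zeta_reg_minus_one: "Re s > 0 \<Longrightarrow> norm (zeta_reg s - 1) \<le> norm (s - 1) * (norm s / Re s)"
  unfolding zeta_reg_def using telescoping_bound[OF norm_zeta_term] by simp

lemma zeta_reg_1: "zeta_reg 1 = 1" using norm_zeta_reg_minus_one[of 1] by simp

lemma dirser_upto_eq_zeta_terms: "(s - 1) * dirser_upto (\<lambda>_. 1) N s = (\<Sum>n<N. zeta_term n s) + 1 - of_nat (Suc N) powr (1 - s)"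
  by (induction N) (simp_all add: dirser_upto_def zeta_term_def algebra_simps of_nat_Suc[of 0] del: of_nat_Suc)

lemma zeta_reg_dirser_upto:
  assumes "Re s > 0"
  shows "norm (zeta_reg s - (s - 1) * dirser_upto (\<lambda>_. 1) N s - of_nat (Suc N) powr (1 - s))
           \<le> norm (s - 1) * (norm s / Re s) * real (Suc N) powr (- Re s)"
  using telescoping_tail[OF norm_zeta_term assms, of N] unfolding dirser_upto_eq_zeta_terms zeta_reg_def by (simp add: algebra_simps)

lemma zeta_reg_eq_dirser:
  assumes "Re s > 1"
  shows "zeta_reg s = (s - 1) * dirser (\<lambda>_. 1) s"
proof (rule LIMSEQ_unique)
  have r: "Re s > 0" using assms by simp
  have "(\<lambda>N. norm (s - 1) * (norm s / Re s) * real (Suc N) powr (- Re s)) \<longlonglongrightarrow> 0"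
    using r by real_asymp
  hence "(\<lambda>N. zeta_reg s - (s - 1) * dirser_upto (\<lambda>_. 1) N s - of_nat (Suc N) powr (1 - s)) \<longlonglongrightarrow> 0"
    by (rule Lim_null_comparison[rotated]) (intro always_eventually allI zeta_reg_dirser_upto r)
  moreover have "(\<lambda>N. of_nat (Suc N) powr (1 - s) :: complex) \<longlonglongrightarrow> 0"
  proof (rule tendsto_norm_zero_cancel)
    have "norm (of_nat (Suc N) powr (1 - s) :: complex) = real (Suc N) powr (1 - Re s)" for N
      using norm_nat_powr[of "Suc N" "s - 1"] by simp
    moreover have "(\<lambda>N. real (Suc N) powr (1 - Re s)) \<longlonglongrightarrow> 0" using assms by real_asymp
    ultimately show "(\<lambda>N. norm (of_nat (Suc N) powr (1 - s) :: complex)) \<longlonglongrightarrow> 0" by simp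
  qed
  ultimately have "(\<lambda>N. zeta_reg s - (s - 1) * dirser_upto (\<lambda>_. 1) N s) \<longlonglongrightarrow> 0"
    using tendsto_add by fastforce
  from tendsto_diff[OF tendsto_const[of "zeta_reg s"] this]
  show "(\<lambda>N. (s - 1) * dirser_upto (\<lambda>_. 1) N s) \<longlonglongrightarrow> zeta_reg s" by simp
  show "(\<lambda>N. (s - 1) * dirser_upto (\<lambda>_. 1) N s) \<longlonglongrightarrow> (s - 1) * dirser (\<lambda>_. 1) s"
    by (intro tendsto_intros dirser_upto_tendsto_dirser) (use assms in auto)
qed


section \<open>Sums over primes\<close>

text \<open>On the positive real axis |s| / Re s = 1, so \<open>zeta_reg\<close> differs from 1 by
  at most d <= 1/2 and zeta (1 + d) is 1 / d up to a factor 2.\<close>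

lemma dirser_one_bounds:
  assumes "0 < d" "d \<le> 1/2"
  shows "1 / (2 * d) \<le> norm (dirser (\<lambda>_. 1) (of_real (1 + d)))"
    and "norm (dirser (\<lambda>_. 1) (of_real (1 + d))) \<le> 2 / d"
proof -
  define s :: complex where "s = of_real (1 + d)"
  have "norm s = 1 + d" using assms unfolding s_def norm_of_real by simp
  hence s: "norm s / Re s = 1" "Re s > 0" "norm (s - 1) = d" using assms by (simp_all add: s_def)
  have z: "norm (zeta_reg s - 1) \<le> d" using norm_zeta_reg_minus_one[OF s(2)] s by simp
  have eq: "norm (zeta_reg s) = d * norm (dirser (\<lambda>_. 1) s)"
    using zeta_reg_eq_dirser[of s] assms s(3) by (simp add: norm_mult s_def)
  have "norm (zeta_reg s) \<le> 1 + d" using norm_triangle_ineq[of 1 "zeta_reg s - 1"] z by simp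
  hence "d * norm (dirser (\<lambda>_. 1) s) \<le> 2" using assms eq by simp
  thus "norm (dirser (\<lambda>_. 1) (of_real (1 + d))) \<le> 2 / d"
    unfolding s_def using assms by (simp add: pos_le_divide_eq mult.commute)
  have "norm (zeta_reg s) \<ge> 1 - d" using norm_triangle_ineq4[of "zeta_reg s" "zeta_reg s - 1"] z by simp
  hence "d * norm (dirser (\<lambda>_. 1) s) \<ge> 1 / 2" using assms eq by simp
  thus "1 / (2 * d) \<le> norm (dirser (\<lambda>_. 1) (of_real (1 + d)))"
    unfolding s_def using assms by (simp add: pos_divide_le_eq mult_ac)
qed

lemma completely_mult_one: "completely_mult (\<lambda>_. 1)" by (simp add: completely_mult_def)

definition prime_zeta :: "real \<Rightarrow> real" where
  "prime_zeta d = Re (primeser (\<lambda>_. 1) (of_real (1 + d)))"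

lemma prime_zeta_bounds:
  assumes "0 < d" "d \<le> 1/2"
  shows "\<bar>prime_zeta d - ln (1 / d)\<bar> \<le> 6"
proof -
  have s: "Re (of_real (1 + d)) > 1" using assms by simp
  note e = dirser_euler_bounds[OF completely_mult_one s, folded prime_zeta_def]
  have "exp (prime_zeta d - 5) \<le> 2 / d" using e(1) dirser_one_bounds(2)[OF assms] by linarith
  hence "ln (exp (prime_zeta d - 5)) \<le> ln (2 * (1 / d))" using assms by (subst ln_le_cancel_iff) auto
  also have "\<dots> = ln 2 + ln (1 / d)" using assms by (subst ln_mult) auto
  finally have 1: "prime_zeta d \<le> ln (1 / d) + 6" using ln_2_less_1 by simp
  have "1 / (2 * d) \<le> exp (prime_zeta d + 5)" using e(2) dirser_one_bounds(1)[OF assms] by linarith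
  hence "ln ((1 / d) / 2) \<le> ln (exp (prime_zeta d + 5))" using assms by (subst ln_le_cancel_iff) (auto simp: mult.commute)
  moreover have "ln ((1 / d) / 2) = ln (1 / d) - ln 2" using assms by (subst ln_div) auto
  ultimately have "prime_zeta d \<ge> ln (1 / d) - 6" using ln_2_less_1 by simp
  with 1 show ?thesis by simp
qed

definition prime_term :: "real \<Rightarrow> nat \<Rightarrow> real" where
  "prime_term d n = (if prime n then real n powr (-1 - d) else 0)"

lemma prime_term_sums: assumes "d > 0" shows "prime_term d sums prime_zeta d"
proof -
  have "(\<lambda>n. on_primes (\<lambda>_. 1) n * of_nat n powr (- of_real (1 + d))) sums primeser (\<lambda>_. 1) (of_real (1 + d))"
    by (rule dirser_sums) (use assms in \<open>auto simp: on_primes_def\<close>)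
  from sums_Re[OF this] have "(\<lambda>n. Re (on_primes (\<lambda>_. 1) n * of_nat n powr (- of_real (1 + d)))) sums prime_zeta d"
    by (simp add: prime_zeta_def)
  moreover have "Re (on_primes (\<lambda>_. 1) n * of_nat n powr (- of_real (1 + d))) = prime_term d n" for n
    using powr_of_real[of "real n" "- (1 + d)"] by (simp add: on_primes_def prime_term_def)
  ultimately show ?thesis by simp
qed

text \<open>The weights \<open>ln n\<close> are absorbed by a difference quotient of \<open>prime_zeta\<close>, so neither
  Chebyshev's nor Mertens' estimates are needed.\<close>

lemma log_prime_sum_bound:
  assumes "0 < d" "d \<le> 1/2"
  shows "(\<Sum>n\<le>N. ln (real n) * prime_term d n) \<le> 26 / d"
proof -
  have le: "d / 2 * (ln (real n) * prime_term d n) \<le> prime_term (d/2) n - prime_term d n" for n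
  proof (cases "prime n")
    case True
    hence n: "n > 0" by (simp add: prime_gt_0_nat)
    have "1 + d / 2 * ln (real n) \<le> exp (d / 2 * ln (real n))" by (rule exp_ge_add_one_self)
    also have "\<dots> = real n powr (d / 2)" using n by (simp add: powr_def)
    finally have "(d / 2 * ln (real n)) * real n powr (-1 - d) \<le> (real n powr (d / 2) - 1) * real n powr (-1 - d)"
      by (intro mult_right_mono) auto
    also have "\<dots> = real n powr (-1 - d/2) - real n powr (-1 - d)"
    proof -
      have "d/2 + (-1 - d) = -1 - d/2" by simp
      thus ?thesis by (simp only: left_diff_distrib powr_add[symmetric] mult_1_left)
    qed
    finally show ?thesis using True by (simp add: prime_term_def mult_ac)
  qed (simp add: prime_term_def)
  have d2: "0 < d / 2" "d / 2 \<le> 1 / 2" using assms by auto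
  have sm: "(\<lambda>n. prime_term (d/2) n - prime_term d n) sums (prime_zeta (d/2) - prime_zeta d)"
    using assms by (intro sums_diff prime_term_sums) auto
  have nn: "prime_term (d/2) n - prime_term d n \<ge> 0" for n
  proof (cases "prime n")
    case True
    hence "n \<ge> 1" using prime_gt_0_nat[of n] by linarith
    thus ?thesis using assms by (auto simp: prime_term_def intro!: powr_mono)
  qed (simp add: prime_term_def)
  have "d / 2 * (\<Sum>n\<le>N. ln (real n) * prime_term d n) \<le> (\<Sum>n\<le>N. prime_term (d/2) n - prime_term d n)"
    unfolding sum_distrib_left by (intro sum_mono le)
  also have "\<dots> \<le> (\<Sum>n. prime_term (d/2) n - prime_term d n)"
    by (intro sum_le_suminf) (use sm nn in \<open>auto simp: sums_iff\<close>)
  also have "\<dots> = prime_zeta (d/2) - prime_zeta d" using sm by (simp add: sums_iff)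
  \<comment> \<open>Each comparison of \<open>prime_zeta\<close> with a logarithm costs 6, and the
    logarithms differ by ln 2 < 1. This gives 13, and division by d / 2 turns it into 26 /
    d.\<close>
  also have "\<dots> \<le> ln (1 / (d/2)) - ln (1 / d) + 12"
    using prime_zeta_bounds[OF d2] prime_zeta_bounds[OF assms] by linarith
  also have "ln (1 / (d/2)) = ln 2 + ln (1 / d)"
    using assms ln_mult[of 2 "1/d"] by simp
  finally have "d / 2 * (\<Sum>n\<le>N. ln (real n) * prime_term d n) \<le> 13" using ln_2_less_1 by simp
  thus ?thesis using assms by (simp add: field_simps)
qed

definition primes_le :: "real \<Rightarrow> nat set" where
  "primes_le y = {p. prime p \<and> real p \<le> y}"

lemma finite_primes_le: "finite (primes_le y)"
proof (rule finite_subset)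
  show "primes_le y \<subseteq> {..nat \<lfloor>y\<rfloor>}" by (auto simp: primes_le_def le_nat_floor)
qed simp

lemma prime_sum_compare:
  assumes f: "\<And>n. norm (f n) \<le> 1" and y: "ln y \<ge> 2" and y0: "y > 1"
  shows "norm ((\<Sum>p\<in>primes_le y. f p / of_nat p) - primeser f (of_real (1 + 1 / ln y))) \<le> 52"
proof -
  define d where "d = 1 / ln y"
  have d: "0 < d" "d \<le> 1/2" using y by (auto simp: d_def field_simps)
  define z where "z = (\<lambda>n. on_primes f n * of_nat n powr (- of_real (1 + d)))"
  define w where "w = (\<lambda>n. if n \<in> primes_le y then f n / of_nat n else 0)"
  have wz: "norm (w n - z n) \<le> 2 * d * (ln (real n) * prime_term d n)" for n
  proof (cases "prime n")
    case True
    hence n: "n > 0" by (simp add: prime_gt_0_nat)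
    have zn: "z n = f n * of_real (real n powr (-1 - d))"
      using True powr_of_real[of "real n" "- (1 + d)"] by (simp add: z_def on_primes_def)
    have x0: "d * ln (real n) \<ge> 0" using n d by simp
    show ?thesis
    proof (cases "real n \<le> y")
      case le: True
      hence "ln (real n) \<le> ln y" using n by simp
      hence x: "d * ln (real n) \<le> 1" using y by (simp add: d_def field_simps)
      have "w n = f n * of_real (real n powr (-1))"
        using True le n by (simp add: w_def primes_le_def powr_minus_divide)
      hence "w n - z n = f n * of_real (real n powr (-1) - real n powr (-1 - d))"
        by (simp add: zn right_diff_distrib)
      hence "norm (w n - z n) = norm (f n) * \<bar>real n powr (-1) - real n powr (-1 - d)\<bar>"
        by (simp only: norm_mult norm_of_real)
      also have "\<dots> \<le> 1 * \<bar>real n powr (-1) - real n powr (-1 - d)\<bar>"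
        by (intro mult_right_mono f) auto
      also have "\<dots> = real n powr (-1) - real n powr (-1 - d)"
      proof -
        have "real n powr (-1 - d) \<le> real n powr (-1)" using n d by (intro powr_mono) auto
        thus ?thesis by (simp only: mult_1_left abs_of_nonneg diff_ge_0_iff_ge)
      qed
      also have "\<dots> = (real n powr d - 1) * real n powr (-1 - d)"
        using n by (simp add: left_diff_distrib powr_add[symmetric])
      also have "real n powr d = exp (d * ln (real n))" using n by (simp add: powr_def)
      also have "exp (d * ln (real n)) \<le> 1 + d * ln (real n) + (d * ln (real n))\<^sup>2"
        by (rule exp_bound[OF x0 x])
      also have "(d * ln (real n))\<^sup>2 \<le> d * ln (real n)"
        using mult_left_mono[OF x x0] by (simp add: power2_eq_square)
      finally have "norm (w n - z n) \<le> (2 * (d * ln (real n))) * real n powr (-1 - d)"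
        by (simp add: mult_right_mono)
      thus ?thesis using True by (simp add: prime_term_def mult_ac)
    next
      case False
      hence "ln (real n) \<ge> ln y" using n y0 by simp
      hence x: "d * ln (real n) \<ge> 1" using y by (simp add: d_def field_simps)
      have "norm (w n - z n) = norm (f n) * real n powr (-1 - d)"
        using False by (simp add: w_def primes_le_def zn norm_mult)
      also have "\<dots> \<le> 1 * real n powr (-1 - d)" by (intro mult_right_mono f) auto
      also have "\<dots> \<le> (2 * (d * ln (real n))) * real n powr (-1 - d)"
        by (intro mult_right_mono) (use x in auto)
      finally show ?thesis using True by (simp add: prime_term_def mult_ac)
    qed
  qed (simp add: w_def z_def on_primes_def primes_le_def prime_term_def)
  have "z sums primeser f (of_real (1 + d))"
    unfolding z_def using norm_on_primes[of f, OF f] d by (intro dirser_sums) auto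
  moreover have "w sums (\<Sum>p\<in>primes_le y. f p / of_nat p)"
    using sums_If_finite_set[OF finite_primes_le, of y "\<lambda>n. f n / of_nat n"] by (simp add: w_def)
  ultimately have "(\<lambda>n. w n - z n) sums ((\<Sum>p\<in>primes_le y. f p / of_nat p) - primeser f (of_real (1 + d)))"
    by (rule sums_diff[rotated])
  hence "(\<lambda>N. norm (\<Sum>n\<le>N. w n - z n)) \<longlonglongrightarrow> norm ((\<Sum>p\<in>primes_le y. f p / of_nat p) - primeser f (of_real (1 + d)))"
    by (intro tendsto_norm) (simp add: sums_def_le)
  moreover have "norm (\<Sum>n\<le>N. w n - z n) \<le> 52" for N
  proof -
    have "norm (\<Sum>n\<le>N. w n - z n) \<le> (\<Sum>n\<le>N. 2 * d * (ln (real n) * prime_term d n))"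
      by (rule sum_norm_le) (rule wz)
    also have "\<dots> = 2 * d * (\<Sum>n\<le>N. ln (real n) * prime_term d n)" by (simp add: sum_distrib_left)
    also have "\<dots> \<le> 2 * d * (26 / d)" using d by (intro mult_left_mono log_prime_sum_bound) auto
    finally show ?thesis using d by simp
  qed
  ultimately show ?thesis unfolding d_def by (intro LIMSEQ_le_const2) auto
qed

text \<open>Mertens' second theorem with a bounded error, as the case f = 1 of the comparison; 58 =
  52 + 6.\<close>

lemma sum_inverse_primes:
  assumes y: "ln y \<ge> 2" and y0: "y > 1"
  shows "\<bar>(\<Sum>p\<in>primes_le y. 1 / real p) - ln (ln y)\<bar> \<le> 58"
proof -
  have d: "0 < 1 / ln y" "1 / ln y \<le> 1/2" using y by (auto simp: field_simps)
  have "norm ((\<Sum>p\<in>primes_le y. (\<lambda>_. 1) p / of_nat p) - primeser (\<lambda>_. 1) (of_real (1 + 1 / ln y))) \<le> 52"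
    by (rule prime_sum_compare[OF _ y y0]) simp
  from order_trans[OF abs_Re_le_cmod this]
  have "\<bar>(\<Sum>p\<in>primes_le y. Re (1 / of_nat p)) - prime_zeta (1 / ln y)\<bar> \<le> 52"
    by (simp add: prime_zeta_def)
  moreover have "Re (1 / of_nat p) = 1 / real p" for p by (simp add: Re_divide_of_nat)
  ultimately show ?thesis using prime_zeta_bounds[OF d] by simp
qed

section \<open>Primes dividing the modulus\<close>

lemma sum_ln_prime_factors_le: assumes "m > 0" shows "(\<Sum>p\<in>prime_factors m. ln (real p)) \<le> ln (real m)"
proof -
  have pos: "p \<in> prime_factors m \<Longrightarrow> p > 0" for p by (auto simp: in_prime_factors_iff prime_gt_0_nat)
  have "real m = (\<Prod>p\<in>prime_factors m. real p ^ multiplicity p m)"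
    by (rule trans[OF arg_cong[OF prime_factorization_nat[OF assms], of real]]) simp
  hence "ln (real m) = ln (\<Prod>p\<in>prime_factors m. real p ^ multiplicity p m)" by (rule arg_cong)
  also have "\<dots> = (\<Sum>p\<in>prime_factors m. ln (real p ^ multiplicity p m))"
    using pos by (intro ln_prod) auto
  also have "\<dots> = (\<Sum>p\<in>prime_factors m. real (multiplicity p m) * ln (real p))"
    by (intro sum.cong refl ln_realpow)
  also have "\<dots> \<ge> (\<Sum>p\<in>prime_factors m. 1 * ln (real p))"
  proof (intro sum_mono mult_right_mono)
    fix p assume p: "p \<in> prime_factors m"
    hence "multiplicity p m > 0" by (simp add: prime_factors_multiplicity)
    thus "1 \<le> real (multiplicity p m)" by linarith
    show "0 \<le> ln (real p)" using pos[OF p] by simp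
  qed
  finally show ?thesis by simp
qed

text \<open>At most \<open>K\<close> primes are <= \<open>K\<close>; for the larger ones 1 / p < 1 /
  K <= 2 ln p / K, as ln p >= 1/2, and the logarithms add up to at most ln m. A large fixed
  \<open>K\<close> thus makes the part that grows with m a small multiple of ln m.\<close>

lemma sum_inverse_prime_factors_le:
  assumes "m > 0" "K > 0"
  shows "(\<Sum>p\<in>prime_factors m. 1 / real p) \<le> real K + 2 * ln (real m) / real K"
proof -
  have "(\<Sum>p\<in>prime_factors m. 1 / real p) \<le> (\<Sum>p\<in>prime_factors m. of_bool (p \<le> K) + 2 * ln (real p) / real K)"
  proof (rule sum_mono)
    fix p assume "p \<in> prime_factors m"
    hence p: "p \<ge> 2" by (auto simp: in_prime_factors_iff prime_ge_2_nat)
    have l: "ln (real p) \<ge> 1/2"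
    proof -
      have "ln (real p) \<ge> ln 2" using p by simp
      thus ?thesis using ln2_ge_two_thirds by linarith
    qed
    show "1 / real p \<le> of_bool (p \<le> K) + 2 * ln (real p) / real K"
    proof (cases "p \<le> K")
      case True
      have "1 / real p \<le> 1" using p by simp
      moreover have "2 * ln (real p) / real K \<ge> 0" using l by simp
      ultimately show ?thesis using True by simp
    next
      case False
      hence "1 / real p \<le> 1 / real K" using assms by (intro divide_left_mono) auto
      also have "\<dots> \<le> 2 * ln (real p) / real K" using l by (intro divide_right_mono) auto
      finally show ?thesis using False by simp
    qed
  qed
  also have "\<dots> = (\<Sum>p\<in>prime_factors m. of_bool (p \<le> K)) + 2 * (\<Sum>p\<in>prime_factors m. ln (real p)) / real K"
    by (simp add: sum.distrib sum_distrib_left sum_divide_distrib)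
  also have "(\<Sum>p\<in>prime_factors m. of_bool (p \<le> K)) \<le> real K"
  proof -
    have "(\<Sum>p\<in>prime_factors m. of_bool (p \<le> K)) = real (card (prime_factors m \<inter> {p. p \<le> K}))"
      by (simp add: of_bool_def sum.If_cases)
    also have "card (prime_factors m \<inter> {p. p \<le> K}) \<le> card {1..K}"
      by (intro card_mono) (auto simp: in_prime_factors_iff intro: prime_ge_1_nat[unfolded One_nat_def])
    finally show ?thesis by simp
  qed
  also have "2 * (\<Sum>p\<in>prime_factors m. ln (real p)) / real K \<le> 2 * ln (real m) / real K"
    by (intro divide_right_mono mult_left_mono sum_ln_prime_factors_le assms) auto
  finally show ?thesis by simp
qed


section \<open>Dirichlet characters\<close>

abbreviation nat_char :: "(int \<Rightarrow> complex) \<Rightarrow> nat \<Rightarrow> complex" where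
  "nat_char \<psi> n \<equiv> \<psi> (int n)"

context
  fixes m :: nat and \<psi> :: "int \<Rightarrow> complex"
  assumes chr: "dirichlet_character m \<psi>"
begin

lemma char_mod_pos: "m > 0" using chr by (simp add: dirichlet_character_def)

lemma char_mult: "\<psi> (a * b) = \<psi> a * \<psi> b" using chr by (simp add: dirichlet_character_def)

lemma char_zero_iff: "\<psi> a = 0 \<longleftrightarrow> \<not> coprime a (int m)"
  using chr unfolding dirichlet_character_def by blast

lemma char_1: "\<psi> 1 = 1"
proof -
  have "\<psi> 1 * \<psi> 1 = \<psi> 1" using char_mult[of 1 1] by simp
  moreover have "\<psi> 1 \<noteq> 0" by (simp add: char_zero_iff)
  ultimately show ?thesis by simp
qed

lemma char_power: "\<psi> (a ^ k) = \<psi> a ^ k"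
  by (induction k) (simp_all add: char_1 char_mult)

lemma char_add_mult: "\<psi> (a + int m * k) = \<psi> a"
proof -
  have per: "\<psi> (a + int m) = \<psi> a" for a using chr by (simp add: dirichlet_character_def)
  have nat_case: "\<psi> (a + int m * int j) = \<psi> a" for a j
  proof (induction j)
    case (Suc j)
    have "a + int m * int (Suc j) = (a + int m * int j) + int m" by (simp add: algebra_simps)
    thus ?case using per Suc by (simp only:)
  qed simp
  show ?thesis
  proof (cases "k \<ge> 0")
    case True
    thus ?thesis using nat_case[of a "nat k"] by simp
  next
    case False
    thus ?thesis using nat_case[of "a + int m * k" "nat (-k)"] by simp
  qed
qed

lemma char_mod: "\<psi> (a mod int m) = \<psi> a"
  using char_add_mult[of "a mod int m" "a div int m"] by (simp add: algebra_simps)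

lemma char_power_totient: assumes "coprime a (int m)" shows "\<psi> a ^ totient m = 1"
proof -
  define b where "b = nat (a mod int m)"
  have b: "int b = a mod int m" using char_mod_pos by (simp add: b_def)
  have "coprime (int b) (int m)" unfolding b using assms char_mod_pos by (simp add: coprime_mod_left_iff)
  hence "coprime b m" by simp
  hence "[b ^ totient m = 1] (mod m)" by (rule euler_theorem)
  hence "(b ^ totient m) mod m = 1 mod m" by (simp add: cong_def)
  hence "int ((b ^ totient m) mod m) = int (1 mod m)" by (rule arg_cong)
  hence eq: "(int b ^ totient m) mod int m = 1 mod int m" by (simp only: zmod_int of_nat_power of_nat_1)
  have "\<psi> a ^ totient m = \<psi> (int b) ^ totient m" unfolding b by (simp add: char_mod)
  also have "\<dots> = \<psi> ((int b ^ totient m) mod int m)" by (simp add: char_mod char_power)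
  also have "\<dots> = 1" unfolding eq by (simp add: char_mod char_1)
  finally show ?thesis .
qed

lemma char_norm: assumes "coprime a (int m)" shows "norm (\<psi> a) = 1"
proof -
  have "norm (\<psi> a) ^ totient m = 1"
    using arg_cong[OF char_power_totient[OF assms], of norm] by (simp add: norm_power)
  moreover have "totient m > 0" using char_mod_pos by simp
  ultimately show ?thesis using power_eq_imp_eq_base[of "norm (\<psi> a)" "totient m" 1] by auto
qed

lemma char_norm_le: "norm (\<psi> a) \<le> 1"
  using char_norm[of a] char_zero_iff[of a] by (cases "coprime a (int m)") auto

lemma char_norm_cases: "\<psi> a = 0 \<or> norm (\<psi> a) = 1"
  using char_norm char_zero_iff by blast

lemma completely_mult_char: "completely_mult (nat_char \<psi>)"
  unfolding completely_mult_def by (simp add: char_1 char_mult char_norm_le)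

lemma char_power_character: assumes "j > 0" shows "dirichlet_character m (\<lambda>a. \<psi> a ^ j)"
  unfolding dirichlet_character_def
proof (intro conjI allI)
  show "m > 0" by (rule char_mod_pos)
  fix a b
  show "\<psi> (a + int m) ^ j = \<psi> a ^ j" using char_add_mult[of a 1] by simp
  show "\<psi> (a * b) ^ j = \<psi> a ^ j * \<psi> b ^ j" by (simp add: char_mult power_mult_distrib)
  show "(\<psi> a ^ j \<noteq> 0) = coprime a (int m)" using assms by (simp add: char_zero_iff)
qed

lemma char_cnj_character: "dirichlet_character m (\<lambda>a. cnj (\<psi> a))"
  using chr unfolding dirichlet_character_def by simp

text \<open>Multiplication by a unit \<open>a\<close> with \<open>\<psi> a\<close> different from 1
  permutes the residues, so a full period sums to 0. Removing periods brings N below m, where the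
  triangle inequality suffices.\<close>

lemma partial_sum_char_bound:
  assumes "\<psi> \<noteq> principal_character m"
  shows "norm (partial_sum (nat_char \<psi>) N) \<le> real m"
proof -
  have m: "m > 0" by (rule char_mod_pos)
  obtain a where a: "coprime a (int m)" "\<psi> a \<noteq> 1"
  proof -
    from assms obtain a where a: "\<psi> a \<noteq> principal_character m a" by blast
    hence "coprime a (int m)" using char_zero_iff by (auto simp: principal_character_def split: if_splits)
    with a show ?thesis by (intro that[of a]) (simp_all add: principal_character_def)
  qed
  define I where "I = {0..<int m}"
  have inj: "inj_on (\<lambda>n. (a * n) mod int m) I"
  proof (rule inj_onI)
    fix x y assume xy: "x \<in> I" "y \<in> I" "(a * x) mod int m = (a * y) mod int m"
    hence "[a * x = a * y] (mod int m)" by (simp add: cong_def)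
    hence "[x = y] (mod int m)" using a(1) by (simp add: cong_mult_lcancel)
    thus "x = y" using xy by (auto simp: I_def cong_def)
  qed
  have img: "(\<lambda>n. (a * n) mod int m) ` I = I"
    by (rule endo_inj_surj[OF _ _ inj]) (use m in \<open>auto simp: I_def\<close>)
  have "\<psi> a * (\<Sum>n\<in>I. \<psi> n) = (\<Sum>n\<in>I. \<psi> ((a * n) mod int m))"
    by (simp add: sum_distrib_left char_mult char_mod)
  also have "\<dots> = (\<Sum>n\<in>(\<lambda>n. (a * n) mod int m) ` I. \<psi> n)"
    by (subst sum.reindex[OF inj]) (simp add: o_def)
  also have "\<dots> = (\<Sum>n\<in>I. \<psi> n)" by (simp only: img)
  finally have "(\<psi> a - 1) * (\<Sum>n\<in>I. \<psi> n) = 0" by (simp add: left_diff_distrib)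
  hence z: "(\<Sum>n\<in>I. \<psi> n) = 0" using a by simp
  have "I = int ` {0..<m}" by (simp add: I_def image_int_atLeastLessThan)
  hence z2: "(\<Sum>n\<in>{0..<m}. \<psi> (int n)) = 0"
    using z by (simp add: sum.reindex o_def)
  have block: "(\<Sum>n\<in>{k..<k+m}. \<psi> (int n)) = 0" for k
  proof (induction k)
    case (Suc k)
    have "(\<Sum>n\<in>{k..<k+m}. \<psi> (int n)) + \<psi> (int (k + m)) = \<psi> (int k) + (\<Sum>n\<in>{Suc k..<Suc k + m}. \<psi> (int n))"
    proof -
      have "(\<Sum>n\<in>{k..<k+m}. \<psi> (int n)) + \<psi> (int (k + m)) = (\<Sum>n\<in>{k..<Suc (k+m)}. \<psi> (int n))"
        by (simp add: sum.atLeastLessThan_Suc)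
      also have "\<dots> = \<psi> (int k) + (\<Sum>n\<in>{Suc k..<Suc (k+m)}. \<psi> (int n))"
        by (rule sum.atLeast_Suc_lessThan) simp
      finally show ?thesis by simp
    qed
    moreover have "\<psi> (int (k + m)) = \<psi> (int k)" using char_add_mult[of "int k" 1] by simp
    ultimately show ?case using Suc by simp
  qed (use z2 in simp)
  show ?thesis
  proof (induction N rule: less_induct)
    case (less N)
    show ?case
    proof (cases "N < m")
      case True
      have "norm (partial_sum (nat_char \<psi>) N) \<le> (\<Sum>k=1..N. 1)"
        unfolding partial_sum_def by (rule sum_norm_le) (rule char_norm_le)
      thus ?thesis using True by simp
    next
      case False
      have "{1..N} = {1..N-m} \<union> {N-m+1..<N-m+1+m}" using False m by auto
      hence "partial_sum (nat_char \<psi>) N = partial_sum (nat_char \<psi>) (N-m) + (\<Sum>n\<in>{N-m+1..<N-m+1+m}. \<psi> (int n))"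
        unfolding partial_sum_def by (simp only:) (rule sum.union_disjoint, auto)
      hence "partial_sum (nat_char \<psi>) N = partial_sum (nat_char \<psi>) (N-m)" by (simp only: block add_0_right)
      thus ?thesis using less[of "N - m"] False m by simp
    qed
  qed
qed

end

lemma character_mult:
  assumes "dirichlet_character m \<psi>" "dirichlet_character k \<phi>"
  shows "dirichlet_character (m * k) (\<lambda>a. \<psi> a * \<phi> a)"
  unfolding dirichlet_character_def
proof (intro conjI allI)
  show "m * k > 0" using assms char_mod_pos by simp
  fix a b
  show "\<psi> (a + int (m * k)) * \<phi> (a + int (m * k)) = \<psi> a * \<phi> a"
    using char_add_mult[OF assms(1), of a "int k"] char_add_mult[OF assms(2), of a "int m"]
    by (simp add: mult.commute)
  show "\<psi> (a * b) * \<phi> (a * b) = \<psi> a * \<phi> a * (\<psi> b * \<phi> b)"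
    using assms char_mult by (simp add: mult_ac)
  show "(\<psi> a * \<phi> a \<noteq> 0) = coprime a (int (m * k))"
    using char_zero_iff[OF assms(1)] char_zero_iff[OF assms(2)] by simp
qed

definition real_char :: "(int \<Rightarrow> complex) \<Rightarrow> bool" where
  "real_char \<psi> \<longleftrightarrow> (\<forall>a. \<psi> a \<in> {0, 1, -1})"

lemma real_char_if_square_principal:
  assumes "dirichlet_character m \<psi>" "(\<lambda>a. \<psi> a ^ 2) = principal_character m"
  shows "real_char \<psi>"
  unfolding real_char_def
proof
  fix a
  from fun_cong[OF assms(2), of a] show "\<psi> a \<in> {0, 1, -1}"
    by (auto simp: principal_character_def power2_eq_1_iff split: if_splits)
qed

lemma character_order_power:
  assumes "dirichlet_character q \<phi>" "character_order q \<phi> = g"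
  shows "(\<lambda>a. \<phi> a ^ g) = principal_character q" "g > 0"
proof -
  let ?P = "\<lambda>k. k > 0 \<and> (\<lambda>a. \<phi> a ^ k) = principal_character q"
  have t: "totient q > 0" using char_mod_pos[OF assms(1)] by simp
  have "?P (totient q)"
    using t char_power_totient[OF assms(1)] char_zero_iff[OF assms(1)]
    by (auto simp: principal_character_def fun_eq_iff)
  hence "?P (LEAST k. ?P k)" by (rule LeastI)
  thus "(\<lambda>a. \<phi> a ^ g) = principal_character q" "g > 0"
    using assms(2) by (auto simp: character_order_def)
qed

text \<open>A principal character is induced from modulus 1. This settles order g = 1, where chi
  must not vanish at any prime.\<close>

lemma primitive_principal:
  assumes "primitive_character q (principal_character q)"
  shows "q = 1"
proof (rule ccontr)
  assume "q \<noteq> 1"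
  have "q > 0" using assms by (simp add: primitive_character_def dirichlet_character_def)
  moreover have "dirichlet_character 1 (\<lambda>_. 1)" by (simp add: dirichlet_character_def)
  ultimately show False
    using assms \<open>q \<noteq> 1\<close> unfolding primitive_character_def
    by (auto dest!: spec[of _ "1::nat"] spec[of _ "\<lambda>_. 1::complex"])
qed


section \<open>Nonnegative Taylor coefficients\<close>

text \<open>\<open>F\<close> has nonnegative Taylor coefficients at \<open>2\<close> in powers of \<open>2 - s\<close>, as Dirichlet series with
  nonnegative coefficients do.\<close>

definition nonneg_taylor :: "(complex \<Rightarrow> complex) \<Rightarrow> bool" where
  "nonneg_taylor F \<longleftrightarrow> F holomorphic_on ball 2 (1/2) \<and> (\<forall>k. (-1) ^ k * (deriv ^^ k) F 2 \<in> \<real>\<^sub>\<ge>\<^sub>0)"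

lemma nonneg_taylor_holo: "nonneg_taylor F \<Longrightarrow> F holomorphic_on ball 2 (1/2)" by (simp add: nonneg_taylor_def)

lemma nonneg_taylor_cong:
  assumes "nonneg_taylor F" "\<And>s. s \<in> ball 2 (1/2) \<Longrightarrow> F s = G s"
  shows "nonneg_taylor G"
proof -
  have h: "F holomorphic_on ball 2 (1/2)" using assms(1) by (rule nonneg_taylor_holo)
  have hG: "G holomorphic_on ball 2 (1/2)" using h assms(2) by (rule holomorphic_transform)
  have "(deriv ^^ k) F 2 = (deriv ^^ k) G 2" for k
    by (rule higher_deriv_transform_within_open[OF h hG]) (use assms(2) in auto)
  thus ?thesis using assms(1) hG by (simp add: nonneg_taylor_def)
qed

lemma nonneg_taylor_const: assumes "c \<in> \<real>\<^sub>\<ge>\<^sub>0" shows "nonneg_taylor (\<lambda>_. c)"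
proof -
  have "(deriv ^^ k) (\<lambda>_. c) 2 = (if k = 0 then c else 0)" for k by simp
  thus ?thesis unfolding nonneg_taylor_def using assms by (auto intro!: holomorphic_intros)
qed

lemma nonneg_taylor_add: assumes "nonneg_taylor F" "nonneg_taylor G" shows "nonneg_taylor (\<lambda>s. F s + G s)"
  unfolding nonneg_taylor_def
proof (intro conjI allI)
  note h = nonneg_taylor_holo[OF assms(1)] nonneg_taylor_holo[OF assms(2)]
  show "(\<lambda>s. F s + G s) holomorphic_on ball 2 (1/2)" by (intro holomorphic_intros h)
  fix k
  have "(deriv ^^ k) (\<lambda>s. F s + G s) 2 = (deriv ^^ k) F 2 + (deriv ^^ k) G 2"
    by (rule higher_deriv_add[OF h]) auto
  thus "(-1) ^ k * (deriv ^^ k) (\<lambda>s. F s + G s) 2 \<in> \<real>\<^sub>\<ge>\<^sub>0"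
    using assms unfolding nonneg_taylor_def by (simp add: distrib_left nonneg_Reals_add_I)
qed

lemma nonneg_Reals_sum_I: "(\<And>i. f i \<in> \<real>\<^sub>\<ge>\<^sub>0) \<Longrightarrow> sum f A \<in> \<real>\<^sub>\<ge>\<^sub>0"
  by (induction A rule: infinite_finite_induct) (simp_all add: nonneg_Reals_add_I)

text \<open>Leibniz' rule, with (-1)^k shared out as (-1)^i (-1)^(k-i). Closure under products lets
  Euler products be treated factor by factor, without computing Dirichlet coefficients.\<close>

lemma nonneg_taylor_mult: assumes "nonneg_taylor F" "nonneg_taylor G" shows "nonneg_taylor (\<lambda>s. F s * G s)"
  unfolding nonneg_taylor_def
proof (intro conjI allI)
  note h = nonneg_taylor_holo[OF assms(1)] nonneg_taylor_holo[OF assms(2)]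
  show "(\<lambda>s. F s * G s) holomorphic_on ball 2 (1/2)" by (intro holomorphic_intros h)
  fix k
  have eq: "(deriv ^^ k) (\<lambda>s. F s * G s) 2
          = (\<Sum>i=0..k. of_nat (k choose i) * (deriv ^^ i) F 2 * (deriv ^^ (k - i)) G 2)"
    by (rule higher_deriv_mult[OF h]) auto
  have "(-1) ^ k * (deriv ^^ k) (\<lambda>s. F s * G s) 2
          = (\<Sum>i=0..k. of_nat (k choose i) * ((-1) ^ i * (deriv ^^ i) F 2) * ((-1) ^ (k - i) * (deriv ^^ (k - i)) G 2))"
    unfolding eq sum_distrib_left
  proof (intro sum.cong refl)
    fix i assume "i \<in> {0..k}"
    hence "(-1 :: complex) ^ k = (-1) ^ i * (-1) ^ (k - i)" by (simp flip: power_add)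
    thus "(-1) ^ k * (of_nat (k choose i) * (deriv ^^ i) F 2 * (deriv ^^ (k - i)) G 2)
        = of_nat (k choose i) * ((-1) ^ i * (deriv ^^ i) F 2) * ((-1) ^ (k - i) * (deriv ^^ (k - i)) G 2)"
      by (simp only: mult_ac)
  qed
  also have "\<dots> \<in> \<real>\<^sub>\<ge>\<^sub>0"
  proof (rule nonneg_Reals_sum_I)
    fix i
    have "(-1) ^ i * (deriv ^^ i) F 2 \<in> \<real>\<^sub>\<ge>\<^sub>0" "(-1) ^ (k - i) * (deriv ^^ (k - i)) G 2 \<in> \<real>\<^sub>\<ge>\<^sub>0"
      using assms by (auto simp: nonneg_taylor_def)
    thus "of_nat (k choose i) * ((-1) ^ i * (deriv ^^ i) F 2) * ((-1) ^ (k - i) * (deriv ^^ (k - i)) G 2) \<in> \<real>\<^sub>\<ge>\<^sub>0"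
      by (rule nonneg_Reals_mult_I[OF nonneg_Reals_mult_I, rotated]) simp
  qed
  finally show "(-1) ^ k * (deriv ^^ k) (\<lambda>s. F s * G s) 2 \<in> \<real>\<^sub>\<ge>\<^sub>0" .
qed

lemma nonneg_taylor_sum: "finite A \<Longrightarrow> (\<And>i. i \<in> A \<Longrightarrow> nonneg_taylor (F i)) \<Longrightarrow> nonneg_taylor (\<lambda>s. \<Sum>i\<in>A. F i s)"
  by (induction A rule: finite_induct) (simp_all add: nonneg_taylor_add nonneg_taylor_const)

lemma nonneg_taylor_power: "nonneg_taylor F \<Longrightarrow> nonneg_taylor (\<lambda>s. F s ^ n)"
  by (induction n) (simp_all add: nonneg_taylor_mult nonneg_taylor_const nonneg_Reals_one_I)

lemma higher_deriv_exp_linear: "(deriv ^^ k) (\<lambda>s. exp (c * s)) = (\<lambda>s. c ^ k * exp (c * s :: complex))"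
proof (induction k)
  case (Suc k)
  have "deriv (\<lambda>s. c ^ k * exp (c * s)) = (\<lambda>s. c ^ Suc k * exp (c * s))"
    by (rule ext, rule DERIV_imp_deriv) (auto intro!: derivative_eq_intros)
  thus ?case using Suc by simp
qed simp

text \<open>Each derivative brings down - ln n, whose sign cancels against (-1)^k.\<close>

lemma nonneg_taylor_nat_powr: assumes "n > 0" shows "nonneg_taylor (\<lambda>s. of_nat n powr (-s))"
proof -
  define c :: complex where "c = - of_real (ln (real n))"
  have eq: "(\<lambda>s. of_nat n powr (-s)) = (\<lambda>s. exp (c * s))"
    using assms by (simp add: powr_def c_def Ln_of_nat fun_eq_iff mult.commute)
  have "(-1) ^ k * (c ^ k * exp (c * 2)) \<in> \<real>\<^sub>\<ge>\<^sub>0" for k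
  proof -
    have "(-1) ^ k * (c ^ k * exp (c * 2)) = of_real (ln (real n) ^ k * exp (- ln (real n) * 2))"
      by (simp add: c_def exp_of_real[symmetric] power_mult_distrib[symmetric] flip: mult.assoc)
    thus ?thesis using assms by (simp only: nonneg_Reals_of_real_iff) (auto intro!: mult_nonneg_nonneg)
  qed
  thus ?thesis unfolding nonneg_taylor_def eq higher_deriv_exp_linear by (auto intro!: holomorphic_intros)
qed

lemma nonneg_taylor_limit:
  assumes lim: "uniform_limit (ball 2 (1/2)) F G sequentially" and F: "\<And>n. nonneg_taylor (F n)"
  shows "nonneg_taylor G"
proof -
  have hG: "G holomorphic_on ball 2 (1/2)"
  proof (rule holomorphic_uniform_sequence[of _ F])
    fix x :: complex assume "x \<in> ball 2 (1/2)"
    then obtain d where d: "d > 0" "cball x d \<subseteq> ball 2 (1/2)" using open_contains_cball[of "ball 2 (1/2)"] open_ball by blast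
    thus "\<exists>d>0. cball x d \<subseteq> ball 2 (1/2) \<and> uniform_limit (cball x d) F G sequentially"
      using uniform_limit_on_subset[OF lim] by blast
  qed (use F nonneg_taylor_holo in auto)
  have "(\<lambda>n. (-1) ^ k * (deriv ^^ k) (F n) 2) \<longlonglongrightarrow> (-1) ^ k * (deriv ^^ k) G 2" for k
    by (intro tendsto_intros higher_deriv_complex_uniform_limit[OF lim]) (use F nonneg_taylor_holo in auto)
  hence "(-1) ^ k * (deriv ^^ k) G 2 \<in> \<real>\<^sub>\<ge>\<^sub>0" for k
    by (rule closed_sequentially[OF closed_nonneg_Reals_complex, rotated]) (use F in \<open>auto simp: nonneg_taylor_def\<close>)
  thus ?thesis using hG by (simp add: nonneg_taylor_def)
qed

text \<open>Models a Dirichlet series with nonnegative coefficients whose coefficient at n = 1 is at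
  least 1. That surplus 1 is the source of every lower bound in Estermann's argument.\<close>

definition unital_taylor :: "(complex \<Rightarrow> complex) \<Rightarrow> bool" where
  "unital_taylor F \<longleftrightarrow> nonneg_taylor F \<and> nonneg_taylor (\<lambda>s. F s - 1)"

lemma unital_taylor_cong:
  assumes "unital_taylor F" "\<And>s. s \<in> ball 2 (1/2) \<Longrightarrow> F s = G s" shows "unital_taylor G"
  using assms(1) unfolding unital_taylor_def by (auto intro: nonneg_taylor_cong simp: assms(2))

text \<open>From F G - 1 = F (G - 1) + (F - 1).\<close>

lemma unital_taylor_mult: assumes "unital_taylor F" "unital_taylor G" shows "unital_taylor (\<lambda>s. F s * G s)"
proof -
  have "nonneg_taylor (\<lambda>s. F s * (G s - 1) + (F s - 1))"
    using assms by (intro nonneg_taylor_add nonneg_taylor_mult) (auto simp: unital_taylor_def)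
  hence "nonneg_taylor (\<lambda>s. F s * G s - 1)" by (rule nonneg_taylor_cong) (simp add: algebra_simps)
  thus ?thesis using assms by (simp add: unital_taylor_def nonneg_taylor_mult)
qed

lemma unital_taylor_one: "unital_taylor (\<lambda>_. 1)" by (simp add: unital_taylor_def nonneg_taylor_const nonneg_Reals_one_I)

lemma unital_taylor_prod: "finite A \<Longrightarrow> (\<And>i. i \<in> A \<Longrightarrow> unital_taylor (F i)) \<Longrightarrow> unital_taylor (\<lambda>s. \<Prod>i\<in>A. F i s)"
  by (induction A rule: finite_induct) (simp_all add: unital_taylor_mult unital_taylor_one)

lemma ball_Re: assumes "s \<in> ball 2 (1/2)" shows "Re s > 3/2"
  using abs_Re_le_cmod[of "2 - s"] assms by (simp add: dist_norm)

lemma norm_nat_powr_ball: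
  assumes "n \<ge> 2" "s \<in> ball 2 (1/2)" shows "norm (of_nat n powr (-s) :: complex) \<le> 1/2"
proof -
  have "norm (of_nat n powr (-s) :: complex) = real n powr (- Re s)" by (rule norm_nat_powr)
  also have "\<dots> \<le> real n powr (-1)" using assms ball_Re[OF assms(2)] by (intro powr_mono) auto
  also have "\<dots> = 1 / real n" using assms by (simp add: powr_minus_divide)
  also have "\<dots> \<le> 1/2" using assms by (intro divide_left_mono) auto
  finally show ?thesis .
qed

text \<open>The geometric series in n^(-s), which has norm at most 1/2 on the disc. Removing the
  first term leaves n^(-s) times the whole series, hence again nonnegative coefficients.\<close>

lemma unital_taylor_geometric: assumes "n \<ge> 2" shows "unital_taylor (\<lambda>s. 1 / (1 - of_nat n powr (-s)))"
proof -
  have lim: "uniform_limit (ball 2 (1/2)) (\<lambda>N s. \<Sum>i<N. (of_nat n powr (-s)) ^ i) (\<lambda>s. \<Sum>i. (of_nat n powr (-s)) ^ i :: complex) sequentially"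
  proof (rule Weierstrass_m_test)
    show "norm ((of_nat n powr (-s)) ^ i :: complex) \<le> (1/2) ^ i" if "s \<in> ball 2 (1/2)" for i s
      unfolding norm_power by (intro power_mono norm_nat_powr_ball assms that) auto
  qed (simp add: summable_geometric)
  have "nonneg_taylor (\<lambda>s. \<Sum>i. (of_nat n powr (-s)) ^ i)"
    by (rule nonneg_taylor_limit[OF lim]) (use assms in \<open>auto intro!: nonneg_taylor_sum nonneg_taylor_power nonneg_taylor_nat_powr\<close>)
  hence g: "nonneg_taylor (\<lambda>s. 1 / (1 - of_nat n powr (-s)))"
  proof (rule nonneg_taylor_cong)
    fix s :: complex assume s: "s \<in> ball 2 (1/2)"
    have "norm (of_nat n powr (-s) :: complex) < 1" using norm_nat_powr_ball[OF assms s] by simp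
    thus "(\<Sum>i. (of_nat n powr (-s)) ^ i) = 1 / (1 - of_nat n powr (-s) :: complex)" by (rule suminf_geometric)
  qed
  have "nonneg_taylor (\<lambda>s. of_nat n powr (-s) * (1 / (1 - of_nat n powr (-s))))"
    using assms g by (intro nonneg_taylor_mult nonneg_taylor_nat_powr) auto
  hence "nonneg_taylor (\<lambda>s. 1 / (1 - of_nat n powr (-s)) - 1)"
  proof (rule nonneg_taylor_cong)
    fix s :: complex assume s: "s \<in> ball 2 (1/2)"
    have "of_nat n powr (-s) \<noteq> (1 :: complex)" using norm_nat_powr_ball[OF assms s] by auto
    thus "of_nat n powr (-s) * (1 / (1 - of_nat n powr (-s))) = 1 / (1 - of_nat n powr (-s)) - (1 :: complex)"
      by (simp add: field_simps)
  qed
  with g show ?thesis by (simp add: unital_taylor_def)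
qed

section \<open>Euler factors with real coefficients\<close>

definition sign_values :: "complex set" where "sign_values = {0, 1, -1}"

text \<open>The factor at \<open>p\<close> of zeta(s) L(s, f), with b = f(p).\<close>

definition euler_factor2 :: "complex \<Rightarrow> nat \<Rightarrow> complex \<Rightarrow> complex" where
  "euler_factor2 b p s = 1 / ((1 - of_nat p powr (-s)) * (1 - b * of_nat p powr (-s)))"

text \<open>For b = -1 the denominator is 1 - p^(-2s), so the factor is the geometric one of p^2; b
  = 0 and b = 1 give one and two copies of the geometric factor of p.\<close>

lemma unital_taylor_euler_factor2:
  assumes p: "p \<ge> 2" and b: "b \<in> sign_values" shows "unital_taylor (euler_factor2 b p)"
proof -
  have g: "unital_taylor (\<lambda>s. 1 / (1 - of_nat p powr (-s)))" by (rule unital_taylor_geometric[OF p])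
  have "p\<^sup>2 \<ge> 2" using p by (simp add: power2_eq_square) (metis le_trans mult_le_mono2 nat_le_linear one_le_numeral mult_1_right)
  hence g2: "unital_taylor (\<lambda>s. 1 / (1 - of_nat (p\<^sup>2) powr (-s)))" by (rule unital_taylor_geometric)
  have sq: "(of_nat p * of_nat p) powr (-s) = (of_nat p powr (-s) * of_nat p powr (-s) :: complex)" for s
    by (rule powr_times_real) auto
  consider "b = 0" | "b = 1" | "b = -1" using b by (auto simp: sign_values_def)
  thus ?thesis
  proof cases
    case 1
    show ?thesis by (rule unital_taylor_cong[OF g]) (simp add: euler_factor2_def 1)
  next
    case 2
    show ?thesis by (rule unital_taylor_cong[OF unital_taylor_mult[OF g g]]) (simp add: euler_factor2_def 2)
  next
    case 3
    show ?thesis by (rule unital_taylor_cong[OF g2]) (simp add: euler_factor2_def 3 sq power2_eq_square algebra_simps)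
  qed
qed

text \<open>The factor at \<open>p\<close> of zeta(s) L(s, f) L(s, g) L(s, f g), with a = f(p) and b
  = g(p).\<close>

definition euler_factor4 :: "complex \<Rightarrow> complex \<Rightarrow> nat \<Rightarrow> complex \<Rightarrow> complex" where
  "euler_factor4 a b p s = 1 / (((1 - of_nat p powr (-s)) * (1 - a * of_nat p powr (-s))) *
      ((1 - b * of_nat p powr (-s)) * (1 - (a * b) * of_nat p powr (-s))))"

text \<open>Reduction to two characters: a = 1 gives the square of \<open>euler_factor2 b p\<close>,
  a = 0 the factor itself, and a = -1 pairs the terms into \<open>euler_factor2\<close> for b^2 at
  p^2.\<close>

lemma unital_taylor_euler_factor4:
  assumes p: "p \<ge> 2" and ab: "a \<in> sign_values" "b \<in> sign_values" shows "unital_taylor (euler_factor4 a b p)"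
proof -
  note e = unital_taylor_euler_factor2[OF p]
  have "p\<^sup>2 \<ge> 2" using p by (simp add: power2_eq_square) (metis le_trans mult_le_mono2 nat_le_linear one_le_numeral mult_1_right)
  note e2 = unital_taylor_euler_factor2[OF this]
  have sq: "(of_nat p * of_nat p) powr (-s) = (of_nat p powr (-s) * of_nat p powr (-s) :: complex)" for s
    by (rule powr_times_real) auto
  consider "a = 0" | "a = 1" | "a = -1" using ab by (auto simp: sign_values_def)
  thus ?thesis
  proof cases
    case 1
    show ?thesis by (rule unital_taylor_cong[OF e[OF ab(2)]]) (simp add: euler_factor4_def euler_factor2_def 1)
  next
    case 2
    show ?thesis by (rule unital_taylor_cong[OF unital_taylor_mult[OF e[OF ab(2)] e[OF ab(2)]]]) (simp add: euler_factor4_def euler_factor2_def 2)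
  next
    case 3
    have "b\<^sup>2 \<in> sign_values" using ab by (auto simp: sign_values_def)
    show ?thesis
      by (rule unital_taylor_cong[OF e2[OF \<open>b\<^sup>2 \<in> sign_values\<close>]])
         (simp add: euler_factor4_def euler_factor2_def 3 sq power2_eq_square algebra_simps)
  qed
qed

lemma euler_den_nonzero:
  assumes "completely_mult f" "Re s > 1" shows "euler_den f s N \<noteq> 0"
  using norm_euler_den(1)[of f s N] assms by (force simp: completely_mult_def)

lemma norm_dirser_ball:
  assumes "\<And>n. norm (f n) \<le> 1" "s \<in> ball 2 (1/2)"
  shows "norm (dirser f s) \<le> (\<Sum>\<^sub>\<infinity>n. real n powr (-(3/2)))"
proof -
  have s: "Re s > 3/2" by (rule ball_Re[OF assms(2)])
  have "norm (dirser f s) \<le> (\<Sum>\<^sub>\<infinity>n. norm (f n * of_nat n powr (-s)))"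
    unfolding dirser_def by (rule norm_infsum_bound) (use dirser_abs_summable[of f s] assms s in auto)
  also have "\<dots> \<le> (\<Sum>\<^sub>\<infinity>n. real n powr (-(3/2)))"
  proof (rule infsum_mono)
    show "norm (f n * of_nat n powr (-s)) \<le> real n powr (-(3/2))" for n
    proof -
      have "norm (f n * of_nat n powr (-s)) \<le> 1 * real n powr (- Re s)"
        unfolding norm_mult norm_nat_powr by (intro mult_right_mono assms) auto
      also have "\<dots> \<le> real n powr (-(3/2))" using s by (cases "n = 0") (auto intro!: powr_mono)
      finally show ?thesis .
    qed
  qed (use dirser_abs_summable[of f s] nat_powr_summable_on[of "3/2"] assms s in auto)
  finally show ?thesis .
qed

text \<open>With E for \<open>euler_den\<close> and D for the series, 1 / E - D = - D (E D - 1) / (E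
  D). On the disc D is bounded, and E D - 1 is at most the tail at exponent 3/2, which does not
  depend on s.\<close>

lemma euler_uniform_limit:
  assumes f: "completely_mult f"
  shows "uniform_limit (ball 2 (1/2)) (\<lambda>N s. 1 / euler_den f s N) (dirser f) sequentially"
proof (rule uniform_limitI)
  fix e :: real assume e: "e > 0"
  define Z where "Z = (\<Sum>\<^sub>\<infinity>n. real n powr (-(3/2)))"
  have fb: "\<And>n. norm (f n) \<le> 1" using f by (simp add: completely_mult_def)
  have Zb: "norm (dirser f s) \<le> Z" if "s \<in> ball 2 (1/2)" for s
    unfolding Z_def using fb that by (rule norm_dirser_ball)
  have "(\<lambda>N. Z * powr_tail (3/2) N * 2) \<longlonglongrightarrow> Z * 0 * 2" by (intro tendsto_intros powr_tail_tendsto) simp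
  hence 1: "\<forall>\<^sub>F N in sequentially. Z * powr_tail (3/2) N * 2 < e" using e by (intro order_tendstoD(2)) auto
  have 2: "\<forall>\<^sub>F N in sequentially. powr_tail (3/2) N < 1/2"
    by (rule order_tendstoD(2)[OF powr_tail_tendsto]) auto
  from 1 2 eventually_ge_at_top[of 2]
  show "\<forall>\<^sub>F N in sequentially. \<forall>s\<in>ball 2 (1/2). dist (1 / euler_den f s N) (dirser f s) < e"
  proof eventually_elim
    case (elim N)
    show ?case
    proof
      fix s :: complex assume s: "s \<in> ball 2 (1/2)"
      have re: "Re s > 3/2" by (rule ball_Re[OF s])
      define E where "E = euler_den f s N"
      define D where "D = dirser f s"
      have nz: "E \<noteq> 0" unfolding E_def using f re by (intro euler_den_nonzero) auto
      have t: "norm (E * D - 1) \<le> powr_tail (3/2) N"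
        unfolding E_def D_def using euler_den_dirser[OF f _ elim(3), of s] powr_tail_antimono[of "3/2" "Re s" N] re by auto
      have ED: "norm (E * D) \<ge> 1/2" using norm_triangle_ineq4[of "E * D" "E * D - 1"] t elim by simp
      hence ED0: "norm (E * D) > 0" by linarith
      have "1 / E - D = - (D * (E * D - 1) / (E * D))" using nz ED0 by (simp add: field_simps)
      hence "norm (1 / E - D) = norm D * norm (E * D - 1) / norm (E * D)" by (simp add: norm_divide norm_mult)
      also have "\<dots> \<le> Z * powr_tail (3/2) N / (1/2)"
        using Zb[OF s] t ED ED0 order_trans[OF norm_ge_zero t] order_trans[OF norm_ge_zero Zb[OF s]]
        by (intro frac_le mult_mono) (auto simp: D_def)
      also have "\<dots> < e" using elim by simp
      finally show "dist (1 / euler_den f s N) (dirser f s) < e" by (simp add: dist_norm E_def D_def)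
    qed
  qed
qed

lemma bounded_dirser_ball: assumes "completely_mult f" shows "bounded (dirser f ` ball 2 (1/2))"
proof (rule boundedI)
  fix z assume "z \<in> dirser f ` ball 2 (1/2)"
  thus "norm z \<le> (\<Sum>\<^sub>\<infinity>n. real n powr (-(3/2)))"
    using norm_dirser_ball[of f] assms by (auto simp only: completely_mult_def)
qed

definition sign_fun :: "(nat \<Rightarrow> complex) \<Rightarrow> bool" where
  "sign_fun f \<longleftrightarrow> completely_mult f \<and> (\<forall>n. f n \<in> sign_values)"

definition euler2 :: "(nat \<Rightarrow> complex) \<Rightarrow> nat \<Rightarrow> complex \<Rightarrow> complex" where
  "euler2 f N s = (\<Prod>p | prime p \<and> p \<le> N. euler_factor2 (f p) p s)"

lemma finite_primes: "finite {p. prime p \<and> p \<le> (N::nat)}"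
  by (rule finite_subset[of _ "{..N}"]) auto

lemma euler2_eq: "euler2 f N s = 1 / euler_den (\<lambda>_. 1) s N * (1 / euler_den f s N)"
  unfolding euler2_def euler_den_def euler_factor2_def by (simp add: prod_dividef prod.distrib)

lemma euler2_limit:
  assumes "completely_mult f"
  shows "uniform_limit (ball 2 (1/2)) (euler2 f) (\<lambda>s. dirser (\<lambda>_. 1) s * dirser f s) sequentially"
proof -
  have "uniform_limit (ball 2 (1/2)) (\<lambda>N s. 1 / euler_den (\<lambda>_. 1) s N * (1 / euler_den f s N))
          (\<lambda>s. dirser (\<lambda>_. 1) s * dirser f s) sequentially"
    by (intro uniform_lim_mult euler_uniform_limit bounded_dirser_ball assms completely_mult_one)
  thus ?thesis by (simp add: euler2_eq[abs_def])
qed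

lemma unital_taylor_euler2: assumes "sign_fun f" shows "unital_taylor (euler2 f N)"
  unfolding euler2_def[abs_def] using assms
  by (intro unital_taylor_prod finite_primes unital_taylor_euler_factor2) (auto simp: sign_fun_def prime_ge_2_nat)

text \<open>The longer product is the shorter one times the product \<open>R\<close> over the new
  primes, so the difference is \<open>euler2 f n\<close> times R - 1. This coefficientwise
  monotonicity feeds the proof that L(1) is not 0.\<close>

lemma nonneg_taylor_euler2_diff:
  assumes f: "sign_fun f" and "n \<le> N"
  shows "nonneg_taylor (\<lambda>s. euler2 f N s - euler2 f n s)"
proof -
  let ?A = "{p. prime p \<and> p \<le> n}" and ?B = "{p. prime p \<and> n < p \<and> p \<le> N}"
  have fB: "finite ?B" by (rule finite_subset[of _ "{..N}"]) auto
  define R where "R = (\<lambda>s. \<Prod>p\<in>?B. euler_factor2 (f p) p s)"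
  have "{p. prime p \<and> p \<le> N} = ?A \<union> ?B" using assms by auto
  hence eq: "euler2 f N s = euler2 f n s * R s" for s
    unfolding euler2_def R_def by (simp only:) (rule prod.union_disjoint, auto simp: finite_primes fB)
  have "unital_taylor R" unfolding R_def using f fB
    by (intro unital_taylor_prod unital_taylor_euler_factor2) (auto simp: sign_fun_def prime_ge_2_nat)
  hence "nonneg_taylor (\<lambda>s. euler2 f n s * (R s - 1))"
    using unital_taylor_euler2[OF f, of n] by (intro nonneg_taylor_mult) (auto simp: unital_taylor_def)
  thus ?thesis by (simp add: eq algebra_simps)
qed

lemma nonneg_taylor_zeta_L_minus_euler2:
  assumes f: "sign_fun f"
  shows "nonneg_taylor (\<lambda>s. dirser (\<lambda>_. 1) s * dirser f s - euler2 f n s)"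
proof (rule nonneg_taylor_limit)
  have cm: "completely_mult f" using f by (simp add: sign_fun_def)
  have "uniform_limit (ball 2 (1/2)) (\<lambda>N. euler2 f (N + n)) (\<lambda>s. dirser (\<lambda>_. 1) s * dirser f s) sequentially"
    using filterlim_compose[OF euler2_limit[OF cm] filterlim_add_const_nat_at_top[of n]] by (simp add: o_def)
  thus "uniform_limit (ball 2 (1/2)) (\<lambda>N s. euler2 f (N + n) s - euler2 f n s) (\<lambda>s. dirser (\<lambda>_. 1) s * dirser f s - euler2 f n s) sequentially"
    by (intro uniform_limit_intros)
  show "nonneg_taylor (\<lambda>s. euler2 f (N + n) s - euler2 f n s)" for N by (rule nonneg_taylor_euler2_diff[OF f]) simp
qed

lemma unital_taylor_limit:
  assumes "uniform_limit (ball 2 (1/2)) F G sequentially" "\<And>n. unital_taylor (F n)"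
  shows "unital_taylor G"
proof -
  have "uniform_limit (ball 2 (1/2)) (\<lambda>n s. F n s - 1) (\<lambda>s. G s - 1) sequentially"
    by (intro uniform_limit_intros assms(1))
  thus ?thesis using assms nonneg_taylor_limit unfolding unital_taylor_def by blast
qed

lemma unital_taylor_zeta_L: "sign_fun f \<Longrightarrow> unital_taylor (\<lambda>s. dirser (\<lambda>_. 1) s * dirser f s)"
  by (rule unital_taylor_limit[OF euler2_limit unital_taylor_euler2]) (auto simp: sign_fun_def)

lemma unital_taylor_zeta_LLL:
  assumes f: "sign_fun f" and g: "sign_fun g"
  shows "unital_taylor (\<lambda>s. dirser (\<lambda>_. 1) s * dirser f s * (dirser g s * dirser (\<lambda>n. f n * g n) s))"
proof (rule unital_taylor_limit)
  have cm: "completely_mult f" "completely_mult g" using f g by (auto simp: sign_fun_def)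
  have cm2: "completely_mult (\<lambda>n. f n * g n)" using cm unfolding completely_mult_def by (auto simp: norm_mult intro!: mult_le_one)
  have b: "bounded ((\<lambda>s. a s * b s) ` ball 2 (1/2))"
    if "bounded (a ` ball 2 (1/2))" "bounded (b ` ball 2 (1/2))" for a b :: "complex \<Rightarrow> complex"
  proof -
    from that obtain A B where "\<forall>s\<in>ball 2 (1/2). norm (a s) \<le> A" "\<forall>s\<in>ball 2 (1/2). norm (b s) \<le> B"
      unfolding bounded_iff by blast
    hence "norm (a s * b s) \<le> A * B" if "s \<in> ball 2 (1/2)" for s
      using that unfolding norm_mult by (intro mult_mono) (use order_trans[OF norm_ge_zero] in blast)+
    thus ?thesis by (intro boundedI[of _ "A * B"]) blast
  qed
  show "uniform_limit (ball 2 (1/2)) (\<lambda>N s. 1 / euler_den (\<lambda>_. 1) s N * (1 / euler_den f s N) * (1 / euler_den g s N * (1 / euler_den (\<lambda>n. f n * g n) s N)))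
     (\<lambda>s. dirser (\<lambda>_. 1) s * dirser f s * (dirser g s * dirser (\<lambda>n. f n * g n) s)) sequentially"
    by (intro uniform_lim_mult euler_uniform_limit bounded_dirser_ball b cm cm2 completely_mult_one)
  fix N
  have "unital_taylor (\<lambda>s. \<Prod>p | prime p \<and> p \<le> N. euler_factor4 (f p) (g p) p s)"
    using f g by (intro unital_taylor_prod finite_primes unital_taylor_euler_factor4) (auto simp: sign_fun_def prime_ge_2_nat)
  thus "unital_taylor (\<lambda>s. 1 / euler_den (\<lambda>_. 1) s N * (1 / euler_den f s N) * (1 / euler_den g s N * (1 / euler_den (\<lambda>n. f n * g n) s N)))"
    unfolding euler_den_def euler_factor4_def by (simp add: prod_dividef prod.distrib)
qed


section \<open>Estermann's argument\<close>

lemma ball_2_pos_half: "ball 2 2 \<subseteq> pos_half"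
proof
  fix s :: complex assume "s \<in> ball 2 2"
  thus "s \<in> pos_half" using abs_Re_le_cmod[of "2 - s"] by (simp add: dist_norm)
qed

lemma cball_2_pos_half: "cball 2 (3/2) \<subseteq> pos_half"
proof
  fix s :: complex assume "s \<in> cball 2 (3/2)"
  thus "s \<in> pos_half" using abs_Re_le_cmod[of "2 - s"] by (simp add: dist_norm)
qed

lemma taylor_at_2:
  assumes G: "G holomorphic_on ball 2 2" and x: "0 < x" "x < 2"
  shows "(\<lambda>n. (-1) ^ n * (deriv ^^ n) G 2 / fact n * of_real ((2 - x) ^ n)) sums G (of_real x)"
proof -
  have "norm (2 - of_real x :: complex) = \<bar>2 - x\<bar>"
    by (metis norm_of_real of_real_diff of_real_numeral)
  hence "complex_of_real x \<in> ball 2 2" using x by (simp add: dist_norm)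
  from holomorphic_power_series[OF G this]
  have "(\<lambda>n. (deriv ^^ n) G 2 / fact n * (of_real x - 2) ^ n) sums G (of_real x)" .
  moreover have "(of_real x - 2 :: complex) ^ n = (-1) ^ n * of_real ((2 - x) ^ n)" for n
    by (simp add: power_mult_distrib[symmetric])
  ultimately show ?thesis by (simp add: mult_ac)
qed

text \<open>Nonnegative coefficients in powers of 2 - s make the Taylor series nonnegative on (0,
  2). Holomorphy on the full disc of radius 2 carries the comparison beyond the half plane where the
  Euler products converge.\<close>

lemma nonneg_taylor_compare:
  assumes G: "G holomorphic_on ball 2 2" and H: "H holomorphic_on ball 2 2"
    and p: "nonneg_taylor (\<lambda>s. G s - H s)" and x: "0 < x" "x < 2"
  shows "Re (H (of_real x)) \<le> Re (G (of_real x))"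
proof -
  let ?W = "\<lambda>s. G s - H s"
  have "?W holomorphic_on ball 2 2" by (intro holomorphic_intros G H)
  from sums_Re[OF taylor_at_2[OF this x]]
  have "(\<lambda>n. Re ((-1) ^ n * (deriv ^^ n) ?W 2 / fact n * of_real ((2 - x) ^ n))) sums Re (?W (of_real x))" .
  moreover have n: "0 \<le> Re ((-1) ^ n * (deriv ^^ n) ?W 2 / fact n * of_real ((2 - x) ^ n))" for n
  proof -
    have "(-1) ^ n * (deriv ^^ n) ?W 2 \<in> \<real>\<^sub>\<ge>\<^sub>0" using p unfolding nonneg_taylor_def by blast
    then obtain r where r: "(-1) ^ n * (deriv ^^ n) ?W 2 = of_real r" "r \<ge> 0"
      by (auto elim!: nonneg_Reals_cases)
    have "Re (of_real r / fact n * of_real ((2 - x) ^ n)) = r / fact n * (2 - x) ^ n"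
      by (metis Re_complex_of_real of_real_divide of_real_fact of_real_mult)
    thus ?thesis unfolding r(1) using r(2) x by simp
  qed
  ultimately have "0 \<le> Re (?W (of_real x))" by (intro sums_le[OF n sums_zero])
  thus ?thesis by simp
qed

text \<open>For F = K / (s - 1) this is F minus its polar part K(1) / (s - 1), with the removable
  singularity filled in.\<close>

definition pole_quot :: "(complex \<Rightarrow> complex) \<Rightarrow> complex \<Rightarrow> complex" where
  "pole_quot K s = (if s = 1 then deriv K 1 else (K s - K 1) / (s - 1))"

lemma pole_quot_holo:
  assumes "K holomorphic_on pos_half" shows "pole_quot K holomorphic_on pos_half"
  unfolding pole_quot_def[abs_def]
  by (rule pole_lemma[OF assms]) (simp add: interior_open[OF open_pos_half])

lemma higher_deriv_pole:
  "s \<noteq> 1 \<Longrightarrow> (deriv ^^ k) (\<lambda>s::complex. 1 / (s - 1)) s = (-1) ^ k * fact k / (s - 1) ^ Suc k"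
proof (induction k arbitrary: s)
  case (Suc k)
  have "((\<lambda>s. (-1) ^ k * fact k / (s - 1) ^ Suc k) has_field_derivative
          (-1) ^ Suc k * fact (Suc k) / (s - 1) ^ Suc (Suc k)) (at s)"
    using Suc.prems
    by (auto intro!: derivative_eq_intros simp: field_simps power2_eq_square simp del: power_Suc)
       (simp add: field_simps)
  hence "((deriv ^^ k) (\<lambda>s::complex. 1 / (s - 1)) has_field_derivative
          (-1) ^ Suc k * fact (Suc k) / (s - 1) ^ Suc (Suc k)) (at s)"
    by (rule has_field_derivative_transform_within_open[of _ _ _ "- {1}"]) (use Suc in auto)
  thus ?case by (simp add: DERIV_imp_deriv)
qed simp

text \<open>Estermann's argument: \<open>K(s) / (s - 1) - K(1) / (s - 1)\<close> is holomorphic on the right half plane,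
  so its Taylor coefficients at \<open>2\<close> decay like \<open>(2/3)\<^sup>k\<close>.\<close>

lemma estermann_cutoff:
  assumes K: "K holomorphic_on pos_half"
    and F: "unital_taylor (\<lambda>s. K s / (s - 1))"
    and M: "\<And>s. s \<in> cball 2 (3/2) \<Longrightarrow> norm (K s) \<le> M"
    and b: "7/8 \<le> b" "b < 1" and Kb: "Re (K (of_real b)) \<ge> 0"
    and k0: "k0 > 0" "16 * M * (3/4) ^ k0 \<le> 1/2"
  shows "(1 - b) / 2 \<le> Re (K 1) * (2 - b) ^ k0"
proof -
  define Q where "Q = pole_quot K"
  define x where "x = 2 - b"
  have x: "1 < x" "x \<le> 9/8" using b by (auto simp: x_def)
  define l where "l = Re (K 1)"
  define F where "F = (\<lambda>s. K s / (s - 1))"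
  have pF: "nonneg_taylor F" "nonneg_taylor (\<lambda>s. F s - 1)" using F by (auto simp: unital_taylor_def F_def)
  have Qh: "Q holomorphic_on pos_half" unfolding Q_def by (rule pole_quot_holo[OF K])
  have Qh2: "Q holomorphic_on ball 2 2" by (rule holomorphic_on_subset[OF Qh ball_2_pos_half])
  define c where "c = (\<lambda>k. (-1) ^ k * (deriv ^^ k) Q 2 / fact k)"
  define B where "B = (\<lambda>k. Re ((-1) ^ k * (deriv ^^ k) F 2) / fact k)"
  have B0: "B k \<ge> 0" for k
  proof -
    have "(-1) ^ k * (deriv ^^ k) F 2 \<in> \<real>\<^sub>\<ge>\<^sub>0" using pF unfolding nonneg_taylor_def by blast
    then obtain r where r: "(-1) ^ k * (deriv ^^ k) F 2 = of_real r" "r \<ge> 0" by (auto elim!: nonneg_Reals_cases)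
    show ?thesis unfolding B_def r(1) using r(2) by simp
  qed
  have B1: "B 0 \<ge> 1"
  proof -
    have "(-1) ^ 0 * (deriv ^^ 0) (\<lambda>s. F s - 1) 2 \<in> \<real>\<^sub>\<ge>\<^sub>0" using pF unfolding nonneg_taylor_def by blast
    thus ?thesis unfolding B_def by (auto elim!: nonneg_Reals_cases simp: complex_eq_iff)
  qed
  have ne1: "s \<noteq> 1" if "s \<in> ball 2 (1/2)" for s :: complex
    using ball_Re[OF that] by auto
  have sub: "ball 2 (1/2) \<subseteq> pos_half" using ball_Re by fastforce
  \<comment> \<open>The polar part is K(1) times the geometric series in 2 - s, all of whose
    coefficients are 1; hence the constant shift by \<open>l\<close>.\<close>
  have cB: "Re (c k) = B k - l" for k
  proof -
    have hP: "(\<lambda>s. K 1 * (1 / (s - 1))) holomorphic_on ball 2 (1/2)"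
      by (intro holomorphic_intros) (use ne1 in auto)
    have hP1: "(\<lambda>s. 1 / (s - 1)) holomorphic_on ball 2 (1/2)"
      by (intro holomorphic_intros) (use ne1 in auto)
    have hQ: "Q holomorphic_on ball 2 (1/2)" by (rule holomorphic_on_subset[OF Qh sub])
    have hR: "(\<lambda>s. Q s + K 1 * (1 / (s - 1))) holomorphic_on ball 2 (1/2)"
      by (intro holomorphic_on_add hQ hP)
    have "(deriv ^^ k) F 2 = (deriv ^^ k) (\<lambda>s. Q s + K 1 * (1 / (s - 1))) 2"
    proof (rule higher_deriv_transform_within_open[OF nonneg_taylor_holo[OF pF(1)] hR])
      fix s :: complex assume "s \<in> ball 2 (1/2)"
      from ne1[OF this] show "F s = Q s + K 1 * (1 / (s - 1))"
        by (simp add: F_def Q_def pole_quot_def diff_divide_distrib)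
    qed auto
    also have "\<dots> = (deriv ^^ k) Q 2 + (deriv ^^ k) (\<lambda>s. K 1 * (1 / (s - 1))) 2"
      by (rule higher_deriv_add[OF hQ hP]) auto
    also have "(deriv ^^ k) (\<lambda>s. K 1 * (1 / (s - 1))) 2 = K 1 * (deriv ^^ k) (\<lambda>s. 1 / (s - 1)) 2"
      by (rule higher_deriv_cmult[OF hP1]) auto
    also have "(deriv ^^ k) (\<lambda>s. 1 / (s - 1)) 2 = (-1 :: complex) ^ k * fact k"
      using higher_deriv_pole[of 2 k] by simp
    finally have "(-1) ^ k * (deriv ^^ k) F 2 = (-1) ^ k * (deriv ^^ k) Q 2 + K 1 * fact k"
      by (simp add: algebra_simps flip: power_add power_mult_distrib mult_2)
    hence "(-1) ^ k * (deriv ^^ k) F 2 / fact k = c k + K 1"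
      by (simp add: c_def add_divide_distrib)
    moreover have "Re ((-1) ^ k * (deriv ^^ k) F 2 / fact k) = B k"
      unfolding B_def by (metis Re_divide_of_real of_real_fact)
    ultimately show ?thesis by (simp add: l_def)
  qed
  have M0: "M \<ge> 0" using order_trans[OF norm_ge_zero M[of 2]] by simp
  \<comment> \<open>The circle of radius 3/2 stays in the right half plane and at distance at least
    1/2 from the point 1, so division by s - 1 costs only a factor 2.\<close>
  have circ: "norm (Q s) \<le> 4 * M" if "norm (2 - s) = 3/2" for s
  proof -
    have s: "s \<in> cball 2 (3/2)" using that by (simp add: dist_norm)
    have n1: "norm (s - 1) \<ge> 1/2"
      using norm_triangle_ineq2[of "2 - s" "1"] that by (simp add: norm_minus_commute algebra_simps)
    hence "s \<noteq> 1" by auto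
    hence "norm (Q s) = norm (K s - K 1) / norm (s - 1)" by (simp add: Q_def pole_quot_def norm_divide)
    also have "\<dots> \<le> (M + M) / (1/2)"
    proof (rule frac_le)
      show "norm (K s - K 1) \<le> M + M"
        using norm_triangle_ineq4[of "K s" "K 1"] M[OF s] M[of 1] by (simp add: dist_norm)
    qed (use M0 n1 in auto)
    finally show ?thesis by simp
  qed
  have cbd: "norm (c k) \<le> 4 * M * (2/3) ^ k" for k
  proof -
    have "norm ((deriv ^^ k) Q 2) \<le> fact k * (4 * M) / (3/2) ^ k"
    proof (rule Cauchy_inequality)
      show "Q holomorphic_on ball 2 (3/2)"
        by (rule holomorphic_on_subset[OF Qh]) (use cball_2_pos_half ball_subset_cball in blast)
      show "continuous_on (cball 2 (3/2)) Q"
        by (rule holomorphic_on_imp_continuous_on[OF holomorphic_on_subset[OF Qh cball_2_pos_half]])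
    qed (use circ in auto)
    hence "norm ((deriv ^^ k) Q 2) / fact k \<le> 4 * M / (3/2) ^ k" by (simp add: field_simps)
    thus ?thesis by (simp add: c_def norm_mult norm_divide norm_power power_divide)
  qed
  have "(\<lambda>n. c n * of_real (x ^ n)) sums Q (of_real b)"
    unfolding c_def x_def using b by (intro taylor_at_2[OF Qh2]) auto
  from sums_Re[OF this] have S: "(\<lambda>n. (B n - l) * x ^ n) sums Re (Q (of_real b))" by (simp add: cB)
  have sm: "summable (\<lambda>n. (B n - l) * x ^ n)" using S by (simp add: sums_iff)
  have split: "Re (Q (of_real b)) = (\<Sum>n. (B (n + k0) - l) * x ^ (n + k0)) + (\<Sum>n<k0. (B n - l) * x ^ n)"
    using suminf_split_initial_segment[OF sm, of k0] S by (simp add: sums_iff)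
  \<comment> \<open>As 2 - b <= 9/8, the decay (2/3)^n worsens only to (3/4)^n. This is where b >=
    7/8 enters.\<close>
  have tb: "\<bar>(B n - l) * x ^ n\<bar> \<le> 4 * M * (3/4) ^ n" for n
  proof -
    have "\<bar>B n - l\<bar> \<le> 4 * M * (2/3) ^ n" using abs_Re_le_cmod[of "c n"] cbd[of n] by (simp add: cB)
    hence "\<bar>B n - l\<bar> * x ^ n \<le> 4 * M * (2/3) ^ n * (9/8) ^ n"
      using x M0 by (intro mult_mono power_mono) auto
    also have "\<dots> = 4 * M * (3/4) ^ n" by (simp add: power_mult_distrib[symmetric])
    finally show ?thesis using x by (simp add: abs_mult)
  qed
  have geo: "(\<lambda>n. 4 * M * (3/4) ^ (n + k0)) sums (16 * M * (3/4) ^ k0)"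
    using sums_mult[OF geometric_sums[of "3/4::real"], of "4 * M * (3/4) ^ k0"] by (simp add: power_add mult_ac)
  have "norm (\<Sum>n. (B (n + k0) - l) * x ^ (n + k0)) \<le> (\<Sum>n. 4 * M * (3/4) ^ (n + k0))"
    by (rule norm_suminf_le) (use tb geo in \<open>auto simp: sums_iff\<close>)
  also have "\<dots> \<le> 1/2" using geo k0 by (simp add: sums_iff)
  finally have tail: "(\<Sum>n. (B (n + k0) - l) * x ^ (n + k0)) \<ge> - (1/2)" by simp
  have gs: "(\<Sum>n<k0. x ^ n) = (x ^ k0 - 1) / (1 - b)"
    using geometric_sum[of x k0] x by (simp add: x_def)
  \<comment> \<open>Below the cutoff only the constant coefficient is kept; it is at least 1 because
    F is unital.\<close>
  have "(\<Sum>n<k0. B n * x ^ n) \<ge> (\<Sum>n\<in>{0}. B n * x ^ n)"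
    by (rule sum_mono2) (use B0 x k0 in auto)
  hence "(\<Sum>n<k0. (B n - l) * x ^ n) \<ge> 1 - l * ((x ^ k0 - 1) / (1 - b))"
    using B1 gs by (simp add: left_diff_distrib sum_subtractf flip: sum_distrib_left)
  hence low: "Re (Q (of_real b)) \<ge> 1/2 - l * ((x ^ k0 - 1) / (1 - b))" using split tail by linarith
  have "Q (of_real b) = (K (of_real b) - K 1) / of_real (b - 1)"
    using b by (simp add: Q_def pole_quot_def)
  hence "Re (Q (of_real b)) = (Re (K (of_real b)) - l) / (b - 1)"
    by (simp only: Re_divide_of_real l_def minus_complex.simps)
  also have "\<dots> = (l - Re (K (of_real b))) / (1 - b)" using b by (simp add: field_simps)
  also have "\<dots> \<le> l / (1 - b)" using Kb b by (intro divide_right_mono) auto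
  finally have "1/2 \<le> l / (1 - b) + l * ((x ^ k0 - 1) / (1 - b))" using low by linarith
  also have "\<dots> = l * x ^ k0 / (1 - b)" by (simp add: add_divide_distrib diff_divide_distrib right_diff_distrib)
  finally show ?thesis using b unfolding l_def x_def by (simp add: field_simps)
qed

text \<open>The cutoff is k0 = 4 ln (32 M), rounded up: as 3/4 <= exp (-1/4), it makes 16 M (3/4)^k0
  at most 1/2. Its price (2 - b)^k0 is at most 3 (32 M)^(4 (1 - b)), the 3 bounding the effect of
  rounding. For b near 1 only a small power of M is lost.\<close>

lemma estermann_bound:
  assumes K: "K holomorphic_on pos_half"
    and F: "unital_taylor (\<lambda>s. K s / (s - 1))"
    and M: "\<And>s. s \<in> cball 2 (3/2) \<Longrightarrow> norm (K s) \<le> M" and M1: "M \<ge> 1"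
    and b: "7/8 \<le> b" "b < 1" and Kb: "Re (K (of_real b)) \<ge> 0"
  shows "(1 - b) / 6 * (32 * M) powr (- 4 * (1 - b)) \<le> Re (K 1)"
proof -
  define k0 where "k0 = nat \<lceil>4 * ln (32 * M)\<rceil>"
  have lM: "ln (32 * M) > 0" using M1 by simp
  have k1: "real k0 \<ge> 4 * ln (32 * M)" using lM unfolding k0_def by linarith
  have k2: "real k0 \<le> 4 * ln (32 * M) + 1" using lM unfolding k0_def by linarith
  have "k0 > 0" using k1 lM by linarith
  have "(3/4 :: real) \<le> exp (- (1/4))" using exp_ge_add_one_self[of "- (1/4) :: real"] by simp
  hence "(3/4 :: real) ^ k0 \<le> exp (- (1/4)) ^ k0" by (intro power_mono) auto
  also have "\<dots> = exp (- real k0 / 4)" by (simp flip: exp_of_nat_mult)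
  also have "\<dots> \<le> exp (- ln (32 * M))" using k1 by simp
  also have "\<dots> = 1 / (32 * M)" using M1 by (simp add: exp_minus inverse_eq_divide)
  finally have "16 * M * (3/4) ^ k0 \<le> 1/2" using M1 by (simp add: field_simps)
  from estermann_cutoff[OF K F M b Kb \<open>k0 > 0\<close> this]
  have e: "(1 - b) / 2 \<le> Re (K 1) * (2 - b) ^ k0" .
  have "2 - b \<le> exp (1 - b)" using exp_ge_add_one_self[of "1 - b"] by simp
  hence "(2 - b) ^ k0 \<le> exp (1 - b) ^ k0" using b by (intro power_mono) auto
  also have "\<dots> = exp (real k0 * (1 - b))" by (simp flip: exp_of_nat_mult)
  also have "\<dots> \<le> exp ((4 * ln (32 * M) + 1) * (1 - b))" using k2 b by (simp add: mult_right_mono)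
  also have "\<dots> = exp (1 - b) * (32 * M) powr (4 * (1 - b))"
    using M1 by (simp add: powr_def exp_add[symmetric] algebra_simps)
  also have "\<dots> \<le> 3 * (32 * M) powr (4 * (1 - b))"
  proof (rule mult_right_mono)
    have "exp (1 - b) \<le> exp 1" using b by simp
    thus "exp (1 - b) \<le> 3" using exp_le by linarith
  qed simp
  finally have p: "(2 - b) ^ k0 \<le> 3 * (32 * M) powr (4 * (1 - b))" .
  have "Re (K 1) \<ge> 0"
  proof (rule ccontr)
    assume "\<not> Re (K 1) \<ge> 0"
    hence "Re (K 1) * (2 - b) ^ k0 \<le> 0" using b by (intro mult_nonpos_nonneg) auto
    thus False using e b by simp
  qed
  hence "Re (K 1) * (2 - b) ^ k0 \<le> Re (K 1) * (3 * (32 * M) powr (4 * (1 - b)))"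
    using p by (intro mult_left_mono)
  hence "(1 - b) / 2 \<le> Re (K 1) * (3 * (32 * M) powr (4 * (1 - b)))" using e by linarith
  hence "(1 - b) / 6 \<le> Re (K 1) * (32 * M) powr (4 * (1 - b))" by simp
  hence "(1 - b) / 6 * (32 * M) powr (- 4 * (1 - b)) \<le> Re (K 1) * (32 * M) powr (4 * (1 - b)) * (32 * M) powr (- 4 * (1 - b))"
    by (rule mult_right_mono) simp
  also have "\<dots> = Re (K 1)" using M1 by (simp add: mult.assoc powr_add[symmetric])
  finally show ?thesis .
qed


section \<open>Values at one\<close>

lemma nat_powr_of_real: "(of_nat n powr (- of_real x) :: complex) = of_real (real n powr (-x))"
  using powr_of_real[of "real n" "-x"] by simp

lemma partial_sum_real: "(\<And>n. f n \<in> \<real>) \<Longrightarrow> partial_sum f n \<in> \<real>"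
  unfolding partial_sum_def by (rule sum_in_Reals)

lemma Lfun_real:
  assumes ps: "\<And>n. norm (partial_sum f n) \<le> m" and re: "\<And>n. f n \<in> \<real>" and x: "x > 0"
  shows "Lfun f (of_real x) \<in> \<real>"
proof -
  have "summable (\<lambda>n. L_term f n (of_real x))"
    by (rule telescoping_summable[OF norm_L_term[OF ps]]) (use x in auto)
  hence "(\<lambda>n. Im (L_term f n (of_real x))) sums Im (Lfun f (of_real x))"
    unfolding Lfun_def by (intro sums_Im summable_sums)
  moreover have "Im (L_term f n (of_real x)) = 0" for n
    unfolding L_term_def nat_powr_of_real using partial_sum_real[of f, OF re]
    by (simp add: complex_is_Real_iff del: of_nat_Suc)
  ultimately have "Im (Lfun f (of_real x)) = 0" using sums_unique2[OF _ sums_zero] by fastforce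
  thus ?thesis by (simp add: complex_is_Real_iff)
qed

lemma nat_powr_of_real': "(of_nat n powr (1 - of_real x) :: complex) = of_real (real n powr (1 - x))"
  using powr_of_real[of "real n" "1-x"] by simp

lemma zeta_reg_real: assumes x: "x > 0" shows "zeta_reg (of_real x) \<in> \<real>"
proof -
  have "summable (\<lambda>n. zeta_term n (of_real x))"
    by (rule telescoping_summable[OF norm_zeta_term]) (use x in auto)
  hence "(\<lambda>n. Im (zeta_term n (of_real x))) sums Im (\<Sum>n. zeta_term n (of_real x))"
    by (intro sums_Im summable_sums)
  moreover have "Im (zeta_term n (of_real x)) = 0" for n
    unfolding zeta_term_def nat_powr_of_real nat_powr_of_real' by simp
  ultimately have "Im (\<Sum>n. zeta_term n (of_real x)) = 0" using sums_unique2[OF _ sums_zero] by fastforce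
  thus ?thesis by (simp add: complex_is_Real_iff zeta_reg_def)
qed

text \<open>On (0, 1) the distance of \<open>zeta_reg\<close> from 1 is at most 1 - x. In terms of
  zeta this is its negativity on the interval, seen through the factor s - 1.\<close>

lemma Re_zeta_reg_nonneg: assumes "0 < x" "x < 1" shows "Re (zeta_reg (of_real x)) \<ge> 0"
proof -
  have "norm (of_real x - 1 :: complex) = 1 - x"
    using assms by (metis abs_minus_commute abs_of_pos diff_gt_0_iff_gt norm_of_real of_real_1 of_real_diff)
  hence "norm (zeta_reg (of_real x) - 1) \<le> 1 - x"
    using norm_zeta_reg_minus_one[of "of_real x"] assms by simp
  hence "\<bar>Re (zeta_reg (of_real x)) - 1\<bar> \<le> 1 - x" using abs_Re_le_cmod[of "zeta_reg (of_real x) - 1"] by simp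
  thus ?thesis using assms by linarith
qed

lemma sign_fun_real: "sign_fun f \<Longrightarrow> f n \<in> \<real>"
  unfolding sign_fun_def sign_values_def by (metis Reals_0 Reals_1 Reals_minus insertE singletonD)

lemma sign_fun_norm: "sign_fun f \<Longrightarrow> norm (f n) \<le> 1"
  by (simp add: sign_fun_def completely_mult_def)

text \<open>The denominators 1 - f(p) p^(-x) are nonnegative reals, and their product times the
  series tends to 1, which a series with negative real part would contradict.\<close>

lemma Re_dirser_nonneg:
  assumes f: "sign_fun f" and x: "x > 1"
  shows "Re (dirser f (of_real x)) \<ge> 0"
proof (rule ccontr)
  let ?s = "complex_of_real x"
  assume neg: "\<not> Re (dirser f ?s) \<ge> 0"
  have cm: "completely_mult f" using f by (simp add: sign_fun_def)
  have fr: "f p = of_real (Re (f p))" for p using sign_fun_real[OF f, of p] by (simp add: of_real_Re)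
  have pos: "\<exists>e\<ge>0. euler_den f ?s N = of_real e" for N
  proof -
    have "euler_den f ?s N = (\<Prod>p | prime p \<and> p \<le> N. of_real (1 - Re (f p) * real p powr (-x)))"
      unfolding euler_den_def nat_powr_of_real by (subst fr) simp
    moreover have "1 - Re (f p) * real p powr (-x) \<ge> 0" if "prime p" for p
    proof -
      have "Re (f p) \<le> 1" using sign_fun_norm[OF f, of p] complex_Re_le_cmod[of "f p"] by linarith
      moreover have "real p powr (-x) \<le> real p powr 0"
        using prime_ge_2_nat[OF that] x by (intro powr_mono) auto
      ultimately have "Re (f p) * real p powr (-x) \<le> 1 * 1"
        using prime_gt_0_nat[OF that] by (intro mult_mono) auto
      thus ?thesis by simp
    qed
    ultimately show ?thesis
      by (intro exI[of _ "\<Prod>p | prime p \<and> p \<le> N. 1 - Re (f p) * real p powr (-x)"]) (auto intro!: prod_nonneg)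
  qed
  have "(\<lambda>N. Re (euler_den f ?s N * dirser f ?s)) \<longlonglongrightarrow> Re 1"
    by (intro tendsto_Re euler_den_dirser_tendsto cm) (use x in auto)
  moreover have "Re (euler_den f ?s N * dirser f ?s) \<le> 0" for N
  proof -
    obtain e where "e \<ge> 0" "euler_den f ?s N = of_real e" using pos[of N] by blast
    thus ?thesis using neg by (simp add: mult_nonneg_nonpos)
  qed
  ultimately have "Re 1 \<le> 0" by (intro LIMSEQ_le_const2) auto
  thus False by simp
qed

lemma Lfun_tendsto_1:
  assumes ps: "\<And>n. norm (partial_sum f n) \<le> m"
  shows "(\<lambda>n. Lfun f (of_real (1 + 1 / real (Suc n)))) \<longlonglongrightarrow> Lfun f 1"
proof -
  have "isCont (Lfun f) 1"
    using holomorphic_on_imp_continuous_on[OF Lfun_holomorphic[OF ps]] open_pos_half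
    by (simp add: continuous_on_eq_continuous_at)
  moreover have "(\<lambda>n. complex_of_real (1 + 1 / real (Suc n))) \<longlonglongrightarrow> of_real (1 + 0)"
    by (intro tendsto_intros LIMSEQ_inverse_real_of_nat[unfolded inverse_eq_divide])
  ultimately show ?thesis using isCont_tendsto_compose[of 1 "Lfun f"] by simp
qed

lemma cball_norm_bounds:
  assumes "s \<in> cball 2 (3/2)"
  shows "Re s > 0" "norm s / Re s \<le> 7" "norm (s - 1) \<le> 5/2"
proof -
  have n: "norm (2 - s) \<le> 3/2" using assms by (simp add: dist_norm)
  have re: "Re s \<ge> 1/2" using abs_Re_le_cmod[of "2 - s"] n by simp
  thus "Re s > 0" by simp
  have "norm s \<le> 7/2" using norm_triangle_ineq4[of 2 "2 - s"] n by simp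
  hence "norm s / Re s \<le> (7/2) / (1/2)" using re by (intro frac_le) auto
  thus "norm s / Re s \<le> 7" by simp
  show "norm (s - 1) \<le> 5/2" using norm_triangle_ineq4[of 1 "2 - s"] n by (simp add: algebra_simps)
qed

lemma norm_zeta_reg_cball: assumes "s \<in> cball 2 (3/2)" shows "norm (zeta_reg s) \<le> 19"
proof -
  note b = cball_norm_bounds[OF assms]
  have "norm (zeta_reg s) \<le> norm (1::complex) + norm (zeta_reg s - 1)" using norm_triangle_ineq[of 1 "zeta_reg s - 1"] by simp
  also have "norm (zeta_reg s - 1) \<le> norm (s - 1) * (norm s / Re s)" by (rule norm_zeta_reg_minus_one[OF b(1)])
  also have "\<dots> \<le> 5/2 * 7" by (intro mult_mono b) (use b in auto)
  finally show ?thesis by simp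
qed

lemma norm_Lfun_cball:
  assumes ps: "\<And>n. norm (partial_sum f n) \<le> m" and s: "s \<in> cball 2 (3/2)" shows "norm (Lfun f s) \<le> 7 * m"
proof -
  note b = cball_norm_bounds[OF s]
  have "norm (Lfun f s) \<le> m * (norm s / Re s)" by (rule norm_Lfun[OF ps b(1)])
  also have "\<dots> \<le> m * 7" by (intro mult_left_mono b partial_sum_bound_nonneg[OF ps])
  finally show ?thesis by simp
qed

lemma prod_one_plus_ge_sum:
  assumes "finite A" "\<And>x. x \<in> A \<Longrightarrow> a x \<ge> (0::real)" "\<And>x. x \<in> A \<Longrightarrow> b x \<ge> 1 + a x"
  shows "(\<Prod>x\<in>A. b x) \<ge> 1 + (\<Sum>x\<in>A. a x)"
  using assms
proof (induction A rule: finite_induct)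
  case (insert x A)
  have IH: "(\<Prod>x\<in>A. b x) \<ge> 1 + (\<Sum>x\<in>A. a x)" using insert by simp
  have s: "(\<Sum>x\<in>A. a x) \<ge> 0" using insert by (intro sum_nonneg) auto
  have "(1 + a x) * (1 + (\<Sum>x\<in>A. a x)) \<le> b x * (\<Prod>x\<in>A. b x)"
    using IH s insert.prems(1)[of x] insert.prems(2)[of x] by (intro mult_mono) auto
  moreover have "(1 + a x) * (1 + (\<Sum>x\<in>A. a x)) \<ge> 1 + (a x + (\<Sum>x\<in>A. a x))"
    using s insert.prems(1)[of x] by (simp add: algebra_simps)
  ultimately show ?case using insert by simp
qed simp

text \<open>The point 1/2 is chosen because even the smallest factor, at f(p) = -1, is 1 / (1 - 1/p)
  >= 1 + 1/p there, so the finite products are bounded below by a divergent sum.\<close>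

lemma euler2_half:
  assumes f: "sign_fun f"
  shows "Re (euler2 f N (of_real (1/2))) \<ge> (\<Sum>p | prime p \<and> p \<le> N. 1 / real p)"
proof -
  define b where "b = (\<lambda>p. 1 / ((1 - real p powr (-(1/2))) * (1 - Re (f p) * real p powr (-(1/2)))))"
  have fr: "f p = of_real (Re (f p))" for p using sign_fun_real[OF f, of p] by (simp add: of_real_Re)
  have e: "euler_factor2 (f p) p (of_real (1/2)) = of_real (b p)" for p
    unfolding euler_factor2_def b_def nat_powr_of_real by (subst fr) simp
  have "euler2 f N (of_real (1/2)) = of_real (\<Prod>p | prime p \<and> p \<le> N. b p)"
    unfolding euler2_def e by simp
  hence eq: "Re (euler2 f N (of_real (1/2))) = (\<Prod>p | prime p \<and> p \<le> N. b p)"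
    by (simp only: Re_complex_of_real)
  have "b p \<ge> 1 + 1 / real p" if "prime p" for p
  proof -
    define t where "t = real p powr (-(1/2))"
    have p: "p > 1" by (rule prime_gt_1_nat[OF that])
    have t2: "t * t = 1 / real p" using p by (simp add: t_def powr_add[symmetric] powr_minus_divide)
    have t0: "t > 0" using p by (simp add: t_def)
    have "t * t < 1" using t2 p by simp
    hence t1: "t < 1" using t0 mult_mono[of 1 t 1 t] by (cases "t < 1") auto
    have c: "Re (f p) = 0 \<or> Re (f p) = 1 \<or> Re (f p) = -1" 
    proof -
      have "f p \<in> {0, 1, -1}" using f unfolding sign_fun_def sign_values_def by blast
      thus ?thesis by auto
    qed
    have d: "(1 - t) * (1 - Re (f p) * t) > 0" using c t0 t1 by auto
    have "(1 + t * t) * ((1 - t) * (1 - Re (f p) * t)) \<le> 1"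
    proof -
      have 1: "(1 + t * t) * (1 - t) \<le> 1" 
      proof -
        have "(1 + t * t) * (1 - t) = 1 - t * (1 - t) - t * t * t" by (simp add: algebra_simps)
        moreover have "t * (1 - t) \<ge> 0" "t * t * t \<ge> 0" using t0 t1 by auto
        ultimately show ?thesis by linarith
      qed
      have 2: "(1 + t * t) * ((1 - t) * (1 + t)) \<le> 1"
      proof -
        have "(1 + t * t) * ((1 - t) * (1 + t)) = 1 - (t * t) * (t * t)" by (simp add: algebra_simps)
        thus ?thesis by simp
      qed
      have 3: "(1 + t * t) * ((1 - t) * (1 - t)) \<le> 1"
      proof -
        have "((1 + t * t) * (1 - t)) * (1 - t) \<le> 1 * 1" using t0 t1 1 by (intro mult_mono) auto
        thus ?thesis by (simp add: mult.assoc)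
      qed
      show ?thesis using c 1 2 3 by auto
    qed
    hence "1 + t * t \<le> b p" using d by (simp add: b_def t_def[symmetric] pos_le_divide_eq)
    thus ?thesis using t2 by simp
  qed
  hence "(\<Prod>p | prime p \<and> p \<le> N. b p) \<ge> 1 + (\<Sum>p | prime p \<and> p \<le> N. 1 / real p)"
    by (intro prod_one_plus_ge_sum finite_primes) auto
  thus ?thesis unfolding eq by simp
qed

lemma euler2_holo: "sign_fun f \<Longrightarrow> euler2 f N holomorphic_on pos_half"
  unfolding euler2_def[abs_def] euler_factor2_def
proof (intro holomorphic_intros, goal_cases)
  case (1 p s)
  hence p: "p > 1" "Re s > 0" using prime_gt_1_nat[of p] by auto
  have n: "norm (of_nat p powr (-s) :: complex) < 1"
    unfolding norm_nat_powr using p powr_less_mono[of "- Re s" 0 "real p"] by simp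
  have "norm (f p * of_nat p powr (-s)) \<le> 1 * norm (of_nat p powr (-s) :: complex)"
    unfolding norm_mult by (intro mult_right_mono sign_fun_norm 1) auto
  hence "norm (f p * of_nat p powr (-s)) < 1" using n by simp
  thus ?case using n by auto
qed

lemma prime_sum_unbounded: "\<exists>N. (\<Sum>p | prime p \<and> p \<le> N. 1 / real p) > (C::real)"
proof -
  define y where "y = exp (exp (\<bar>C\<bar> + 60))"
  have "exp (\<bar>C\<bar> + 60) \<ge> 1 + (\<bar>C\<bar> + 60)" by (rule exp_ge_add_one_self)
  hence "\<bar>(\<Sum>p\<in>primes_le y. 1 / real p) - ln (ln y)\<bar> \<le> 58"
    by (intro sum_inverse_primes) (auto simp: y_def)
  hence "(\<Sum>p\<in>primes_le y. 1 / real p) > C" by (simp add: y_def)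
  moreover have "primes_le y = {p. prime p \<and> p \<le> nat \<lfloor>y\<rfloor>}" by (auto simp: primes_le_def le_nat_floor le_floor_iff)
       (auto simp: y_def le_nat_iff le_floor_iff)
  ultimately show ?thesis by auto
qed

text \<open>If \<open>L(1) = 0\<close>, then \<open>\<zeta>(s) * L(s)\<close> is holomorphic on the right half plane, and at \<open>s = 1/2\<close> its
  Taylor series around \<open>2\<close> dominates all finite Euler products, which are unbounded there.\<close>

lemma Lfun_1_nonzero:
  assumes f: "sign_fun f" and ps: "\<And>n. norm (partial_sum f n) \<le> m"
  shows "Lfun f 1 \<noteq> 0"
proof
  assume z: "Lfun f 1 = 0"
  define K where "K = (\<lambda>s. zeta_reg s * Lfun f s)"
  have Kh: "K holomorphic_on pos_half"
    unfolding K_def by (intro holomorphic_intros zeta_reg_holomorphic Lfun_holomorphic[OF ps])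
  have K1: "K 1 = 0" by (simp add: K_def z)
  have Qh: "pole_quot K holomorphic_on ball 2 2"
    by (rule holomorphic_on_subset[OF pole_quot_holo[OF Kh] ball_2_pos_half])
  \<comment> \<open>As K(1) = 0, there is no polar part to subtract, and \<open>pole_quot K\<close>
    is zeta(s) L(s) itself.\<close>
  have eq: "dirser (\<lambda>_. 1) s * dirser f s = pole_quot K s" if "s \<in> ball 2 (1/2)" for s
  proof -
    have s: "Re s > 1" using ball_Re[OF that] by simp
    hence "s \<noteq> 1" by auto
    hence "pole_quot K s = K s / (s - 1)" by (simp add: pole_quot_def K1)
    thus ?thesis
      using zeta_reg_eq_dirser[OF s] Lfun_eq_dirser[OF ps sign_fun_norm[OF f] s] \<open>s \<noteq> 1\<close> by (simp add: K_def)
  qed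
  have "Re (euler2 f n (of_real (1/2))) \<le> Re (pole_quot K (of_real (1/2)))" for n
  proof (rule nonneg_taylor_compare[OF Qh])
    show "euler2 f n holomorphic_on ball 2 2"
      by (rule holomorphic_on_subset[OF euler2_holo[OF f] ball_2_pos_half])
    show "nonneg_taylor (\<lambda>s. pole_quot K s - euler2 f n s)"
      by (rule nonneg_taylor_cong[OF nonneg_taylor_zeta_L_minus_euler2[OF f]]) (simp add: eq)
  qed auto
  hence "(\<Sum>p | prime p \<and> p \<le> n. 1 / real p) \<le> Re (pole_quot K (of_real (1/2)))" for n
    using euler2_half[OF f, of n] order_trans by blast
  thus False using prime_sum_unbounded[of "Re (pole_quot K (of_real (1/2)))"] by (meson not_less)
qed

text \<open>Nonnegativity to the right of 1 passes to 1 by continuity, and the value there is real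
  and nonzero.\<close>

lemma Lfun_1_pos:
  assumes f: "sign_fun f" and ps: "\<And>n. norm (partial_sum f n) \<le> m"
  shows "Re (Lfun f 1) > 0"
proof -
  have "Re (Lfun f (of_real (1 + 1 / real (Suc n)))) \<ge> 0" for n
    using Re_dirser_nonneg[OF f, of "1 + 1 / real (Suc n)"] Lfun_eq_dirser[OF ps sign_fun_norm[OF f], of "of_real (1 + 1 / real (Suc n))"]
    by simp
  hence "Re (Lfun f 1) \<ge> 0" using tendsto_Re[OF Lfun_tendsto_1[OF ps]] by (intro LIMSEQ_le_const) auto
  moreover have "Lfun f 1 \<in> \<real>" using Lfun_real[OF ps sign_fun_real[OF f], of 1] by simp
  ultimately show ?thesis using Lfun_1_nonzero[OF f ps] by (auto simp: complex_is_Real_iff complex_eq_iff less_le)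
qed

lemma sum_inverse_le_ln: "N > 0 \<Longrightarrow> (\<Sum>k=1..N. 1 / real k) \<le> 1 + ln (real N)"
proof (induction N rule: nat_induct_non_zero)
  case (Suc n)
  have "ln (real n / real (Suc n)) \<le> real n / real (Suc n) - 1" using Suc.hyps by (intro ln_le_minus_one) auto
  moreover have "ln (real n / real (Suc n)) = ln (real n) - ln (real (Suc n))" by (subst ln_div) (use Suc.hyps in auto)
  moreover have "real n / real (Suc n) - 1 = - (1 / real (Suc n))" by (simp add: field_simps)
  ultimately have "1 / real (Suc n) \<le> ln (real (Suc n)) - ln (real n)" by linarith
  thus ?case using Suc by simp
qed simp

lemma norm_dirser_upto:
  assumes "\<And>n. norm (f n) \<le> 1" "Re s \<ge> 1" "N > 0"
  shows "norm (dirser_upto f N s) \<le> 1 + ln (real N)"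
proof -
  have "norm (dirser_upto f N s) \<le> (\<Sum>k=1..N. 1 / real k)"
    unfolding dirser_upto_def
  proof (rule sum_norm_le)
    fix k assume k: "k \<in> {1..N}"
    have "norm (f k * of_nat k powr (-s)) \<le> 1 * real k powr (- Re s)"
      unfolding norm_mult norm_nat_powr by (intro mult_right_mono assms) auto
    also have "real k powr (- Re s) \<le> real k powr (-1)" using k assms by (intro powr_mono) auto
    finally show "norm (f k * of_nat k powr (-s)) \<le> 1 / real k" using k by (simp add: powr_minus_divide)
  qed
  thus ?thesis using sum_inverse_le_ln[OF assms(3)] by linarith
qed

text \<open>Truncation at the modulus leaves a remainder of at most 2 and a harmonic sum. A bound
  linear in m would ruin Siegel's theorem, where this factor is divided out of the lower
  bound.\<close>

lemma Lfun_1_upper: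
  assumes "\<And>n. norm (f n) \<le> 1" and ps: "\<And>n. norm (partial_sum f n) \<le> real m" and m: "m > 0"
  shows "norm (Lfun f 1) \<le> 3 + ln (real m)"
proof -
  have "norm (Lfun f 1 - dirser_upto f m 1) \<le> 2 * real m * (norm (1::complex) / Re 1) * real (Suc m) powr (- Re 1)"
    by (rule Lfun_dirser_upto[OF ps]) simp
  also have "\<dots> \<le> 2" by (simp add: powr_minus_divide divide_le_eq)
  finally show ?thesis
    using norm_triangle_ineq[of "Lfun f 1 - dirser_upto f m 1" "dirser_upto f m 1"] norm_dirser_upto[of f 1 m] assms by simp
qed

lemma primeser_diff:
  assumes f: "\<And>n. norm (f n) \<le> 1" and g: "\<And>n. norm (g n) \<le> 1" and s: "Re s > 1" and k: "k > 0"
    and eq: "\<And>p. prime p \<Longrightarrow> \<not> p dvd k \<Longrightarrow> f p = g p"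
  shows "norm (primeser f s - primeser g s) \<le> 2 * (\<Sum>p\<in>prime_factors k. 1 / real p)"
proof -
  define z where "z = (\<lambda>n. (on_primes f n - on_primes g n) * of_nat n powr (-s))"
  have "z sums (primeser f s - primeser g s)"
    using sums_diff[OF dirser_sums[OF norm_on_primes[of f, OF f] s] dirser_sums[OF norm_on_primes[of g, OF g] s]]
    by (simp add: z_def left_diff_distrib)
  moreover have "z sums (\<Sum>p\<in>prime_factors k. z p)"
    by (rule sums_finite) (use eq k in \<open>auto simp: z_def on_primes_def in_prime_factors_iff\<close>)
  ultimately have "primeser f s - primeser g s = (\<Sum>p\<in>prime_factors k. z p)" by (rule sums_unique2)
  also have "norm \<dots> \<le> (\<Sum>p\<in>prime_factors k. 2 * (1 / real p))"
  proof (rule sum_norm_le)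
    fix p assume "p \<in> prime_factors k"
    hence p: "prime p" "p > 0" by (auto simp: in_prime_factors_iff prime_gt_0_nat)
    have "norm (z p) = norm (f p - g p) * real p powr (- Re s)"
      using p by (simp add: z_def on_primes_def norm_mult norm_nat_powr)
    also have "\<dots> \<le> 2 * real p powr (-1)"
    proof (rule mult_mono)
      show "norm (f p - g p) \<le> 2" using norm_triangle_ineq4[of "f p" "g p"] f[of p] g[of p] by linarith
      show "real p powr (- Re s) \<le> real p powr (-1)" using p s by (intro powr_mono) auto
    qed auto
    finally show "norm (z p) \<le> 2 * (1 / real p)" using p by (simp add: powr_minus_divide)
  qed
  finally show ?thesis by (simp add: sum_distrib_left)
qed


section \<open>Siegel's theorem\<close>

lemma sign_fun_char:
  assumes "dirichlet_character m \<psi>" "real_char \<psi>" shows "sign_fun (nat_char \<psi>)"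
  using completely_mult_char[OF assms(1)] assms(2) by (simp add: sign_fun_def real_char_def sign_values_def)

text \<open>The constants come from the bounds on \<open>cball 2 (3/2)\<close>: \<open>4256 = 32 * 19 * 7\<close> here, and
  \<open>6517 = 19 * 7 ^ 3\<close> below.\<close>

lemma siegel_zero_free:
  assumes chr: "dirichlet_character m \<psi>" "real_char \<psi>" and np: "\<psi> \<noteq> principal_character m"
    and b: "7/8 \<le> b" "b < 1" and nz: "\<And>x. b \<le> x \<Longrightarrow> x < 1 \<Longrightarrow> Lfun (nat_char \<psi>) (of_real x) \<noteq> 0"
  shows "(1 - b) / 6 * (4256 * real m) powr (- 4 * (1 - b)) \<le> Re (Lfun (nat_char \<psi>) 1)"
proof -
  let ?f = "nat_char \<psi>"
  define K where "K = (\<lambda>s. zeta_reg s * Lfun ?f s)"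
  have f: "sign_fun ?f" by (rule sign_fun_char[OF chr])
  have ps: "norm (partial_sum ?f n) \<le> real m" for n by (rule partial_sum_char_bound[OF chr(1) np])
  have Kh: "K holomorphic_on pos_half"
    unfolding K_def by (intro holomorphic_intros zeta_reg_holomorphic Lfun_holomorphic[OF ps])
  have Re_real: "Lfun ?f (of_real x) = of_real (Re (Lfun ?f (of_real x)))" if "x > 0" for x
    using Lfun_real[OF ps sign_fun_real[OF f] that] by (simp add: of_real_Re)
  \<comment> \<open>A negative value at b together with L(1) > 0 would produce a zero between b and
    1.\<close>
  have Lb: "Re (Lfun ?f (of_real b)) \<ge> 0"
  proof (rule ccontr)
    assume neg: "\<not> ?thesis"
    have "continuous_on {b..1} (\<lambda>x. Re (Lfun ?f (of_real x)))"
      using b by (intro continuous_intros continuous_on_compose2[OF holomorphic_on_imp_continuous_on[OF Lfun_holomorphic[OF ps]]]) auto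
    from IVT'[OF _ _ _ this, of 0] neg Lfun_1_pos[OF f ps] b
    obtain x where x: "b \<le> x" "x \<le> 1" "Re (Lfun ?f (of_real x)) = 0" by auto
    have "x \<noteq> 1" using x Lfun_1_pos[OF f ps] by auto
    thus False using nz[of x] x b Re_real[of x] by auto
  qed
  have "(1 - b) / 6 * (32 * (133 * real m)) powr (- 4 * (1 - b)) \<le> Re (K 1)"
  proof (rule estermann_bound[OF Kh _ _ _ b])
    show "unital_taylor (\<lambda>s. K s / (s - 1))"
    proof (rule unital_taylor_cong[OF unital_taylor_zeta_L[OF f]])
      fix s :: complex assume "s \<in> ball 2 (1/2)"
      hence s: "Re s > 1" using ball_Re[of s] by simp
      hence "s \<noteq> 1" by auto
      thus "dirser (\<lambda>_. 1) s * dirser ?f s = K s / (s - 1)"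
        using zeta_reg_eq_dirser[OF s] Lfun_eq_dirser[OF ps sign_fun_norm[OF f] s] by (simp add: K_def)
    qed
    show "norm (K s) \<le> 133 * real m" if "s \<in> cball 2 (3/2)" for s
    proof -
      have "norm (K s) \<le> 19 * (7 * real m)"
        unfolding K_def norm_mult by (intro mult_mono norm_zeta_reg_cball norm_Lfun_cball[OF ps] that) auto
      thus ?thesis by simp
    qed
    show "133 * real m \<ge> 1" using char_mod_pos[OF chr(1)] by simp
    have "K (of_real b) = of_real (Re (zeta_reg (of_real b)) * Re (Lfun ?f (of_real b)))"
      using Re_real[of b] zeta_reg_real[of b] b by (simp add: K_def of_real_Re)
    thus "Re (K (of_real b)) \<ge> 0" using Lb Re_zeta_reg_nonneg[of b] b by simp
  qed
  thus ?thesis by (simp add: K_def zeta_reg_1 mult.assoc)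
qed

text \<open>Estermann's bound for K(s) = (s - 1) zeta(s) L(s, \<phi>) L(s, \<psi>) L(s,
  \<phi>\<psi>): the zero b of L(s, \<phi>) gives K(b) = 0 whatever \<psi> is. Of the factors of
  K(1), those with \<phi> and \<phi>\<psi> are removed by upper bounds.\<close>

lemma siegel_with_zero:
  assumes c1: "dirichlet_character m1 \<phi>" "real_char \<phi>" "\<phi> \<noteq> principal_character m1"
    and b: "7/8 \<le> b" "b < 1" and z: "Lfun (nat_char \<phi>) (of_real b) = 0"
    and c2: "dirichlet_character m \<psi>" "real_char \<psi>" "\<psi> \<noteq> principal_character m"
    and np: "(\<lambda>a. \<phi> a * \<psi> a) \<noteq> principal_character (m1 * m)"
  shows "(1 - b) / 6 * (32 * (6517 * (real m1)\<^sup>2 * (real m)\<^sup>2)) powr (- 4 * (1 - b))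
           \<le> 7 * real m1 * (3 + ln (real (m1 * m))) * Re (Lfun (nat_char \<psi>) 1)"
proof -
  let ?f = "nat_char \<phi>" and ?g = "nat_char \<psi>" and ?h = "\<lambda>n. nat_char \<phi> n * nat_char \<psi> n"
  have f: "sign_fun ?f" "sign_fun ?g" using sign_fun_char c1 c2 by auto
  have c3: "dirichlet_character (m1 * m) (\<lambda>a. \<phi> a * \<psi> a)" by (rule character_mult[OF c1(1) c2(1)])
  have r3: "real_char (\<lambda>a. \<phi> a * \<psi> a)" using c1(2) c2(2) unfolding real_char_def by fastforce
  have h: "sign_fun ?h" by (rule sign_fun_char[OF c3 r3])
  have ps1: "norm (partial_sum ?f n) \<le> real m1" for n by (rule partial_sum_char_bound[OF c1(1,3)])
  have ps2: "norm (partial_sum ?g n) \<le> real m" for n by (rule partial_sum_char_bound[OF c2(1,3)])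
  have ps3: "norm (partial_sum ?h n) \<le> real (m1 * m)" for n by (rule partial_sum_char_bound[OF c3 np])
  have m: "m1 > 0" "m > 0" using char_mod_pos c1 c2 by auto
  define K where "K = (\<lambda>s. zeta_reg s * Lfun ?f s * (Lfun ?g s * Lfun ?h s))"
  have Kh: "K holomorphic_on pos_half"
    unfolding K_def
    by (intro holomorphic_intros zeta_reg_holomorphic Lfun_holomorphic[OF ps1] Lfun_holomorphic[OF ps2] Lfun_holomorphic[OF ps3])
  have "(1 - b) / 6 * (32 * (6517 * (real m1)\<^sup>2 * (real m)\<^sup>2)) powr (- 4 * (1 - b)) \<le> Re (K 1)"
  proof (rule estermann_bound[OF Kh _ _ _ b])
    show "unital_taylor (\<lambda>s. K s / (s - 1))"
    proof (rule unital_taylor_cong[OF unital_taylor_zeta_LLL[OF f]])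
      fix s :: complex assume "s \<in> ball 2 (1/2)"
      hence s: "Re s > 1" using ball_Re[of s] by simp
      hence "s \<noteq> 1" by auto
      thus "dirser (\<lambda>_. 1) s * dirser ?f s * (dirser ?g s * dirser ?h s) = K s / (s - 1)"
        using zeta_reg_eq_dirser[OF s] Lfun_eq_dirser[OF ps1 sign_fun_norm[OF f(1)] s]
          Lfun_eq_dirser[OF ps2 sign_fun_norm[OF f(2)] s] Lfun_eq_dirser[OF ps3 sign_fun_norm[OF h] s]
        by (simp add: K_def)
    qed
    show "norm (K s) \<le> 6517 * (real m1)\<^sup>2 * (real m)\<^sup>2" if "s \<in> cball 2 (3/2)" for s
    proof -
      have "norm (K s) \<le> 19 * (7 * real m1) * ((7 * real m) * (7 * real (m1 * m)))"
        unfolding K_def norm_mult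
        by (intro mult_mono norm_zeta_reg_cball norm_Lfun_cball[OF ps1] norm_Lfun_cball[OF ps2] norm_Lfun_cball[OF ps3] that) auto
      thus ?thesis by (simp add: power2_eq_square mult_ac)
    qed
    have "1 * 1 \<le> (real m1)\<^sup>2 * (real m)\<^sup>2" using m by (intro mult_mono) auto
    thus "6517 * (real m1)\<^sup>2 * (real m)\<^sup>2 \<ge> 1" by simp
    show "Re (K (of_real b)) \<ge> 0" by (simp add: K_def z)
  qed
  also have "Re (K 1) = Re (Lfun ?f 1) * Re (Lfun ?g 1) * Re (Lfun ?h 1)"
  proof -
    have r: "Lfun ?f 1 = of_real (Re (Lfun ?f 1))" "Lfun ?g 1 = of_real (Re (Lfun ?g 1))" "Lfun ?h 1 = of_real (Re (Lfun ?h 1))"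
      using Lfun_real[OF ps1 sign_fun_real[OF f(1)], of 1] Lfun_real[OF ps2 sign_fun_real[OF f(2)], of 1]
        Lfun_real[OF ps3 sign_fun_real[OF h], of 1] by (simp_all add: of_real_Re)
    have "K 1 = of_real (Re (Lfun ?f 1) * Re (Lfun ?g 1) * Re (Lfun ?h 1))"
      unfolding K_def zeta_reg_1 of_real_mult r[symmetric] by simp
    thus ?thesis by simp
  qed
  also have "\<dots> \<le> (7 * real m1) * Re (Lfun ?g 1) * (3 + ln (real (m1 * m)))"
  proof (intro mult_mono)
    have "norm (Lfun ?f 1) \<le> 7 * real m1" by (rule norm_Lfun_cball[OF ps1]) (simp add: dist_norm)
    thus "Re (Lfun ?f 1) \<le> 7 * real m1" using complex_Re_le_cmod[of "Lfun ?f 1"] by linarith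
    have "norm (Lfun ?h 1) \<le> 3 + ln (real (m1 * m))"
      using m by (intro Lfun_1_upper sign_fun_norm[OF h] ps3) auto
    thus "Re (Lfun ?h 1) \<le> 3 + ln (real (m1 * m))" using complex_Re_le_cmod[of "Lfun ?h 1"] by linarith
  qed (use Lfun_1_pos[OF f(2) ps2] Lfun_1_pos[OF h ps3] in auto)
  also have "\<dots> = 7 * real m1 * (3 + ln (real (m1 * m))) * Re (Lfun ?g 1)" by (simp only: mult_ac)
  finally show ?thesis .
qed

text \<open>The case excluded before, where a principal \<phi>\<psi> would give the fourfold product
  a double pole. Then \<phi> and \<psi> agree at all primes not dividing m1 * m, so the prime sums
  differ only at the divisors, at the cost of a small power of the modulus. Since \<psi> may be
  imprimitive, infinitely many \<psi> fall under this case.\<close>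

lemma Lfun_1_compare:
  assumes c1: "dirichlet_character m1 \<phi>" "real_char \<phi>" "\<phi> \<noteq> principal_character m1"
    and c2: "dirichlet_character m \<psi>" "real_char \<psi>" "\<psi> \<noteq> principal_character m"
    and pr: "(\<lambda>a. \<phi> a * \<psi> a) = principal_character (m1 * m)" and K: "K > (0::nat)"
  shows "exp (- 10 - 2 * real K) * real (m1 * m) powr (- (4 / real K)) * Re (Lfun (nat_char \<phi>) 1) \<le> Re (Lfun (nat_char \<psi>) 1)"
proof -
  let ?f = "nat_char \<phi>" and ?g = "nat_char \<psi>"
  have f: "sign_fun ?f" "sign_fun ?g" using sign_fun_char c1 c2 by auto
  have ps1: "norm (partial_sum ?f n) \<le> real m1" for n by (rule partial_sum_char_bound[OF c1(1,3)])
  have ps2: "norm (partial_sum ?g n) \<le> real m" for n by (rule partial_sum_char_bound[OF c2(1,3)])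
  have m: "m1 > 0" "m > 0" using char_mod_pos c1 c2 by auto
  define C where "C = exp (- 10 - 2 * real K) * real (m1 * m) powr (- (4 / real K))"
  \<comment> \<open>The 10 comes from using the Euler product bound once for each function, the rest
    from the primes dividing m1 * m.\<close>
  have C: "C = exp (- 10 - 2 * (real K + 2 * ln (real (m1 * m)) / real K))"
    using m unfolding C_def by (simp add: powr_def exp_add[symmetric] algebra_simps)
  have main: "C * Re (Lfun ?f (of_real x)) \<le> Re (Lfun ?g (of_real x))" if x: "x > 1" for x
  proof -
    let ?s = "complex_of_real x"
    have s: "Re ?s > 1" using x by simp
    have agree: "?f p = ?g p" if p: "prime p" "\<not> p dvd m1 * m" for p
    proof -
      have "coprime (int p) (int (m1 * m))"
        using p by (metis coprime_int_iff prime_imp_coprime)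
      hence "?f p * ?g p = 1" using fun_cong[OF pr, of "int p"] by (simp add: principal_character_def)
      moreover have "?f p \<in> {0, 1, -1}" "?g p \<in> {0, 1, -1}" using c1(2) c2(2) unfolding real_char_def by blast+
      ultimately show ?thesis by auto
    qed
    have "norm (primeser ?f ?s - primeser ?g ?s) \<le> 2 * (\<Sum>p\<in>prime_factors (m1 * m). 1 / real p)"
      using m by (intro primeser_diff sign_fun_norm[OF f(1)] sign_fun_norm[OF f(2)] s agree) auto
    also have "\<dots> \<le> 2 * (real K + 2 * ln (real (m1 * m)) / real K)"
      using m K by (intro mult_left_mono sum_inverse_prime_factors_le) auto
    finally have P: "Re (primeser ?f ?s) - 2 * (real K + 2 * ln (real (m1 * m)) / real K) \<le> Re (primeser ?g ?s)"
      using complex_Re_le_cmod[of "primeser ?f ?s - primeser ?g ?s"] by simp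
    have nn: "Re (dirser ?f ?s) \<ge> 0" "Re (dirser ?g ?s) \<ge> 0" using Re_dirser_nonneg f x by auto
    have eq: "Lfun ?f ?s = dirser ?f ?s" "Lfun ?g ?s = dirser ?g ?s"
      using Lfun_eq_dirser[OF ps1 sign_fun_norm[OF f(1)] s] Lfun_eq_dirser[OF ps2 sign_fun_norm[OF f(2)] s] by auto
    have re: "Lfun ?g ?s \<in> \<real>" using x by (intro Lfun_real[OF ps2 sign_fun_real[OF f(2)]]) auto
    have "C * Re (dirser ?f ?s) \<le> C * exp (Re (primeser ?f ?s) + 5)"
    proof (rule mult_left_mono)
      show "Re (dirser ?f ?s) \<le> exp (Re (primeser ?f ?s) + 5)"
        using complex_Re_le_cmod[of "dirser ?f ?s"] dirser_euler_bounds(2)[of ?f ?s] f s by (force simp: sign_fun_def)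
    qed (simp add: C_def)
    also have "\<dots> = exp (Re (primeser ?f ?s) - 2 * (real K + 2 * ln (real (m1 * m)) / real K) - 5)"
      unfolding C by (simp add: exp_add[symmetric])
    also have "\<dots> \<le> exp (Re (primeser ?g ?s) - 5)" using P by simp
    also have "\<dots> \<le> norm (dirser ?g ?s)" using dirser_euler_bounds(1)[of ?g ?s] f s by (force simp: sign_fun_def)
    also have "\<dots> = Re (dirser ?g ?s)"
      using re nn unfolding eq by (auto elim!: Reals_cases)
    finally show ?thesis by (simp add: eq)
  qed
  have "C * Re (Lfun ?f 1) \<le> Re (Lfun ?g 1)"
  proof (rule LIMSEQ_le)
    show "(\<lambda>n. C * Re (Lfun ?f (of_real (1 + 1 / real (Suc n))))) \<longlonglongrightarrow> C * Re (Lfun ?f 1)"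
      by (intro tendsto_intros Lfun_tendsto_1[OF ps1])
    show "(\<lambda>n. Re (Lfun ?g (of_real (1 + 1 / real (Suc n))))) \<longlonglongrightarrow> Re (Lfun ?g 1)"
      by (intro tendsto_intros Lfun_tendsto_1[OF ps2])
    show "\<exists>N. \<forall>n\<ge>N. C * Re (Lfun ?f (of_real (1 + 1 / real (Suc n)))) \<le> Re (Lfun ?g (of_real (1 + 1 / real (Suc n))))"
      by (intro exI[of _ 0] allI impI main) simp
  qed
  thus ?thesis by (simp add: C_def)
qed

text \<open>A real character whose L-function vanishes close to \<open>1\<close> is played against all other characters; if
  there is none, each L-function is nonnegative at \<open>1 - d\<close> and \<open>\<zeta>(s) * L(s)\<close> suffices.\<close>

theorem siegel:
  assumes e: "\<epsilon> > (0::real)"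
  shows "\<exists>c>0. \<forall>m \<psi>. dirichlet_character m \<psi> \<and> real_char \<psi> \<and> \<psi> \<noteq> principal_character m
            \<longrightarrow> c * real m powr (-\<epsilon>) \<le> Re (Lfun (nat_char \<psi>) 1)"
proof -
  \<comment> \<open>The 1/8 keeps b >= 7/8. With 16 d <= \<epsilon>, the loss m^(-8 d) uses at most
    half of the exponent \<epsilon>; the other half pays for ln m.\<close>
  define d where "d = min (\<epsilon> / 16) (1/8)"
  have d: "d > 0" "d \<le> 1/8" "16 * d \<le> \<epsilon>" using e by (auto simp: d_def)
  show ?thesis
  proof (cases "\<exists>m1 \<phi> b. dirichlet_character m1 \<phi> \<and> real_char \<phi> \<and> \<phi> \<noteq> principal_character m1 \<and>
                  1 - d \<le> b \<and> b < 1 \<and> Lfun (nat_char \<phi>) (of_real b) = 0")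
    case False
    define c where "c = d / 6 * 4256 powr (- 4 * d)"
    have "c * real m powr (-\<epsilon>) \<le> Re (Lfun (nat_char \<psi>) 1)"
      if c: "dirichlet_character m \<psi>" "real_char \<psi>" "\<psi> \<noteq> principal_character m" for m \<psi>
    proof -
      have m: "real m \<ge> 1" using char_mod_pos[OF c(1)] by linarith
      have "c * real m powr (-\<epsilon>) \<le> c * real m powr (- 4 * d)"
        using m d by (intro mult_left_mono powr_mono) (auto simp: c_def)
      also have "\<dots> = (1 - (1 - d)) / 6 * (4256 * real m) powr (- 4 * (1 - (1 - d)))"
        by (simp add: c_def powr_mult)
      also have "\<dots> \<le> Re (Lfun (nat_char \<psi>) 1)"
        by (rule siegel_zero_free[OF c]) (use False c d in auto)
      finally show ?thesis .
    qed
    moreover have "c > 0" using d by (simp add: c_def)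
    ultimately show ?thesis by blast
  next
    case True
    \<comment> \<open>This character and its zero are fixed once and enter the constants
      \<open>ca\<close> and \<open>cb\<close>. Nothing is known about their size, so the theorem is
      ineffective.\<close>
    then obtain m1 \<phi> b where c1: "dirichlet_character m1 \<phi>" "real_char \<phi>" "\<phi> \<noteq> principal_character m1"
      and b: "1 - d \<le> b" "b < 1" and z: "Lfun (nat_char \<phi>) (of_real b) = 0" by blast
    have m1: "real m1 \<ge> 1" using char_mod_pos[OF c1(1)] by linarith
    define l1 where "l1 = Re (Lfun (nat_char \<phi>) 1)"
    have l1: "l1 > 0" unfolding l1_def
      by (rule Lfun_1_pos[OF sign_fun_char[OF c1(1,2)] partial_sum_char_bound[OF c1(1,3)]])
    define K where "K = nat \<lceil>4 / \<epsilon>\<rceil>"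
    have K: "real K \<ge> 4 / \<epsilon>" unfolding K_def by linarith
    have K0: "K > 0" using K e by (metis divide_pos_pos gr0I not_less of_nat_0 zero_less_numeral)
    have K4: "4 / real K \<le> \<epsilon>" using K K0 e by (simp add: field_simps)
    define ca where "ca = exp (- 10 - 2 * real K) * real m1 powr (- \<epsilon>) * l1"
    define W where "W = 32 * 6517 * (real m1)\<^sup>2"
    \<comment> \<open>Absorbs 3 + ln (m1 * m) into a multiple of m^(\<epsilon>/2), by ln x <= x^a /
      a with a = \<epsilon> / 2.\<close>
    define B where "B = 3 + 2 / \<epsilon> * real m1 powr (\<epsilon>/2)"
    define cb where "cb = (1 - b) / 6 * W powr (- 4 * d) / (7 * real m1 * B)"
    have W: "W \<ge> 1" using mult_mono[of 1 "real m1" 1 "real m1"] m1 by (simp add: W_def power2_eq_square)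
    have B: "B > 0" using e by (auto simp: B_def intro!: add_pos_nonneg)
    have pos: "ca > 0" "cb > 0" using l1 m1 b W B by (simp_all add: ca_def cb_def)
    have "min ca cb * real m powr (-\<epsilon>) \<le> Re (Lfun (nat_char \<psi>) 1)"
      if c: "dirichlet_character m \<psi>" "real_char \<psi>" "\<psi> \<noteq> principal_character m" for m \<psi>
    proof -
      have m: "real m \<ge> 1" using char_mod_pos[OF c(1)] by linarith
      define L where "L = Re (Lfun (nat_char \<psi>) 1)"
      have L: "L > 0" unfolding L_def
        by (rule Lfun_1_pos[OF sign_fun_char[OF c(1,2)] partial_sum_char_bound[OF c(1,3)]])
      show ?thesis
      proof (cases "(\<lambda>a. \<phi> a * \<psi> a) = principal_character (m1 * m)")
        case True
        have mm: "1 \<le> real (m1 * m)" using mult_mono[of 1 "real m1" 1 "real m"] m1 m by simp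
        have "min ca cb * real m powr (-\<epsilon>) \<le> ca * real m powr (-\<epsilon>)" by (intro mult_right_mono) auto
        also have "\<dots> = exp (- 10 - 2 * real K) * real (m1 * m) powr (- \<epsilon>) * l1"
          by (simp add: ca_def powr_mult mult_ac)
        also have "\<dots> \<le> exp (- 10 - 2 * real K) * real (m1 * m) powr (- (4 / real K)) * l1"
          using K4 mm l1 by (intro mult_left_mono mult_right_mono powr_mono) auto
        also have "\<dots> \<le> L" unfolding L_def l1_def by (rule Lfun_1_compare[OF c1 c True K0])
        finally show ?thesis by (simp add: L_def)
      next
        case False
        have m2: "W * (real m)\<^sup>2 \<ge> 1" using mult_mono[of 1 W 1 "(real m)\<^sup>2"] W m by simp
        have "W powr (- 4 * d) * real m powr (- (\<epsilon>/2)) \<le> W powr (- 4 * d) * real m powr (- 8 * d)"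
          using m d by (intro mult_left_mono powr_mono) auto
        also have "real m powr (- 8 * d) = ((real m)\<^sup>2) powr (- 4 * d)"
          using m by (simp add: powr_powr flip: powr_numeral)
        also have "W powr (- 4 * d) * ((real m)\<^sup>2) powr (- 4 * d) = (W * (real m)\<^sup>2) powr (- 4 * d)"
          using W by (simp add: powr_mult)
        also have "\<dots> \<le> (W * (real m)\<^sup>2) powr (- 4 * (1 - b))" using m2 b by (intro powr_mono) auto
        finally have "(1 - b) / 6 * (W powr (- 4 * d) * real m powr (- (\<epsilon>/2))) \<le> (1 - b) / 6 * (W * (real m)\<^sup>2) powr (- 4 * (1 - b))"
          using b by (intro mult_left_mono) auto
        also have "\<dots> \<le> 7 * real m1 * (3 + ln (real (m1 * m))) * L"
          using siegel_with_zero[OF c1 _ b(2) z c False] b d unfolding W_def L_def by (simp add: mult.assoc)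
        also have "\<dots> \<le> 7 * real m1 * (B * real m powr (\<epsilon>/2)) * L"
        proof (intro mult_right_mono mult_left_mono)
          have "1 \<le> real (m1 * m)" using mult_mono[of 1 "real m1" 1 "real m"] m1 m by simp
          hence "ln (real (m1 * m)) \<le> real (m1 * m) powr (\<epsilon>/2) / (\<epsilon>/2)" using e by (intro ln_powr_bound) auto
          also have "\<dots> = 2 / \<epsilon> * real m1 powr (\<epsilon>/2) * real m powr (\<epsilon>/2)" by (simp add: powr_mult)
          finally have "3 + ln (real (m1 * m)) \<le> 3 * real m powr (\<epsilon>/2) + 2 / \<epsilon> * real m1 powr (\<epsilon>/2) * real m powr (\<epsilon>/2)"
            using ge_one_powr_ge_zero[of "real m" "\<epsilon>/2"] m e by simp
          thus "3 + ln (real (m1 * m)) \<le> B * real m powr (\<epsilon>/2)" by (simp add: B_def distrib_right)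
        qed (use L in auto)
        finally have "(1 - b) / 6 * (W powr (- 4 * d) * real m powr (- (\<epsilon>/2))) * real m powr (- (\<epsilon>/2))
                         \<le> 7 * real m1 * (B * real m powr (\<epsilon>/2)) * L * real m powr (- (\<epsilon>/2))"
          by (rule mult_right_mono) simp
        also have "\<dots> = 7 * real m1 * B * L * (real m powr (\<epsilon>/2) * real m powr (- (\<epsilon>/2)))" by (simp only: mult_ac)
        also have "real m powr (\<epsilon>/2) * real m powr (- (\<epsilon>/2)) = 1" using m by (simp flip: powr_add)
        also have "(1 - b) / 6 * (W powr (- 4 * d) * real m powr (- (\<epsilon>/2))) * real m powr (- (\<epsilon>/2))
                     = (1 - b) / 6 * W powr (- 4 * d) * (real m powr (- (\<epsilon>/2)) * real m powr (- (\<epsilon>/2)))" by (simp only: mult_ac)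
        also have "real m powr (- (\<epsilon>/2)) * real m powr (- (\<epsilon>/2)) = real m powr (-\<epsilon>)" by (simp flip: powr_add)
        finally have "cb * real m powr (-\<epsilon>) \<le> L"
          using B m1 by (simp add: cb_def divide_le_eq mult_ac)
        moreover have "min ca cb * real m powr (-\<epsilon>) \<le> cb * real m powr (-\<epsilon>)" by (intro mult_right_mono) auto
        ultimately show ?thesis by (simp add: L_def)
      qed
    qed
    moreover have "min ca cb > 0" using pos by simp
    ultimately show ?thesis by blast
  qed
qed


section \<open>Nonvanishing near the line\<close>

text \<open>For moduli up to T^A and heights up to 2 T^3, truncation at N = T^(A+5) has an error of
  at most 8 / T^2, which is at most 1 / T once T >= 8.\<close>

definition cutoff :: "real \<Rightarrow> real \<Rightarrow> nat" where "cutoff A T = nat \<lfloor>T powr (A + 5)\<rfloor>"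

text \<open>A bound for 1 + ln N at the truncation length N, hence for the harmonic sum of that
  length.\<close>

definition qlog :: "real \<Rightarrow> real \<Rightarrow> real" where "qlog A T = 1 + (A + 6) * ln T"

context
  fixes A T :: real
  assumes A: "A > 0" and T: "T \<ge> 8"
begin

lemma cutoff_bounds: "T powr (A + 5) \<le> real (Suc (cutoff A T))" "cutoff A T > 0"
    "ln (real (Suc (cutoff A T))) \<le> (A + 6) * ln T"
proof -
  have p: "T powr (A + 5) \<ge> 1" using A T by (intro ge_one_powr_ge_zero) auto
  show 1: "T powr (A + 5) \<le> real (Suc (cutoff A T))" unfolding cutoff_def by linarith
  show "cutoff A T > 0" using p unfolding cutoff_def by linarith
  have "real (Suc (cutoff A T)) \<le> T powr (A + 5) + 1" using p unfolding cutoff_def by linarith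
  also have "\<dots> \<le> T powr (A + 5) * T" using mult_left_mono[of 2 T "T powr (A + 5)"] p T by linarith
  also have "\<dots> = T powr (A + 6)" 
  proof -
    have "T powr (A + 5) * T powr 1 = T powr (A + 6)" 
    proof -
      have "(A + 5) + 1 = A + 6" by simp
      thus ?thesis by (simp only: powr_add[symmetric])
    qed
    moreover have "T powr 1 = T" using T by (intro powr_one) auto
    ultimately show ?thesis by (simp only:)
  qed
  finally have "ln (real (Suc (cutoff A T))) \<le> ln (T powr (A + 6))" using p T by (subst ln_le_cancel_iff) auto
  thus "ln (real (Suc (cutoff A T))) \<le> (A + 6) * ln T" using T by (simp add: ln_powr)
qed

lemma has_field_derivative_const_powr:
  assumes "r > 0"
  shows "((\<lambda>s. of_real r powr (c - s)) has_field_derivative (- (of_real r powr (c - z)) * of_real (ln r))) (at (z::complex) within S)"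
proof -
  have eq: "of_real r powr w = exp (w * of_real (ln r) :: complex)" for w
    using assms by (simp add: powr_def Ln_of_real)
  show ?thesis unfolding eq by (auto intro!: derivative_eq_intros)
qed

lemma strip_norm:
  assumes "1 \<le> Re s" "Re s \<le> 2" "\<bar>Im s\<bar> \<le> 2 * T ^ 3"
  shows "norm s / Re s \<le> 4 * T ^ 3" "real (Suc (cutoff A T)) powr (- Re s) \<le> T powr (- (A + 5))"
proof -
  have T3: "T ^ 3 \<ge> 1" using T by simp
  have "norm s \<le> \<bar>Re s\<bar> + \<bar>Im s\<bar>" by (rule cmod_le)
  also have "\<dots> \<le> 4 * T ^ 3" using assms T3 by linarith
  finally have "norm s / Re s \<le> 4 * T ^ 3 / 1" using assms T3 T by (intro frac_le) auto
  thus "norm s / Re s \<le> 4 * T ^ 3" by simp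
  have "real (Suc (cutoff A T)) powr (- Re s) \<le> real (Suc (cutoff A T)) powr (-1)"
    using assms by (intro powr_mono) auto
  also have "\<dots> = 1 / real (Suc (cutoff A T))" by (simp add: powr_minus_divide)
  also have "\<dots> \<le> 1 / T powr (A + 5)"
    using cutoff_bounds(1) T by (intro divide_left_mono) auto
  also have "\<dots> = T powr (- (A + 5))" using T by (simp only: powr_minus_divide)
  finally show "real (Suc (cutoff A T)) powr (- Re s) \<le> T powr (- (A + 5))" .
qed

lemma err_bound: "2 * T powr A * (4 * T ^ 3) * T powr (- (A + 5)) \<le> 1 / T"
proof -
  have "2 * T powr A * (4 * T ^ 3) * T powr (- (A + 5)) = 8 * (T powr A * T powr 3 * T powr (- (A + 5)))"
    using T by (simp add: powr_numeral)
  also have "T powr A * T powr 3 * T powr (- (A + 5)) = T powr (- 2)"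
    by (simp flip: powr_add)
  also have "8 * T powr (- 2) \<le> T * T powr (- 2)" using T by (intro mult_right_mono) auto
  also have "\<dots> = 1 / T" using T by (simp add: powr_minus_divide power2_eq_square powr_numeral)
  finally show ?thesis .
qed

context
  fixes f :: "nat \<Rightarrow> complex" and m :: real
  assumes ps: "\<And>n. norm (partial_sum f n) \<le> m" and m: "m \<le> T powr A" and fb: "\<And>n. norm (f n) \<le> 1"
begin

lemma approx_L:
  assumes s: "1 \<le> Re s" "Re s \<le> 2" "\<bar>Im s\<bar> \<le> 2 * T ^ 3"
  shows "norm (Lfun f s - dirser_upto f (cutoff A T) s) \<le> 1 / T"
proof -
  have "norm (Lfun f s - dirser_upto f (cutoff A T) s) \<le> 2 * m * (norm s / Re s) * real (Suc (cutoff A T)) powr (- Re s)"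
    by (rule Lfun_dirser_upto[OF ps]) (use s in auto)
  also have "\<dots> \<le> 2 * T powr A * (4 * T ^ 3) * T powr (- (A + 5))"
    using strip_norm[OF s] m partial_sum_bound_nonneg[OF ps] s T by (intro mult_mono) auto
  also note err_bound
  finally show ?thesis .
qed

lemma norm_Lfun_le_qlog:
  assumes s: "1 \<le> Re s" "Re s \<le> 2" "\<bar>Im s\<bar> \<le> 2 * T ^ 3"
  shows "norm (Lfun f s) \<le> qlog A T + 1"
proof -
  have "norm (dirser_upto f (cutoff A T) s) \<le> 1 + ln (real (cutoff A T))"
    using s cutoff_bounds by (intro norm_dirser_upto fb) auto
  also have "ln (real (cutoff A T)) \<le> ln (real (Suc (cutoff A T)))" using cutoff_bounds(2) by simp
  also note cutoff_bounds(3)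
  finally have "norm (dirser_upto f (cutoff A T) s) \<le> qlog A T" by (simp add: qlog_def)
  moreover have "1 / T \<le> 1" using T by simp
  ultimately show ?thesis
    using approx_L[OF s] norm_triangle_ineq[of "Lfun f s - dirser_upto f (cutoff A T) s" "dirser_upto f (cutoff A T) s"] by simp
qed

end

lemma dirser_upto_lipschitz:
  assumes fb: "\<And>n. norm (f n) \<le> 1" and s: "1 \<le> Re s" "1 \<le> Re s'"
  shows "norm (dirser_upto f (cutoff A T) s - dirser_upto f (cutoff A T) s') \<le> (qlog A T)\<^sup>2 * norm (s - s')"
proof -
  let ?N = "cutoff A T"
  have lnN: "ln (real ?N) \<ge> 0" "ln (real ?N) \<le> (A + 6) * ln T"
    using cutoff_bounds(2,3) ln_le_cancel_iff[of "real ?N" "real (Suc ?N)"] by (auto simp del: ln_le_cancel_iff)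
  have "norm (dirser_upto f ?N s - dirser_upto f ?N s') \<le> (\<Sum>k=1..?N. ln (real ?N) * (1 / real k)) * norm (s - s')"
    unfolding dirser_upto_def sum_subtractf[symmetric] sum_distrib_right
  proof (rule sum_norm_le)
    fix k assume k: "k \<in> {1..?N}"
    have "norm (of_nat k powr (-s) - of_nat k powr (-s') :: complex) \<le> (ln (real k) * (1 / real k)) * norm (s - s')"
    proof (rule field_differentiable_bound[of "{s. Re s \<ge> 1}"])
      show "convex {s. Re s \<ge> 1}" by (rule convex_halfspace_Re_ge)
      fix z :: complex assume z: "z \<in> {s. Re s \<ge> 1}"
      show "((\<lambda>s. of_nat k powr (-s)) has_field_derivative (- (of_nat k powr (-z)) * of_real (ln (real k)))) (at z within {s. Re s \<ge> 1})"
        using has_field_derivative_const_powr[of "real k" 0 z] k by simp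
      have "real k powr (- Re z) \<le> real k powr (-1)" using k z by (intro powr_mono) auto
      hence "real k powr (- Re z) \<le> 1 / real k" using k by (simp add: powr_minus_divide)
      thus "norm (- (of_nat k powr (-z)) * of_real (ln (real k)) :: complex) \<le> ln (real k) * (1 / real k)"
        using k by (simp only: norm_mult norm_minus_cancel norm_nat_powr norm_of_real mult.commute[of _ "1 / real k"])
          (intro mult_mono, auto)
    qed (use s in auto)
    hence "norm (f k * of_nat k powr (-s) - f k * of_nat k powr (-s')) \<le> 1 * ((ln (real k) * (1 / real k)) * norm (s - s'))"
      unfolding right_diff_distrib[symmetric] norm_mult by (intro mult_mono fb) auto
    also have "\<dots> \<le> ln (real ?N) * (1 / real k) * norm (s - s')"
      using k by (simp add: mult_right_mono divide_right_mono)
    finally show "norm (f k * of_nat k powr (-s) - f k * of_nat k powr (-s')) \<le> ln (real ?N) * (1 / real k) * norm (s - s')" .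
  qed
  also have "(\<Sum>k=1..?N. ln (real ?N) * (1 / real k)) = ln (real ?N) * (\<Sum>k=1..?N. 1 / real k)"
    by (simp only: sum_distrib_left)
  also have "\<dots> \<le> qlog A T * qlog A T"
    using lnN sum_inverse_le_ln[OF cutoff_bounds(2)] by (intro mult_mono) (auto simp: qlog_def intro!: sum_nonneg)
  finally show ?thesis by (simp add: power2_eq_square mult_right_mono)
qed

text \<open>Only the Dirichlet polynomial is differentiated. Replacing L by it at both points
  produces the additive 2 / T and makes a bound for the derivative of L unnecessary.\<close>

lemma Lfun_lipschitz:
  assumes ps: "\<And>n. norm (partial_sum f n) \<le> m" and m: "m \<le> T powr A" and fb: "\<And>n. norm (f n) \<le> 1"
    and s: "1 \<le> Re s" "Re s \<le> 2" "\<bar>Im s\<bar> \<le> 2 * T ^ 3" and s': "1 \<le> Re s'" "Re s' \<le> 2" "\<bar>Im s'\<bar> \<le> 2 * T ^ 3"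
  shows "norm (Lfun f s - Lfun f s') \<le> (qlog A T)\<^sup>2 * norm (s - s') + 2 / T"
proof -
  let ?p = "dirser_upto f (cutoff A T)"
  have "Lfun f s - Lfun f s' = (Lfun f s - ?p s) + (?p s - ?p s') - (Lfun f s' - ?p s')" by simp
  also have "norm \<dots> \<le> norm (Lfun f s - ?p s) + norm (?p s - ?p s') + norm (Lfun f s' - ?p s')"
    using norm_triangle_ineq4 norm_triangle_ineq by (meson add_right_mono order_trans)
  finally show ?thesis
    using approx_L[OF ps m fb s] approx_L[OF ps m fb s'] dirser_upto_lipschitz[of f s s'] fb s(1) s'(1) by simp
qed

text \<open>Unlike for a nonprincipal character, the omitted tail has a main term: the integral of
  x^(-s) beyond N + 1, which is the fraction with denominator s - 1.\<close>

lemma approx_zeta: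
  assumes s: "1 \<le> Re s" "Re s \<le> 2" "\<bar>Im s\<bar> \<le> 2 * T ^ 3" and s1: "s \<noteq> 1"
  shows "norm (zeta_reg s / (s - 1) - dirser_upto (\<lambda>_. 1) (cutoff A T) s - of_nat (Suc (cutoff A T)) powr (1 - s) / (s - 1)) \<le> 1 / T"
proof -
  let ?N = "cutoff A T"
  have "zeta_reg s / (s - 1) - dirser_upto (\<lambda>_. 1) ?N s - of_nat (Suc ?N) powr (1 - s) / (s - 1)
          = (zeta_reg s - (s - 1) * dirser_upto (\<lambda>_. 1) ?N s - of_nat (Suc ?N) powr (1 - s)) / (s - 1)"
    using s1 by (simp add: diff_divide_distrib)
  also have "norm \<dots> \<le> (norm (s - 1) * (norm s / Re s) * real (Suc ?N) powr (- Re s)) / norm (s - 1)"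
    unfolding norm_divide using s by (intro divide_right_mono zeta_reg_dirser_upto) auto
  also have "\<dots> = (norm s / Re s) * real (Suc ?N) powr (- Re s)" using s1 by simp
  also have "\<dots> \<le> 4 * T ^ 3 * T powr (- (A + 5))"
    using strip_norm[OF s] T by (intro mult_mono) auto
  also have "\<dots> \<le> 2 * T powr A * (4 * T ^ 3 * T powr (- (A + 5)))"
    using mult_right_mono[of 1 "2 * T powr A" "4 * T ^ 3 * T powr (- (A + 5))"] ge_one_powr_ge_zero[of T A] A T by simp
  also have "\<dots> \<le> 1 / T" using err_bound by (simp only: mult.assoc)
  finally show ?thesis .
qed

lemma norm_pole_part: "Re s \<ge> 1 \<Longrightarrow> norm (of_nat (Suc (cutoff A T)) powr (1 - s) :: complex) \<le> 1"
  using norm_nat_powr[of "Suc (cutoff A T)" "s - 1"] powr_mono[of "1 - Re s" 0 "real (Suc (cutoff A T))"]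
  by (simp del: of_nat_Suc)

lemma norm_zeta_le:
  assumes s: "1 \<le> Re s" "Re s \<le> 2" "\<bar>Im s\<bar> \<le> 2 * T ^ 3" and s1: "s \<noteq> 1"
  shows "norm (zeta_reg s / (s - 1)) \<le> qlog A T + 1 + 1 / norm (s - 1)"
proof -
  let ?N = "cutoff A T"
  have "norm (dirser_upto (\<lambda>_. 1) ?N s) \<le> 1 + ln (real ?N)"
    using s cutoff_bounds by (intro norm_dirser_upto) auto
  also have "ln (real ?N) \<le> ln (real (Suc ?N))" using cutoff_bounds(2) by simp
  also note cutoff_bounds(3)
  finally have d: "norm (dirser_upto (\<lambda>_. 1) ?N s) \<le> qlog A T" by (simp add: qlog_def)
  have p: "norm (of_nat (Suc ?N) powr (1 - s) / (s - 1)) \<le> 1 / norm (s - 1)"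
    unfolding norm_divide using norm_pole_part[OF s(1)] by (intro divide_right_mono) auto
  have "1 / T \<le> 1" using T by simp
  moreover have "norm (zeta_reg s / (s - 1)) \<le> norm (zeta_reg s / (s - 1) - dirser_upto (\<lambda>_. 1) ?N s - of_nat (Suc ?N) powr (1 - s) / (s - 1))
                  + norm (dirser_upto (\<lambda>_. 1) ?N s) + norm (of_nat (Suc ?N) powr (1 - s) / (s - 1))"
    by (rule order_trans[OF _ add_right_mono[OF norm_triangle_ineq]], rule order_trans[OF _ norm_triangle_ineq]) simp
  ultimately show ?thesis using d p approx_zeta[OF s s1] by linarith
qed

text \<open>Along a horizontal line the distance to the pole is at least |Im s|. The two extra terms
  in the constant bound the derivative of the polar part by means of this.\<close>

lemma zeta_lipschitz:
  assumes s: "1 \<le> Re s" "Re s \<le> 2" "\<bar>Im s\<bar> \<le> 2 * T ^ 3" and s': "1 \<le> Re s'" "Re s' \<le> 2"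
    and im: "Im s' = Im s" "Im s \<noteq> 0"
  shows "norm (zeta_reg s / (s - 1) - zeta_reg s' / (s' - 1))
           \<le> ((qlog A T)\<^sup>2 + qlog A T / \<bar>Im s\<bar> + 1 / (Im s)\<^sup>2) * norm (s - s') + 2 / T"
proof -
  let ?N = "cutoff A T"
  define a where "a = real (Suc ?N)"
  have a: "a \<ge> 1" "ln a \<le> qlog A T" "ln a \<ge> 0" using cutoff_bounds(3) by (auto simp: a_def qlog_def)
  have q0: "qlog A T \<ge> 0" using a(2,3) by linarith
  have n1: "s \<noteq> 1" "s' \<noteq> 1" using im by auto
  let ?p = "dirser_upto (\<lambda>_. 1) ?N"
  define g where "g = (\<lambda>s. of_real a powr (1 - s) / (s - 1) :: complex)"
  define S where "S = {z. Re z \<ge> 1} \<inter> {z. Im z = Im s}"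
  have gd: "norm (g s - g s') \<le> (qlog A T / \<bar>Im s\<bar> + 1 / (Im s)\<^sup>2) * norm (s - s')"
  proof (rule field_differentiable_bound[of S])
    show "convex S" unfolding S_def
      by (intro convex_Int convex_halfspace_Re_ge) (auto simp: convex_def algebra_simps simp flip: distrib_right)
    fix z assume z: "z \<in> S"
    hence z1: "z - 1 \<noteq> 0" "Re z \<ge> 1" "\<bar>Im s\<bar> \<le> norm (z - 1)" using im abs_Im_le_cmod[of "z - 1"] by (auto simp: S_def complex_eq_iff)
    show "(g has_field_derivative (- (of_real a powr (1 - z)) * of_real (ln a) / (z - 1) - of_real a powr (1 - z) / (z - 1)\<^sup>2)) (at z within S)"
      unfolding g_def using z1 a
      by (auto intro!: derivative_eq_intros has_field_derivative_const_powr simp: divide_simps power2_eq_square)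
    have na: "norm (of_real a powr (1 - z) :: complex) \<le> 1"
      using norm_pole_part[OF z1(2)] by (simp add: a_def del: of_nat_Suc)
    have "norm (- (of_real a powr (1 - z)) * of_real (ln a) / (z - 1) - of_real a powr (1 - z) / (z - 1)\<^sup>2)
            \<le> norm (- (of_real a powr (1 - z)) * of_real (ln a) / (z - 1)) + norm (of_real a powr (1 - z) / (z - 1)\<^sup>2)"
      by (rule norm_triangle_ineq4)
    also have "norm (- (of_real a powr (1 - z)) * of_real (ln a) / (z - 1)) \<le> 1 * qlog A T / \<bar>Im s\<bar>"
      unfolding norm_divide norm_mult norm_minus_cancel norm_of_real using na a z1 im q0
      by (intro frac_le mult_mono) auto
    also have "norm (of_real a powr (1 - z) / (z - 1)\<^sup>2) \<le> 1 / \<bar>Im s\<bar>\<^sup>2"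
      unfolding norm_divide norm_power using na z1 im by (intro frac_le power_mono) auto
    finally show "norm (- (of_real a powr (1 - z)) * of_real (ln a) / (z - 1) - of_real a powr (1 - z) / (z - 1)\<^sup>2) \<le> qlog A T / \<bar>Im s\<bar> + 1 / (Im s)\<^sup>2"
      by simp
  qed (use s s' im in \<open>auto simp: S_def\<close>)
  have e1: "norm (zeta_reg s / (s - 1) - ?p s - g s) \<le> 1 / T"
    using approx_zeta[OF s n1(1)] by (simp add: g_def a_def)
  have e2: "norm (zeta_reg s' / (s' - 1) - ?p s' - g s') \<le> 1 / T"
    using approx_zeta[OF s' _ n1(2)] s(3) im by (simp add: g_def a_def)
  have e3: "norm (?p s - ?p s') \<le> (qlog A T)\<^sup>2 * norm (s - s')" by (rule dirser_upto_lipschitz) (use s s' in auto)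
  have "zeta_reg s / (s - 1) - zeta_reg s' / (s' - 1)
          = (zeta_reg s / (s - 1) - ?p s - g s) - (zeta_reg s' / (s' - 1) - ?p s' - g s') + (?p s - ?p s') + (g s - g s')" by simp
  also have "norm \<dots> \<le> norm (zeta_reg s / (s - 1) - ?p s - g s) + norm (zeta_reg s' / (s' - 1) - ?p s' - g s') + norm (?p s - ?p s') + norm (g s - g s')"
    by (intro order_trans[OF norm_triangle_ineq] add_mono norm_triangle_ineq4 order_refl)
  also have "\<dots> \<le> 1 / T + 1 / T + (qlog A T)\<^sup>2 * norm (s - s') + (qlog A T / \<bar>Im s\<bar> + 1 / (Im s)\<^sup>2) * norm (s - s')"
    by (intro add_mono e1 e2 e3 gd)
  finally show ?thesis by (simp add: algebra_simps)
qed

end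

text \<open>On the unit circle the expression is 2 (1 + Re z)^2. The value z = 0 occurs at primes
  dividing the modulus.\<close>

lemma three_four_one_trig:
  assumes "z = 0 \<or> norm z = 1" shows "0 \<le> 3 + 4 * Re z + Re (z\<^sup>2)"
proof (cases "z = 0")
  case False
  hence "(Re z)\<^sup>2 + (Im z)\<^sup>2 = 1" using assms cmod_power2[of z] by simp
  hence "3 + 4 * Re z + Re (z\<^sup>2) = 2 * (1 + Re z)\<^sup>2" by (simp add: power2_eq_square algebra_simps)
  thus ?thesis by simp
qed simp

text \<open>Taken at z = f(p) p^(-iu) and summed with weights p^(-1-d). Squaring z doubles the
  height, which is why upper bounds are prepared up to 2 T^3 while u stays below T^3.\<close>

lemma three_four_one:
  assumes f: "\<And>n. norm (f n) \<le> 1" and f1: "\<And>p. prime p \<Longrightarrow> f p = 0 \<or> norm (f p) = 1" and x: "d > 0"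
  shows "0 \<le> 3 * prime_zeta d + 4 * Re (primeser f (Complex (1 + d) u)) + Re (primeser (\<lambda>n. f n ^ 2) (Complex (1 + d) (2 * u)))"
proof -
  let ?s = "Complex (1 + d) u" and ?s2 = "Complex (1 + d) (2 * u)"
  have f2: "norm (f n ^ 2) \<le> 1" for n using f[of n] by (simp add: norm_power power_le_one)
  have "(\<lambda>n. 3 * prime_term d n + 4 * Re (on_primes f n * of_nat n powr (-?s)) + Re (on_primes (\<lambda>n. f n ^ 2) n * of_nat n powr (-?s2)))
          sums (3 * prime_zeta d + 4 * Re (primeser f ?s) + Re (primeser (\<lambda>n. f n ^ 2) ?s2))"
    using x by (intro sums_add sums_mult prime_term_sums sums_Re dirser_sums norm_on_primes f f2) auto
  moreover have nonneg: "0 \<le> 3 * prime_term d n + 4 * Re (on_primes f n * of_nat n powr (-?s)) + Re (on_primes (\<lambda>n. f n ^ 2) n * of_nat n powr (-?s2))" for n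
  proof (cases "prime n")
    case True
    hence n: "n > 0" by (rule prime_gt_0_nat)
    define z where "z = f n * of_nat n powr (- (\<i> * of_real u))"
    have z: "z = 0 \<or> norm z = 1"
      using f1[OF True] n norm_nat_powr[of n "\<i> * of_real u"] by (auto simp: z_def norm_mult)
    have s: "- ?s = of_real (- (1 + d)) + (- (\<i> * of_real u))" "- ?s2 = of_real (- (1 + d)) + (- (\<i> * of_real u)) + (- (\<i> * of_real u))"
      by (auto simp: complex_eq_iff)
    have r: "(of_nat n powr of_real (- (1 + d)) :: complex) = of_real (real n powr (- 1 - d))"
      using powr_of_real[of "real n" "- (1 + d)"] by simp
    have e1: "f n * of_nat n powr (-?s) = of_real (real n powr (- 1 - d)) * z"
      unfolding s powr_add r z_def by (simp only: mult_ac)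
    have e2: "f n ^ 2 * of_nat n powr (-?s2) = of_real (real n powr (- 1 - d)) * z\<^sup>2"
      unfolding s powr_add r z_def power2_eq_square by (simp only: mult_ac)
    have "3 * prime_term d n + 4 * Re (on_primes f n * of_nat n powr (-?s)) + Re (on_primes (\<lambda>n. f n ^ 2) n * of_nat n powr (-?s2))
            = real n powr (- 1 - d) * (3 + 4 * Re z + Re (z\<^sup>2))"
    proof -
      have "Re (of_real a * w) = a * Re w" for a w by simp
      thus ?thesis using True by (simp only: on_primes_def if_True e1 e2 prime_term_def) (simp add: algebra_simps)
    qed
    thus ?thesis using three_four_one_trig[OF z] by simp
  qed (simp add: on_primes_def prime_term_def)
  ultimately show ?thesis by (intro sums_le[OF nonneg sums_zero])
qed

text \<open>The classical nonvanishing argument, losing a small power of \<open>T\<close> at every step: the 3-4-1 inequality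
  bounds \<open>f\<close> from below at distance \<open>T powr (- 6 * \<delta>)\<close> from the line, and the
  Lipschitz bound carries this to distance \<open>1 / T\<close>.\<close>

lemma nonvanishing:
  assumes f: "completely_mult f" and f1: "\<And>p. prime p \<Longrightarrow> f p = 0 \<or> norm (f p) = 1"
    and T: "T \<ge> 8" and d: "0 < \<delta>" "\<delta> \<le> 1/10"
    and T1: "T powr (\<delta> / 4) \<ge> 3 * exp 10"
    and eta: "\<eta> = T powr (- 6 * \<delta>)"
    and R: "Re (primeser (\<lambda>n. f n ^ 2) (Complex (1 + \<eta>) (2 * u))) \<le> \<delta> * ln T"
    and Q: "norm (dirser f (Complex (1 + 1 / T) u) - dirser f (Complex (1 + \<eta>) u)) \<le> T powr \<delta> * \<eta> + 2 / T"
  shows "Re (primeser f (Complex (1 + 1 / T) u)) \<ge> - 5 * \<delta> * ln T - 5"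
proof -
  have fb: "\<And>n. norm (f n) \<le> 1" using f by (simp add: completely_mult_def)
  have T0: "T > 0" "T \<ge> 1" using T by auto
  have eta0: "\<eta> > 0" using T0 by (simp add: eta)
  have eta2: "\<eta> \<le> 1/2"
  proof -
    have "exp 10 \<ge> (1::real)" by simp
    hence "T powr (\<delta> / 4) \<ge> 2" using T1 by linarith
    moreover have "T powr (\<delta> / 4) \<le> T powr (6 * \<delta>)" using T0 d by (intro powr_mono) auto
    ultimately have "T powr (6 * \<delta>) \<ge> 2" by linarith
    hence "1 / T powr (6 * \<delta>) \<le> 1 / 2" by (intro divide_left_mono) auto
    thus ?thesis using T0 by (simp add: eta powr_minus_divide)
  qed
  have lneta: "ln (1 / \<eta>) = 6 * \<delta> * ln T" using T0 by (simp add: eta ln_div ln_powr)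
  have "4 * Re (primeser f (Complex (1 + \<eta>) u)) \<ge> - 3 * prime_zeta \<eta> - \<delta> * ln T"
    using three_four_one[of f \<eta> u, OF fb f1 eta0] R by simp
  moreover have "prime_zeta \<eta> \<le> 6 * \<delta> * ln T + 6" using prime_zeta_bounds[OF eta0 eta2] lneta by simp
  ultimately have "Re (primeser f (Complex (1 + \<eta>) u)) \<ge> - (19/4) * \<delta> * ln T - 9/2" by linarith
  hence "exp (- 10 - (19/4) * \<delta> * ln T) \<le> exp (Re (primeser f (Complex (1 + \<eta>) u)) - 5)" by simp
  also have "\<dots> \<le> norm (dirser f (Complex (1 + \<eta>) u))"
    using eta0 by (intro dirser_euler_bounds f) auto
  finally have low: "exp (- 10 - (19/4) * \<delta> * ln T) \<le> norm (dirser f (Complex (1 + \<eta>) u))" .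
  have "exp (- 10 - (19/4) * \<delta> * ln T) = T powr (\<delta> / 4) * T powr (- 5 * \<delta>) / exp 10"
  proof -
    have "- 10 - (19/4) * \<delta> * ln T = \<delta> / 4 * ln T + - 5 * \<delta> * ln T - 10" by (simp add: algebra_simps)
    thus ?thesis using T0 unfolding powr_def by (simp only: exp_add exp_diff) simp
  qed
  also have "\<dots> \<ge> 3 * exp 10 * T powr (- 5 * \<delta>) / exp 10"
    using T1 by (intro divide_right_mono mult_right_mono) auto
  finally have l1: "exp (- 10 - (19/4) * \<delta> * ln T) \<ge> 3 * T powr (- 5 * \<delta>)" by simp
  have l2: "T powr \<delta> * \<eta> = T powr (- 5 * \<delta>)" by (simp add: eta flip: powr_add)
  \<comment> \<open>Here \<delta> <= 1/10 is used: it gives 5 \<delta> <= 1/2.\<close>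
  have l3: "2 / T \<le> T powr (- 5 * \<delta>)"
  proof -
    have "T powr (- (1/2)) \<le> T powr (- 5 * \<delta>)" using T0 d by (intro powr_mono) auto
    moreover have "2 / T \<le> T powr (- (1/2))"
    proof -
      have "2 \<le> sqrt T" using T by (intro real_le_rsqrt) auto
      hence "2 / T \<le> sqrt T / T" using T0 by (intro divide_right_mono) auto
      also have "sqrt T / T = 1 / sqrt T" using T0 by (simp add: real_div_sqrt field_simps)
      also have "\<dots> = T powr (- (1/2))" using T0 by (simp add: powr_half_sqrt powr_minus_divide)
      finally show ?thesis .
    qed
    ultimately show ?thesis by linarith
  qed
  have "norm (dirser f (Complex (1 + 1 / T) u)) \<ge> norm (dirser f (Complex (1 + \<eta>) u)) - (T powr \<delta> * \<eta> + 2 / T)"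
    using Q norm_triangle_ineq2[of "dirser f (Complex (1 + \<eta>) u)" "dirser f (Complex (1 + 1 / T) u)"]
    by (simp add: norm_minus_commute)
  \<comment> \<open>Of three copies of T^(-5\<delta>), the Lipschitz term and the truncation error
    take one each.\<close>
  hence "norm (dirser f (Complex (1 + 1 / T) u)) \<ge> T powr (- 5 * \<delta>)" using low l1 l2 l3 by linarith
  also have "norm (dirser f (Complex (1 + 1 / T) u)) \<le> exp (Re (primeser f (Complex (1 + 1 / T) u)) + 5)"
    using T0 by (intro dirser_euler_bounds f) auto
  finally have "exp (- 5 * \<delta> * ln T) \<le> exp (Re (primeser f (Complex (1 + 1 / T) u)) + 5)"
    using T0 by (simp add: powr_def)
  thus ?thesis by simp
qed


section \<open>Character sums over primes\<close>

lemma upper_nonprincipal: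
  assumes A: "A > 0" and e: "\<epsilon> > (0::real)"
  shows "\<forall>\<^sub>F T in at_top. \<forall>m \<psi> s. dirichlet_character m \<psi> \<and> \<psi> \<noteq> principal_character m \<and> real m \<le> T powr A
           \<and> 1 < Re s \<and> Re s \<le> 2 \<and> \<bar>Im s\<bar> \<le> 2 * T ^ 3 \<longrightarrow> Re (primeser (nat_char \<psi>) s) \<le> \<epsilon> * ln T"
proof -
  have "\<forall>\<^sub>F T in at_top. ln (1 + (A + 6) * ln T + 1) + 5 \<le> \<epsilon> * ln (T::real)"
    using A e by real_asymp
  moreover have "\<forall>\<^sub>F T in at_top. (T::real) \<ge> 8" by (rule eventually_ge_at_top)
  ultimately show ?thesis
  proof eventually_elim
    case (elim T)
    show ?case
    proof (intro allI impI, elim conjE)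
      fix m :: nat and \<psi> :: "int \<Rightarrow> complex" and s :: complex
      assume c: "dirichlet_character m \<psi>" "\<psi> \<noteq> principal_character m" and m: "real m \<le> T powr A"
        and s: "1 < Re s" "Re s \<le> 2" "\<bar>Im s\<bar> \<le> 2 * T ^ 3"
      have fb: "norm (nat_char \<psi> n) \<le> 1" for n by (rule char_norm_le[OF c(1)])
      have ps: "norm (partial_sum (nat_char \<psi>) n) \<le> real m" for n by (rule partial_sum_char_bound[OF c])
      have q0: "qlog A T + 1 > 0" using A elim by (auto simp: qlog_def intro!: add_nonneg_pos)
      have "exp (Re (primeser (nat_char \<psi>) s) - 5) \<le> norm (dirser (nat_char \<psi>) s)"
        by (rule dirser_euler_bounds(1)[OF completely_mult_char[OF c(1)] s(1)])
      also have "dirser (nat_char \<psi>) s = Lfun (nat_char \<psi>) s" by (rule Lfun_eq_dirser[OF ps fb s(1), symmetric])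
      also have "norm \<dots> \<le> qlog A T + 1"
        by (rule norm_Lfun_le_qlog[OF A elim(2) ps m fb]) (use s in auto)
      finally have "ln (exp (Re (primeser (nat_char \<psi>) s) - 5)) \<le> ln (qlog A T + 1)" using q0 by (subst ln_le_cancel_iff) auto
      thus "Re (primeser (nat_char \<psi>) s) \<le> \<epsilon> * ln T" using elim(1) by (simp add: qlog_def)
    qed
  qed
qed

text \<open>At heights of at least T^(-\<delta>/4) the pole contributes at most T^(\<delta>/4) to
  |zeta|, so \<delta>/4 * ln T to its logarithm; the other \<delta>/4 absorbs the terms of size ln T
  and the constants.\<close>

lemma upper_zeta:
  assumes d: "\<delta> > (0::real)"
  shows "\<forall>\<^sub>F T in at_top. \<forall>s. 1 < Re s \<and> Re s \<le> 2 \<and> \<bar>Im s\<bar> \<le> 2 * T ^ 3 \<and> T powr (- (\<delta> / 4)) \<le> \<bar>Im s\<bar>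
           \<longrightarrow> Re (primeser (\<lambda>_. 1) s) \<le> \<delta> / 2 * ln T"
proof -
  have "\<forall>\<^sub>F T in at_top. ln (1 + (1 + 6) * ln T + 1 + T powr (\<delta> / 4)) + 5 \<le> \<delta> / 2 * ln (T::real)"
    using d by real_asymp
  moreover have "\<forall>\<^sub>F T in at_top. (T::real) \<ge> 8" by (rule eventually_ge_at_top)
  ultimately show ?thesis
  proof eventually_elim
    case (elim T)
    show ?case
    proof (intro allI impI, elim conjE)
      fix s :: complex
      assume s: "1 < Re s" "Re s \<le> 2" "\<bar>Im s\<bar> \<le> 2 * T ^ 3" "T powr (- (\<delta> / 4)) \<le> \<bar>Im s\<bar>"
      have s1: "s \<noteq> 1" using s(1) by auto
      have q0: "qlog 1 T + 1 > 0" using elim by (auto simp: qlog_def intro!: add_nonneg_pos)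
      have "exp (Re (primeser (\<lambda>_. 1) s) - 5) \<le> norm (dirser (\<lambda>_. 1) s)"
        by (rule dirser_euler_bounds(1)[OF completely_mult_one s(1)])
      also have "dirser (\<lambda>_. 1) s = zeta_reg s / (s - 1)" using zeta_reg_eq_dirser[OF s(1)] s1 by simp
      also have "norm \<dots> \<le> qlog 1 T + 1 + 1 / norm (s - 1)"
        by (rule norm_zeta_le) (use s s1 elim in auto)
      also have "1 / norm (s - 1) \<le> 1 / T powr (- (\<delta> / 4))"
        using s(4) abs_Im_le_cmod[of "s - 1"] elim s1 by (intro divide_left_mono) auto
      also have "1 / T powr (- (\<delta> / 4)) = T powr (\<delta> / 4)" using elim by (simp add: powr_minus_divide)
      finally have "ln (exp (Re (primeser (\<lambda>_. 1) s) - 5)) \<le> ln (qlog 1 T + 1 + T powr (\<delta> / 4))"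
        using q0 by (subst ln_le_cancel_iff) (auto intro!: add_pos_nonneg)
      thus "Re (primeser (\<lambda>_. 1) s) \<le> \<delta> / 2 * ln T" using elim(1) by (simp add: qlog_def)
    qed
  qed
qed

text \<open>The two sums differ only at primes dividing m. With K >= 8 A / \<delta>, the part
  proportional to ln m <= A ln T is at most \<delta>/2 * ln T, and the fixed part 2 K is eventually
  at most that as well.\<close>

lemma principal_diff:
  assumes A: "A > 0" and d: "\<delta> > (0::real)"
  shows "\<forall>\<^sub>F T in at_top. \<forall>m s. m > 0 \<and> real m \<le> T powr A \<and> 1 < Re s
           \<longrightarrow> \<bar>Re (primeser (nat_char (principal_character m)) s) - Re (primeser (\<lambda>_. 1) s)\<bar> \<le> \<delta> * ln T"
proof -
  define K where "K = nat \<lceil>8 * A / \<delta>\<rceil>"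
  have K: "real K \<ge> 8 * A / \<delta>" unfolding K_def by linarith
  moreover have "8 * A / \<delta> > 0" using A d by simp
  ultimately have K0: "K > 0" by (metis not_less of_nat_0 gr0I)
  have K1: "4 * A / real K \<le> \<delta> / 2" using K K0 A d by (simp add: field_simps)
  have "\<forall>\<^sub>F T in at_top. 2 * real K \<le> \<delta> / 2 * ln (T::real)" using d by real_asymp
  moreover have "\<forall>\<^sub>F T in at_top. (T::real) \<ge> 8" by (rule eventually_ge_at_top)
  ultimately show ?thesis
  proof eventually_elim
    case (elim T)
    show ?case
    proof (intro allI impI, elim conjE)
      fix m :: nat and s :: complex
      assume m: "m > 0" "real m \<le> T powr A" and s: "1 < Re s"
      have lnm: "ln (real m) \<le> A * ln T"
      proof -
        have "ln (real m) \<le> ln (T powr A)" using m elim by (subst ln_le_cancel_iff) auto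
        thus ?thesis using elim by (simp add: ln_powr)
      qed
      have "norm (primeser (nat_char (principal_character m)) s - primeser (\<lambda>_. 1) s) \<le> 2 * (\<Sum>p\<in>prime_factors m. 1 / real p)"
      proof (rule primeser_diff[OF _ _ s m(1)])
        fix p assume "prime p" "\<not> p dvd m"
        hence "coprime (int p) (int m)" by (metis coprime_int_iff prime_imp_coprime)
        thus "principal_character m (int p) = 1" by (simp add: principal_character_def)
      qed (auto simp: principal_character_def)
      also have "\<dots> \<le> 2 * (real K + 2 * ln (real m) / real K)"
        using m K0 by (intro mult_left_mono sum_inverse_prime_factors_le) auto
      also have "\<dots> \<le> 2 * (real K + 2 * (A * ln T) / real K)"
        using lnm K0 by (intro mult_left_mono add_left_mono divide_right_mono) auto
      also have "\<dots> = 2 * real K + (4 * A / real K) * ln T" by (simp add: algebra_simps)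
      also have "\<dots> \<le> \<delta> / 2 * ln T + \<delta> / 2 * ln T"
        using K1 elim by (intro add_mono mult_right_mono) auto
      finally have "norm (primeser (nat_char (principal_character m)) s - primeser (\<lambda>_. 1) s) \<le> \<delta> * ln T" by (simp add: field_simps)
      thus "\<bar>Re (primeser (nat_char (principal_character m)) s) - Re (primeser (\<lambda>_. 1) s)\<bar> \<le> \<delta> * ln T"
        using abs_Re_le_cmod[of "primeser (nat_char (principal_character m)) s - primeser (\<lambda>_. 1) s"] by simp
    qed
  qed
qed

lemma eta_bounds:
  assumes T: "T \<ge> (8::real)" and d: "0 < \<delta>" "\<delta> \<le> 1/10"
  defines "\<eta> \<equiv> T powr (- 6 * \<delta>)"
  shows "0 < \<eta>" "\<eta> \<le> 1" "norm (Complex (1 + 1 / T) u - Complex (1 + \<eta>) u) \<le> \<eta>"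
    "1 / T \<le> T powr (- (\<delta> / 4))" "\<bar>u\<bar> \<le> T ^ 3 \<Longrightarrow> \<bar>u\<bar> \<le> 2 * T ^ 3" "0 < 1 / T" "1 / T \<le> 1"
proof -
  show "0 < \<eta>" using T by (simp add: \<eta>_def)
  have "T powr (- 6 * \<delta>) \<le> T powr 0" using T d by (intro powr_mono) auto
  thus "\<eta> \<le> 1" using T by (simp add: \<eta>_def)
  have r: "1 / T = T powr (-1)" using T by (simp add: powr_minus_divide)
  have le: "1 / T \<le> \<eta>" unfolding r \<eta>_def using T d by (intro powr_mono) auto
  show "1 / T \<le> T powr (- (\<delta> / 4))" unfolding r using T d by (intro powr_mono) auto
  have "Complex (1 + 1 / T) u - Complex (1 + \<eta>) u = of_real (1 / T - \<eta>)" by (simp add: complex_eq_iff)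
  hence "norm (Complex (1 + 1 / T) u - Complex (1 + \<eta>) u) = \<bar>1 / T - \<eta>\<bar>" by (simp only: norm_of_real)
  moreover have "1 / T > 0" using T by simp
  ultimately show "norm (Complex (1 + 1 / T) u - Complex (1 + \<eta>) u) \<le> \<eta>" using le by linarith
  show "\<bar>u\<bar> \<le> T ^ 3 \<Longrightarrow> \<bar>u\<bar> \<le> 2 * T ^ 3" using T by (smt (verit) zero_le_power)
qed (use T in auto)

text \<open>For |u| >= T^(-\<delta>/4) the nonvanishing argument applies with f = 1, the pole being
  far enough away at heights u and 2 u. Closer to the real axis the pole itself helps: |zeta_reg| >=
  1/4 and |s - 1| <= 3/8.\<close>

lemma lower_zeta:
  assumes d: "0 < \<delta>" "\<delta> \<le> (1/10 :: real)"
  shows "\<forall>\<^sub>F T in at_top. \<forall>u. \<bar>u\<bar> \<le> T ^ 3 \<longrightarrow> Re (primeser (\<lambda>_. 1) (Complex (1 + 1 / T) u)) \<ge> - 6 * \<delta> * ln T"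
proof -
  have "\<forall>\<^sub>F T in at_top. T powr (\<delta> / 4) \<ge> 3 * exp 10" using d by real_asymp
  moreover have "\<forall>\<^sub>F T in at_top. (1 + (1 + 6) * ln T)\<^sup>2 + (1 + (1 + 6) * ln T) * T powr (\<delta> / 4) + T powr (\<delta> / 2) \<le> T powr \<delta>"
    using d by real_asymp
  moreover have "\<forall>\<^sub>F T in at_top. T powr (- (\<delta> / 4)) \<le> 1/4" using d by real_asymp
  moreover have "\<forall>\<^sub>F T in at_top. 5 \<le> \<delta> * ln (T::real)" using d by real_asymp
  moreover have "\<forall>\<^sub>F T in at_top. (T::real) \<ge> 8" by (rule eventually_ge_at_top)
  ultimately show ?thesis using upper_zeta[OF d(1)]
  proof eventually_elim
    case (elim T)
    show ?case
    proof (intro allI impI)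
      fix u :: real assume u: "\<bar>u\<bar> \<le> T ^ 3"
      define \<eta> where "\<eta> = T powr (- 6 * \<delta>)"
      note ef = eta_bounds[OF elim(5) d, folded \<eta>_def]
      let ?s = "Complex (1 + 1 / T) u" and ?s' = "Complex (1 + \<eta>) u"
      have z: "dirser (\<lambda>_. 1) s = zeta_reg s / (s - 1)" if "Re s > 1" for s
        using zeta_reg_eq_dirser[OF that] that by auto
      show "Re (primeser (\<lambda>_. 1) ?s) \<ge> - 6 * \<delta> * ln T"
      proof (cases "T powr (- (\<delta> / 4)) \<le> \<bar>u\<bar>")
        case True
        have u0: "u \<noteq> 0" using True elim(5) by auto
        have "Re (primeser (\<lambda>_. 1) ?s) \<ge> - 5 * \<delta> * ln T - 5"
        proof (rule nonvanishing[OF completely_mult_one _ elim(5) d elim(1) \<eta>_def])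
          have "Re (primeser (\<lambda>_. 1) (Complex (1 + \<eta>) (2 * u))) \<le> \<delta> / 2 * ln T"
            by (rule elim(6)[rule_format]) (use ef u True in auto)
          also have "\<dots> \<le> \<delta> * ln T" using d elim(5) by (intro mult_right_mono) auto
          finally show "Re (primeser (\<lambda>n. 1 ^ 2) (Complex (1 + \<eta>) (2 * u))) \<le> \<delta> * ln T" by simp
          have "norm (zeta_reg ?s / (?s - 1) - zeta_reg ?s' / (?s' - 1))
                  \<le> ((qlog 1 T)\<^sup>2 + qlog 1 T / \<bar>Im ?s\<bar> + 1 / (Im ?s)\<^sup>2) * norm (?s - ?s') + 2 / T"
            by (rule zeta_lipschitz) (use ef u u0 elim in auto)
          also have "\<dots> \<le> T powr \<delta> * \<eta> + 2 / T"
          proof (intro add_right_mono mult_mono ef)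
            have q0: "qlog 1 T \<ge> 0" using elim by (auto simp: qlog_def)
            have iu: "1 / \<bar>u\<bar> \<le> T powr (\<delta> / 4)"
            proof -
              have "1 / \<bar>u\<bar> \<le> 1 / T powr (- (\<delta> / 4))" using True elim u0 by (intro divide_left_mono) auto
              thus ?thesis using elim by (simp add: powr_minus_divide)
            qed
            have "1 / u\<^sup>2 = (1 / \<bar>u\<bar>)\<^sup>2" by (simp add: power_divide)
            also have "\<dots> \<le> (T powr (\<delta> / 4))\<^sup>2" by (intro power_mono iu) auto
            also have "\<dots> = T powr (\<delta> / 2)" by (simp add: power2_eq_square flip: powr_add)
            finally have iu2: "1 / u\<^sup>2 \<le> T powr (\<delta> / 2)" .
            have "qlog 1 T / \<bar>u\<bar> \<le> qlog 1 T * T powr (\<delta> / 4)" using mult_left_mono[OF iu q0] by simp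
            thus "(qlog 1 T)\<^sup>2 + qlog 1 T / \<bar>Im ?s\<bar> + 1 / (Im ?s)\<^sup>2 \<le> T powr \<delta>"
              using elim(2) iu2 by (simp add: qlog_def)
          qed auto
          finally show "norm (dirser (\<lambda>_. 1) ?s - dirser (\<lambda>_. 1) ?s') \<le> T powr \<delta> * \<eta> + 2 / T"
            using ef by (simp add: z)
        qed auto
        thus ?thesis using elim(4) by linarith
      next
        case False
        have n: "norm (?s - 1) \<le> 1 / T + \<bar>u\<bar>"
          using cmod_le[of "?s - 1"] elim(5) by simp
        moreover have "1 / T \<le> 1/8" using elim(5) by (simp add: field_simps)
        ultimately have n1: "norm (?s - 1) \<le> 3/8" using False elim(3) by linarith
        have "norm ?s \<le> 2" using norm_triangle_ineq[of "?s - 1" 1] n1 by simp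
        hence "norm ?s / Re ?s \<le> 2 / 1" using ef by (intro frac_le) auto
        hence "norm (?s - 1) * (norm ?s / Re ?s) \<le> 3/8 * 2" by (intro mult_mono n1) (use ef in auto)
        moreover have "norm (zeta_reg ?s - 1) \<le> norm (?s - 1) * (norm ?s / Re ?s)"
          by (rule norm_zeta_reg_minus_one) (use elim(5) in \<open>auto intro: add_pos_pos\<close>)
        ultimately have "norm (zeta_reg ?s - 1) \<le> 3/4" by linarith
        hence z4: "norm (zeta_reg ?s) \<ge> 1/4" using norm_triangle_ineq2[of 1 "1 - zeta_reg ?s"] by (simp add: norm_minus_commute)
        have sne: "norm (?s - 1) > 0" using ef by (auto simp: complex_eq_iff)
        have "(1/4) / (3/8) \<le> norm (zeta_reg ?s) / norm (?s - 1)" using z4 n1 sne by (intro frac_le) auto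
        hence "exp (-5 + 5) * (1/4) / (3/8) \<le> norm (dirser (\<lambda>_. 1) ?s)" using ef by (simp add: z norm_divide)
        also have "\<dots> \<le> exp (Re (primeser (\<lambda>_. 1) ?s) + 5)" by (rule dirser_euler_bounds(2)[OF completely_mult_one]) (use ef in auto)
        finally have "2/3 \<le> exp (Re (primeser (\<lambda>_. 1) ?s) + 5)" by simp
        moreover have "exp (-1) \<le> (2/3 :: real)"
          using exp_ge_add_one_self[of "1::real"] by (simp add: exp_minus field_simps)
        ultimately have "-1 \<le> Re (primeser (\<lambda>_. 1) ?s) + 5" by (meson exp_le_cancel_iff order_trans)
        moreover have "6 * \<delta> * ln T \<ge> 6 * 5" using elim(4) by linarith
        ultimately show ?thesis by linarith
      qed
    qed
  qed
qed

text \<open>The 3-4-1 inequality needs an upper bound for \<psi>^2 at height 2 u. It exists if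
  \<psi>^2 is nonprincipal, or if it is principal and 2 u is away from the pole of zeta. What
  remains is \<psi> real with |u| < T^(-\<delta>/4).\<close>

lemma lower_nonprincipal:
  assumes A: "A > 0" and d: "0 < \<delta>" "\<delta> \<le> (1/10 :: real)"
  shows "\<forall>\<^sub>F T in at_top. \<forall>m \<psi> u. dirichlet_character m \<psi> \<and> \<psi> \<noteq> principal_character m \<and> real m \<le> T powr A
           \<and> \<bar>u\<bar> \<le> T ^ 3 \<longrightarrow> Re (primeser (nat_char \<psi>) (Complex (1 + 1 / T) u)) \<ge> - 6 * \<delta> * ln T"
proof -
  \<comment> \<open>For m <= T^A this exponent turns Siegel's bound into c T^(-\<delta>/8), which
    outweighs the Lipschitz loss, of order T^(-\<delta>/4) times ln(T)^2, between 1 and s.\<close>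
  have "\<delta> / (8 * A) > 0" using A d by simp
  from siegel[OF this] obtain c where c: "c > 0"
    "\<And>m \<psi>. dirichlet_character m \<psi> \<Longrightarrow> real_char \<psi> \<Longrightarrow> \<psi> \<noteq> principal_character m
            \<Longrightarrow> c * real m powr (- (\<delta> / (8 * A))) \<le> Re (Lfun (nat_char \<psi>) 1)" by blast
  have d2: "\<delta> / 2 > 0" using d by simp
  have "\<forall>\<^sub>F T in at_top. T powr (\<delta> / 4) \<ge> 3 * exp 10" using d by real_asymp
  moreover have "\<forall>\<^sub>F T in at_top. (1 + (A + 6) * ln T)\<^sup>2 \<le> T powr \<delta>"
    using d A by real_asymp
  moreover have "\<forall>\<^sub>F T in at_top. c * T powr (- (\<delta> / 8)) - (2 * (1 + (A + 6) * ln T)\<^sup>2 + 2) * T powr (- (\<delta> / 4)) \<ge> T powr (- \<delta>)"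
    using d A c by real_asymp
  moreover have "\<forall>\<^sub>F T in at_top. 5 \<le> \<delta> * ln (T::real)" using d by real_asymp
  moreover have "\<forall>\<^sub>F T in at_top. (T::real) \<ge> 8" by (rule eventually_ge_at_top)
  ultimately show ?thesis using upper_zeta[OF d(1)] upper_nonprincipal[OF A d(1)] principal_diff[OF A d2]
  proof eventually_elim
    case (elim T)
    note ee = elim(1-5) and uz = elim(6)[rule_format] and un = elim(7)[rule_format] and pd = elim(8)[rule_format]
    show ?case
    proof (intro allI impI, elim conjE)
      fix m :: nat and \<psi> :: "int \<Rightarrow> complex" and u :: real
      assume ch: "dirichlet_character m \<psi>" "\<psi> \<noteq> principal_character m" and m: "real m \<le> T powr A" and u: "\<bar>u\<bar> \<le> T ^ 3"
      define \<eta> where "\<eta> = T powr (- 6 * \<delta>)"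
      note ef = eta_bounds[OF ee(5) d, folded \<eta>_def]
      let ?s = "Complex (1 + 1 / T) u" and ?s' = "Complex (1 + \<eta>) u" and ?f = "nat_char \<psi>"
      have fb: "norm (?f n) \<le> 1" for n by (rule char_norm_le[OF ch(1)])
      have ps: "norm (partial_sum ?f n) \<le> real m" for n by (rule partial_sum_char_bound[OF ch])
      have m0: "m > 0" by (rule char_mod_pos[OF ch(1)])
      have ch2: "dirichlet_character m (\<lambda>a. \<psi> a ^ 2)" by (rule char_power_character[OF ch(1)]) simp
      have LD: "Lfun ?f s = dirser ?f s" if "Re s > 1" for s by (rule Lfun_eq_dirser[OF ps fb that])
      have mainc: "Re (primeser ?f ?s) \<ge> - 6 * \<delta> * ln T"
        if R: "Re (primeser (\<lambda>n. ?f n ^ 2) (Complex (1 + \<eta>) (2 * u))) \<le> \<delta> * ln T"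
      proof -
        have "Re (primeser ?f ?s) \<ge> - 5 * \<delta> * ln T - 5"
        proof (rule nonvanishing[OF completely_mult_char[OF ch(1)] _ ee(5) d ee(1) \<eta>_def R])
          show "?f p = 0 \<or> norm (?f p) = 1" for p by (rule char_norm_cases[OF ch(1)])
          have "norm (Lfun ?f ?s - Lfun ?f ?s') \<le> (qlog A T)\<^sup>2 * norm (?s - ?s') + 2 / T"
            by (rule Lfun_lipschitz[OF A ee(5) ps m fb]) (use ef u in auto)
          also have "\<dots> \<le> T powr \<delta> * \<eta> + 2 / T"
            using ee(2) ef by (intro add_right_mono mult_mono) (auto simp: qlog_def)
          finally show "norm (dirser ?f ?s - dirser ?f ?s') \<le> T powr \<delta> * \<eta> + 2 / T"
            using ef by (simp add: LD)
        qed
        thus ?thesis using ee(4) by linarith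
      qed
      show "Re (primeser ?f ?s) \<ge> - 6 * \<delta> * ln T"
      proof (cases "(\<lambda>a. \<psi> a ^ 2) = principal_character m")
        case False
        show ?thesis
          by (rule mainc, rule un[of m "\<lambda>a. \<psi> a ^ 2"]) (use ch2 False m ef u in auto)
      next
        case sq: True
        show ?thesis
        proof (cases "T powr (- (\<delta> / 4)) \<le> \<bar>u\<bar>")
          case True
          have "Re (primeser (\<lambda>_. 1) (Complex (1 + \<eta>) (2 * u))) \<le> \<delta> / 2 * ln T"
            by (rule uz) (use ef u True in auto)
          moreover have "\<bar>Re (primeser (nat_char (principal_character m)) (Complex (1 + \<eta>) (2 * u))) - Re (primeser (\<lambda>_. 1) (Complex (1 + \<eta>) (2 * u)))\<bar> \<le> \<delta> / 2 * ln T"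
            by (rule pd) (use m0 m ef in auto)
          ultimately have "Re (primeser (nat_char (principal_character m)) (Complex (1 + \<eta>) (2 * u))) \<le> \<delta> * ln T"
            by linarith
          thus ?thesis by (intro mainc) (simp add: fun_cong[OF sq])
        next
          case False
          have rc: "real_char \<psi>" by (rule real_char_if_square_principal[OF ch(1) sq])
          have "(T powr A) powr (- (\<delta> / (8 * A))) \<le> real m powr (- (\<delta> / (8 * A)))"
            using m m0 A d by (intro powr_mono2') auto
          hence "c * T powr (- (\<delta> / 8)) \<le> c * real m powr (- (\<delta> / (8 * A)))"
            using A c by (simp add: powr_powr)
          also have "\<dots> \<le> Re (Lfun ?f 1)" by (rule c(2)[OF ch(1) rc ch(2)])
          also have "\<dots> \<le> norm (Lfun ?f 1)" by (rule complex_Re_le_cmod)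
          finally have l1: "c * T powr (- (\<delta> / 8)) \<le> norm (Lfun ?f 1)" .
          have n: "norm (1 - ?s) \<le> 2 * T powr (- (\<delta> / 4))"
            using cmod_le[of "1 - ?s"] ef False by simp
          have "norm (Lfun ?f 1 - Lfun ?f ?s) \<le> (qlog A T)\<^sup>2 * norm (1 - ?s) + 2 / T"
            by (rule Lfun_lipschitz[OF A ee(5) ps m fb]) (use ef u ee in auto)
          also have "\<dots> \<le> (qlog A T)\<^sup>2 * (2 * T powr (- (\<delta> / 4))) + 2 * T powr (- (\<delta> / 4))"
            using n ef by (intro add_mono mult_left_mono) auto
          finally have "norm (Lfun ?f ?s) \<ge> norm (Lfun ?f 1) - (2 * (qlog A T)\<^sup>2 + 2) * T powr (- (\<delta> / 4))"
            using norm_triangle_ineq2[of "Lfun ?f 1" "Lfun ?f ?s"] by (simp add: algebra_simps)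
          hence "T powr (- \<delta>) \<le> norm (Lfun ?f ?s)" using l1 ee(3) by (simp add: qlog_def)
          also have "\<dots> \<le> exp (Re (primeser ?f ?s) + 5)"
            using dirser_euler_bounds(2)[OF completely_mult_char[OF ch(1)], of ?s] ef by (simp add: LD)
          finally have "exp (- \<delta> * ln T) \<le> exp (Re (primeser ?f ?s) + 5)" using ee(5) by (simp add: powr_def)
          hence "- \<delta> * ln T \<le> Re (primeser ?f ?s) + 5" by simp
          thus ?thesis using ee(4) by linarith
        qed
      qed
    qed
  qed
qed

lemma primeser_twist:
  "primeser (\<lambda>n. f n * of_nat n powr (- (\<i> * of_real u))) (of_real x) = primeser f (Complex x u)"
proof -
  have "- Complex x u = - (\<i> * of_real u) + (- of_real x)" by (simp add: complex_eq_iff)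
  thus ?thesis unfolding dirser_def on_primes_def by (simp only: powr_add) (intro infsum_cong, simp)
qed

lemma char_prime_sum_compare:
  assumes ch: "dirichlet_character m \<psi>" and y: "ln y \<ge> 2" "y > 1"
  shows "\<bar>Re (\<Sum>p\<in>primes_le y. \<psi> (int p) * of_nat p powr (- (\<i> * of_real u)) / of_nat p)
            - Re (primeser (nat_char \<psi>) (Complex (1 + 1 / ln y) u))\<bar> \<le> 52"
proof -
  let ?f = "\<lambda>n. \<psi> (int n) * of_nat n powr (- (\<i> * of_real u))"
  have "norm (?f n) \<le> 1" for n
  proof -
    have "norm (of_nat n powr (- (\<i> * of_real u)) :: complex) \<le> 1"
      using norm_nat_powr[of n "\<i> * of_real u"] by simp
    thus ?thesis unfolding norm_mult using char_norm_le[OF ch, of "int n"] by (intro mult_le_one) auto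
  qed
  from prime_sum_compare[of ?f, OF this y]
  have "norm ((\<Sum>p\<in>primes_le y. ?f p / of_nat p) - primeser (nat_char \<psi>) (Complex (1 + 1 / ln y) u)) \<le> 52"
    by (simp only: primeser_twist)
  from order_trans[OF abs_Re_le_cmod this] show ?thesis by simp
qed

theorem char_sum_lower:
  assumes A: "A > 0" and e: "\<epsilon> > (0::real)"
  shows "\<forall>\<^sub>F y in at_top. \<forall>m \<psi> u. dirichlet_character m \<psi> \<and> real m \<le> ln y powr A \<and> \<bar>u\<bar> \<le> ln y ^ 3
     \<longrightarrow> Re (\<Sum>p\<in>primes_le y. \<psi> (int p) * of_nat p powr (- (\<i> * of_real u)) / of_nat p) \<ge> - \<epsilon> * ln (ln y)"
proof -
  \<comment> \<open>The losses are 6 \<delta> from the lower bounds, \<delta> from primes dividing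
    the modulus and \<delta> from the constant 52.\<close>
  define \<delta> where "\<delta> = min (\<epsilon> / 10) (1 / 10)"
  have d: "0 < \<delta>" "\<delta> \<le> 1/10" "10 * \<delta> \<le> \<epsilon>" using e by (auto simp: \<delta>_def)
  have "\<forall>\<^sub>F T in at_top. 52 \<le> \<delta> * ln (T::real)" using d by real_asymp
  moreover have "\<forall>\<^sub>F T in at_top. (T::real) \<ge> 8" by (rule eventually_ge_at_top)
  ultimately have "\<forall>\<^sub>F T in at_top. T \<ge> 8 \<and> 52 \<le> \<delta> * ln T \<and> (\<forall>m \<psi> u. dirichlet_character m \<psi> \<and> real m \<le> T powr A
           \<and> \<bar>u\<bar> \<le> T ^ 3 \<longrightarrow> Re (primeser (nat_char \<psi>) (Complex (1 + 1 / T) u)) \<ge> - 7 * \<delta> * ln T)"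
    using lower_nonprincipal[OF A d(1,2)] lower_zeta[OF d(1,2)] principal_diff[OF A d(1)]
  proof eventually_elim
    case (elim T)
    have "Re (primeser (nat_char \<psi>) (Complex (1 + 1 / T) u)) \<ge> - 7 * \<delta> * ln T"
      if ch: "dirichlet_character m \<psi>" and m: "real m \<le> T powr A" and u: "\<bar>u\<bar> \<le> T ^ 3" for m \<psi> u
    proof (cases "\<psi> = principal_character m")
      case True
      have "\<bar>Re (primeser (nat_char (principal_character m)) (Complex (1 + 1 / T) u)) - Re (primeser (\<lambda>_. 1) (Complex (1 + 1 / T) u))\<bar> \<le> \<delta> * ln T"
        by (rule elim(5)[rule_format]) (use m elim char_mod_pos[OF ch] in auto)
      thus ?thesis unfolding True using elim(4)[rule_format, OF u] by linarith
    next
      case False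
      have "Re (primeser (nat_char \<psi>) (Complex (1 + 1 / T) u)) \<ge> - 6 * \<delta> * ln T"
        by (rule elim(3)[rule_format]) (use ch False m u in auto)
      thus ?thesis using elim(1) by linarith
    qed
    thus ?case using elim(1,2) by blast
  qed
  from eventually_compose_filterlim[OF this ln_at_top] eventually_gt_at_top[of 1]
  show ?thesis
  proof eventually_elim
    case (elim y)
    show ?case
    proof (intro allI impI, elim conjE)
      fix m :: nat and \<psi> :: "int \<Rightarrow> complex" and u :: real
      assume ch: "dirichlet_character m \<psi>" and m: "real m \<le> ln y powr A" and u: "\<bar>u\<bar> \<le> ln y ^ 3"
      have "Re (primeser (nat_char \<psi>) (Complex (1 + 1 / ln y) u)) \<ge> - 7 * \<delta> * ln (ln y)"
        using elim(1) ch m u by blast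
      moreover have "\<bar>Re (\<Sum>p\<in>primes_le y. \<psi> (int p) * of_nat p powr (- (\<i> * of_real u)) / of_nat p)
            - Re (primeser (nat_char \<psi>) (Complex (1 + 1 / ln y) u))\<bar> \<le> 52"
        by (rule char_prime_sum_compare[OF ch]) (use elim in auto)
      moreover have "10 * \<delta> * ln (ln y) \<le> \<epsilon> * ln (ln y)" using elim d by (intro mult_right_mono) auto
      ultimately show "Re (\<Sum>p\<in>primes_le y. \<psi> (int p) * of_nat p powr (- (\<i> * of_real u)) / of_nat p) \<ge> - \<epsilon> * ln (ln y)"
        using elim(1) by linarith
    qed
  qed
qed

theorem char_sum_upper:
  assumes A: "A > 0" and e: "\<epsilon> > (0::real)"
  shows "\<forall>\<^sub>F y in at_top. \<forall>m \<psi> u. dirichlet_character m \<psi> \<and> \<psi> \<noteq> principal_character m \<and> real m \<le> ln y powr A \<and> \<bar>u\<bar> \<le> ln y ^ 3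
     \<longrightarrow> Re (\<Sum>p\<in>primes_le y. \<psi> (int p) * of_nat p powr (- (\<i> * of_real u)) / of_nat p) \<le> \<epsilon> * ln (ln y)"
proof -
  have e2: "\<epsilon> / 2 > 0" using e by simp
  have "\<forall>\<^sub>F T in at_top. 52 \<le> \<epsilon> / 2 * ln (T::real)" using e by real_asymp
  moreover have "\<forall>\<^sub>F T in at_top. (T::real) \<ge> 8" by (rule eventually_ge_at_top)
  ultimately have "\<forall>\<^sub>F T in at_top. T \<ge> 8 \<and> 52 \<le> \<epsilon> / 2 * ln T \<and> (\<forall>m \<psi> s. dirichlet_character m \<psi> \<and> \<psi> \<noteq> principal_character m \<and> real m \<le> T powr A
           \<and> 1 < Re s \<and> Re s \<le> 2 \<and> \<bar>Im s\<bar> \<le> 2 * T ^ 3 \<longrightarrow> Re (primeser (nat_char \<psi>) s) \<le> \<epsilon> / 2 * ln T)"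
    using upper_nonprincipal[OF A e2] by eventually_elim blast
  from eventually_compose_filterlim[OF this ln_at_top] eventually_gt_at_top[of 1]
  show ?thesis
  proof eventually_elim
    case (elim y)
    show ?case
    proof (intro allI impI, elim conjE)
      fix m :: nat and \<psi> :: "int \<Rightarrow> complex" and u :: real
      assume ch: "dirichlet_character m \<psi>" "\<psi> \<noteq> principal_character m" and m: "real m \<le> ln y powr A" and u: "\<bar>u\<bar> \<le> ln y ^ 3"
      have y8: "ln y \<ge> 8" using elim by blast
      have "0 < 1 / ln y" "1 / ln y \<le> 1" "\<bar>u\<bar> \<le> 2 * ln y ^ 3" using y8 u by (auto intro: order_trans[OF u])
      hence "Re (primeser (nat_char \<psi>) (Complex (1 + 1 / ln y) u)) \<le> \<epsilon> / 2 * ln (ln y)"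
        using elim(1) ch m by auto
      moreover have "\<bar>Re (\<Sum>p\<in>primes_le y. \<psi> (int p) * of_nat p powr (- (\<i> * of_real u)) / of_nat p)
            - Re (primeser (nat_char \<psi>) (Complex (1 + 1 / ln y) u))\<bar> \<le> 52"
        by (rule char_prime_sum_compare[OF ch(1)]) (use elim in auto)
      ultimately show "Re (\<Sum>p\<in>primes_le y. \<psi> (int p) * of_nat p powr (- (\<i> * of_real u)) / of_nat p) \<le> \<epsilon> * ln (ln y)"
        using elim(1) by linarith
    qed
  qed
qed


section \<open>A trigonometric majorant\<close>

lemma integral_cos_cos:
  assumes "a + b \<noteq> 0" "a - b \<noteq> (0::real)"
  shows "((\<lambda>x. cos (a * x) * cos (b * x)) has_integral
           (sin ((a + b) * pi) / (2 * (a + b)) + sin ((a - b) * pi) / (2 * (a - b)))) {0..pi}"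
proof -
  have "((\<lambda>x. cos (a * x) * cos (b * x)) has_integral
           ((\<lambda>x. sin ((a + b) * x) / (2 * (a + b)) + sin ((a - b) * x) / (2 * (a - b))) pi
            - (\<lambda>x. sin ((a + b) * x) / (2 * (a + b)) + sin ((a - b) * x) / (2 * (a - b))) 0)) {0..pi}"
  proof (rule fundamental_theorem_of_calculus)
    fix x :: real assume "x \<in> {0..pi}"
    have "((\<lambda>x. sin ((a + b) * x) / (2 * (a + b)) + sin ((a - b) * x) / (2 * (a - b))) has_real_derivative
            (cos ((a + b) * x) * (a + b) / (2 * (a + b)) + cos ((a - b) * x) * (a - b) / (2 * (a - b)))) (at x within {0..pi})"
      using assms by (auto intro!: derivative_eq_intros)
    also have "cos ((a + b) * x) * (a + b) / (2 * (a + b)) + cos ((a - b) * x) * (a - b) / (2 * (a - b)) = cos (a * x) * cos (b * x)"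
    proof -
      have "w * c / (2 * c) = w / 2" if "c \<noteq> 0" for w c :: real using that by simp
      note aux = this[OF assms(1)] this[OF assms(2)]
      have e: "(a + b) * x = a * x + b * x" "(a - b) * x = a * x - b * x" by (simp_all add: algebra_simps)
      show ?thesis unfolding aux unfolding e cos_add cos_diff by (simp add: field_simps)
    qed
    finally show "((\<lambda>x. sin ((a + b) * x) / (2 * (a + b)) + sin ((a - b) * x) / (2 * (a - b))) has_vector_derivative cos (a * x) * cos (b * x)) (at x within {0..pi})"
      by (simp add: has_real_derivative_iff_has_vector_derivative)
  qed simp
  thus ?thesis by simp
qed

text \<open>The squared norm of cos (n x) in L^2 on [0, pi].\<close>

definition cnorm :: "nat \<Rightarrow> real" where "cnorm n = (if n = 0 then pi else pi / 2)"

lemma integral_cos_nat_nat: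
  "((\<lambda>x. cos (real l * x) * cos (real n * x)) has_integral (if l = n then cnorm n else 0)) {0..pi}"
proof (cases "l = n")
  case False
  have "sin ((real l + real n) * pi) = 0" "sin ((real l - real n) * pi) = 0"
    using sin_integer_2pi sin_times_pi_eq_0[of "real l + real n"] sin_times_pi_eq_0[of "real l - real n"] by auto
  thus ?thesis using integral_cos_cos[of "real l" "real n"] False by simp
next
  case True
  show ?thesis
  proof (cases "n = 0")
    case True
    thus ?thesis using \<open>l = n\<close> has_integral_const_real[of "1::real" 0 pi] by (simp add: cnorm_def)
  next
    case n: False
    have "((\<lambda>x. cos (real n * x) * cos (real n * x)) has_integral
            ((\<lambda>x. x / 2 + sin (2 * real n * x) / (4 * real n)) pi - (\<lambda>x. x / 2 + sin (2 * real n * x) / (4 * real n)) 0)) {0..pi}"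
    proof (rule fundamental_theorem_of_calculus)
      fix x :: real assume "x \<in> {0..pi}"
      have "((\<lambda>x. x / 2 + sin (2 * real n * x) / (4 * real n)) has_real_derivative
              (1 / 2 + cos (2 * (real n * x)) * (2 * real n) / (4 * real n))) (at x within {0..pi})"
        using n by (auto intro!: derivative_eq_intros simp: mult.assoc)
      also have "1 / 2 + cos (2 * (real n * x)) * (2 * real n) / (4 * real n) = cos (real n * x) * cos (real n * x)"
        using n by (simp add: cos_double_cos power2_eq_square diff_divide_distrib)
      finally show "((\<lambda>x. x / 2 + sin (2 * real n * x) / (4 * real n)) has_vector_derivative cos (real n * x) * cos (real n * x)) (at x within {0..pi})"
        by (simp add: has_real_derivative_iff_has_vector_derivative)
    qed simp
    moreover have "sin (2 * real n * pi) = 0" using sin_npi[of "2 * n"] by simp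
    ultimately show ?thesis using True n by (simp add: cnorm_def)
  qed
qed

text \<open>Orthogonality to every cos (n x) gives orthogonality to every power of cos x. By
  Stone-Weierstrass, applied to h (arccos c), \<open>h\<close> is a uniform limit of polynomials in
  cos x, so the integral of h^2 vanishes. This identifies the sum of a uniformly convergent cosine
  series without a pointwise convergence theorem.\<close>

lemma continuous_orthogonal_zero:
  fixes h :: "real \<Rightarrow> real"
  assumes cont: "continuous_on {0..pi} h"
    and orth: "\<And>n::nat. ((\<lambda>x. h x * cos (real n * x)) has_integral 0) {0..pi}"
    and x: "x \<in> {0..pi}"
  shows "h x = 0"
proof -
  \<comment> \<open>The extra factor cos (k x) makes the induction work: the product of cos x and
    cos (k x) is half the sum of the cosines with k + 1 and k - 1.\<close>
  have o1: "((\<lambda>x. h x * (cos x ^ i * cos (real k * x))) has_integral 0) {0..pi}" for i k :: nat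
  proof (induction i arbitrary: k)
    case 0
    show ?case using orth[of k] by simp
  next
    case (Suc i)
    show ?case
    proof (cases k)
      case 0
      thus ?thesis using Suc[of 1] by (simp add: mult_ac)
    next
      case (Suc k')
      have "((\<lambda>x. (1/2) * (h x * (cos x ^ i * cos (real (Suc k) * x)) + h x * (cos x ^ i * cos (real k' * x)))) has_integral (1/2) * (0 + 0)) {0..pi}"
        by (rule has_integral_mult_right[OF has_integral_add[OF Suc.IH Suc.IH]])
      moreover have "(1/2) * (h x * (cos x ^ i * cos (real (Suc k) * x)) + h x * (cos x ^ i * cos (real k' * x)))
                       = h x * (cos x ^ Suc i * cos (real k * x))" for x
      proof -
        have e: "real (Suc k) * x = real k * x + x" "real k' * x = real k * x - x"
          unfolding Suc by (simp_all add: algebra_simps)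
        show ?thesis unfolding e cos_add cos_diff by (simp add: algebra_simps)
      qed
      ultimately show ?thesis by simp
    qed
  qed
  have ch: "continuous_on {-1..1} (\<lambda>c. h (arccos c))"
    by (intro continuous_on_compose2[OF cont] continuous_on_arccos') (auto simp: arccos_lbound arccos_ubound)
  obtain C where C: "\<And>x. x \<in> {0..pi} \<Longrightarrow> \<bar>h x\<bar> \<le> C"
  proof -
    have "bounded (h ` {0..pi})" by (rule compact_imp_bounded[OF compact_continuous_image[OF cont compact_Icc]])
    then obtain a where "\<forall>y\<in>h ` {0..pi}. norm y \<le> a" unfolding bounded_iff ..
    thus ?thesis by (intro that[of a]) auto
  qed
  have C0: "C \<ge> 0" using C[of 0] by simp
  have ih: "(\<lambda>x. h x * h x) integrable_on {0..pi}" by (intro integrable_continuous_real continuous_intros cont)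
  have small: "integral {0..pi} (\<lambda>x. h x * h x) \<le> e * C * pi" if e: "e > 0" for e
  proof -
    obtain p where p: "real_polynomial_function p" "\<And>c. c \<in> {-1..1} \<Longrightarrow> \<bar>h (arccos c) - p c\<bar> < e"
      using Stone_Weierstrass_real_polynomial_function[OF compact_Icc ch e] by blast
    obtain a d where pd: "p = (\<lambda>x. \<Sum>i\<le>(d::nat). a i * x ^ i)" using p(1) real_polynomial_function_iff_sum by blast
    have "((\<lambda>x. \<Sum>i\<le>d. a i * (h x * (cos x ^ i * cos (real 0 * x)))) has_integral (\<Sum>i\<le>d. a i * 0)) {0..pi}"
      by (rule has_integral_sum, simp, rule has_integral_mult_right, rule o1)
    hence ip: "((\<lambda>x. h x * p (cos x)) has_integral 0) {0..pi}"
      by (simp add: pd sum_distrib_left mult_ac)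
    have "((\<lambda>x. h x * h x - h x * p (cos x)) has_integral (integral {0..pi} (\<lambda>x. h x * h x) - 0)) {0..pi}"
      by (rule has_integral_diff[OF integrable_integral[OF ih] ip])
    hence "integral {0..pi} (\<lambda>x. h x * h x) - 0 \<le> e * C * (pi - 0)"
    proof (rule has_integral_le[where g = "\<lambda>_. e * C"])
      show "((\<lambda>_. e * C) has_integral (e * C * (pi - 0))) {0..pi}"
        using has_integral_const_real[of "e * C" 0 pi] by (simp add: mult.commute)
      fix x :: real assume x: "x \<in> {0..pi}"
      have "\<bar>h (arccos (cos x)) - p (cos x)\<bar> < e" by (rule p(2)) simp
      hence "\<bar>h x - p (cos x)\<bar> < e" using x by (simp add: arccos_cos)
      hence "\<bar>h x\<bar> * \<bar>h x - p (cos x)\<bar> \<le> C * e" using C[OF x] C0 by (intro mult_mono) auto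
      hence "\<bar>h x * (h x - p (cos x))\<bar> \<le> C * e" by (simp add: abs_mult)
      thus "h x * h x - h x * p (cos x) \<le> e * C" by (simp add: right_diff_distrib mult.commute)
    qed
    thus ?thesis by simp
  qed
  have "integral {0..pi} (\<lambda>x. h x * h x) \<le> 0"
  proof (rule field_le_epsilon)
    fix e :: real assume e: "e > 0"
    have "integral {0..pi} (\<lambda>x. h x * h x) \<le> e / (C * pi + 1) * C * pi"
      using C0 e by (intro small divide_pos_pos add_nonneg_pos) auto
    also have "\<dots> = e * (C * pi / (C * pi + 1))" by simp
    also have "\<dots> \<le> e * 1" using C0 e by (intro mult_left_mono) (auto simp: divide_le_eq add_nonneg_pos)
    finally show "integral {0..pi} (\<lambda>x. h x * h x) \<le> 0 + e" by simp
  qed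
  moreover have "integral {0..pi} (\<lambda>x. h x * h x) \<ge> 0" by (intro integral_nonneg ih) auto
  ultimately have i0: "integral {0..pi} (\<lambda>x. h x * h x) = 0" by (rule antisym)
  have ch2: "continuous_on {0..pi} (\<lambda>x. h x * h x)" by (rule continuous_on_mult[OF cont cont])
  have "\<forall>x\<in>{0..pi}. h x * h x = 0"
    using iffD1[OF integral_eq_0_iff[OF ch2 pi_gt_zero] i0] by simp
  thus ?thesis using x by simp
qed

text \<open>The Fourier cosine coefficients of cos (\<alpha> x) on [-pi, pi]. At \<alpha> = 1 / g
  the constant one is g / pi * sin (pi / g), that is, 1 - delta g.\<close>

definition cos_coeff :: "real \<Rightarrow> nat \<Rightarrow> real" where
  "cos_coeff \<alpha> n = (if n = 0 then 1 else 2) * (-1) ^ n * (\<alpha> * sin (\<alpha> * pi)) / (pi * (\<alpha>\<^sup>2 - (real n)\<^sup>2))"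

context
  fixes \<alpha> :: real
  assumes al: "0 < \<alpha>" "\<alpha> \<le> 1/2"
begin

lemma integral_cos_cos_coeff:
  "((\<lambda>x. cos (\<alpha> * x) * cos (real n * x)) has_integral (cos_coeff \<alpha> n * cnorm n)) {0..pi}"
proof -
  have nz: "\<alpha> + real n \<noteq> 0" "\<alpha> - real n \<noteq> 0" using al by (cases n; auto)+
  have s: "sin ((\<alpha> + real n) * pi) = (-1) ^ n * sin (\<alpha> * pi)" "sin ((\<alpha> - real n) * pi) = (-1) ^ n * sin (\<alpha> * pi)"
    by (simp_all add: distrib_right left_diff_distrib sin_add sin_diff cos_npi sin_npi)
  have "sin ((\<alpha> + real n) * pi) / (2 * (\<alpha> + real n)) + sin ((\<alpha> - real n) * pi) / (2 * (\<alpha> - real n))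
          = (-1) ^ n * sin (\<alpha> * pi) * (1 / (2 * (\<alpha> + real n)) + 1 / (2 * (\<alpha> - real n)))"
    unfolding s by (simp add: distrib_left)
  also have "1 / (2 * (\<alpha> + real n)) + 1 / (2 * (\<alpha> - real n)) = \<alpha> / ((\<alpha> + real n) * (\<alpha> - real n))"
  proof -
    have "1 / (2 * P) + 1 / (2 * Q) = ((P + Q) / 2) / (P * Q)" if "P \<noteq> 0" "Q \<noteq> 0" for P Q :: real
      using that by (simp add: field_simps)
    from this[OF nz] show ?thesis by simp
  qed
  also have "(\<alpha> + real n) * (\<alpha> - real n) = \<alpha>\<^sup>2 - (real n)\<^sup>2" by (simp add: power2_eq_square algebra_simps)
  also have "(-1) ^ n * sin (\<alpha> * pi) * (\<alpha> / (\<alpha>\<^sup>2 - (real n)\<^sup>2)) = cos_coeff \<alpha> n * cnorm n"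
    by (simp add: cos_coeff_def cnorm_def)
  finally show ?thesis using integral_cos_cos[OF nz] by simp
qed

lemma cos_coeff_denom: "n > 0 \<Longrightarrow> (real n)\<^sup>2 - \<alpha>\<^sup>2 \<ge> (real n)\<^sup>2 / 2"
proof -
  assume "n > 0"
  hence "(real n)\<^sup>2 \<ge> 1" by simp
  moreover have "\<alpha>\<^sup>2 \<le> (1/2)\<^sup>2" using al by (intro power_mono) auto
  ultimately show ?thesis by (simp add: power2_eq_square)
qed

lemma cos_coeff_sin: "sin (\<alpha> * pi) \<ge> 0" using al by (intro sin_ge_zero) (auto simp: mult_le_cancel_right2)

text \<open>For n > 0 and \<alpha> <= 1/2 the denominator is negative while \<alpha> sin (\<alpha>
  pi) is not, so the sign is opposite to that of (-1)^n.\<close>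

lemma cos_coeff_odd: assumes "odd n" shows "cos_coeff \<alpha> n \<ge> 0"
proof -
  have n: "n > 0" using assms by (rule odd_pos)
  have "(real n)\<^sup>2 - \<alpha>\<^sup>2 \<ge> 0" using cos_coeff_denom[OF n] by (rule order_trans[rotated]) simp
  hence "pi * (\<alpha>\<^sup>2 - (real n)\<^sup>2) \<le> 0" by (simp add: mult_nonneg_nonpos)
  moreover have "2 * (-1) ^ n * (\<alpha> * sin (\<alpha> * pi)) \<le> 0" using assms al cos_coeff_sin by simp
  ultimately show ?thesis using n unfolding cos_coeff_def by (simp only: divide_nonpos_nonpos if_False less_numeral_extra(3) gr_implies_not0)
qed

lemma cos_coeff_even: assumes "even n" "n > 0" shows "cos_coeff \<alpha> n \<le> 0"
proof -
  have "(real n)\<^sup>2 - \<alpha>\<^sup>2 \<ge> 0" using cos_coeff_denom[OF assms(2)] by (rule order_trans[rotated]) simp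
  hence "pi * (\<alpha>\<^sup>2 - (real n)\<^sup>2) \<le> 0" by (simp add: mult_nonneg_nonpos)
  thus ?thesis using assms al cos_coeff_sin by (simp add: cos_coeff_def divide_nonneg_nonpos)
qed

lemma cos_coeff_bound: assumes "n > 0" shows "\<bar>cos_coeff \<alpha> n\<bar> \<le> 1 / (real n)\<^sup>2"
proof -
  note d = cos_coeff_denom[OF assms]
  have n2: "(real n)\<^sup>2 > 0" using assms by simp
  have "\<bar>cos_coeff \<alpha> n\<bar> = 2 * (\<alpha> * \<bar>sin (\<alpha> * pi)\<bar>) / (pi * ((real n)\<^sup>2 - \<alpha>\<^sup>2))"
    using assms al d n2 by (simp add: cos_coeff_def abs_mult power_abs abs_minus_commute)
  also have "\<dots> \<le> 2 * (1/2 * 1) / (2 * ((real n)\<^sup>2 / 2))"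
    using al d n2 pi_ge_two by (intro frac_le mult_mono) auto
  finally show ?thesis by simp
qed

lemma cos_coeff_uniform:
  "uniform_limit UNIV (\<lambda>N x. \<Sum>n<N. cos_coeff \<alpha> n * cos (real n * x)) (\<lambda>x. \<Sum>n. cos_coeff \<alpha> n * cos (real n * x)) sequentially"
proof (rule Weierstrass_m_test_ev)
  show "\<forall>\<^sub>F n in sequentially. \<forall>x\<in>UNIV. norm (cos_coeff \<alpha> n * cos (real n * x)) \<le> 1 / (real n)\<^sup>2"
    using eventually_gt_at_top[of 0]
  proof eventually_elim
    case (elim n)
    have "\<bar>cos_coeff \<alpha> n\<bar> * \<bar>cos (real n * x)\<bar> \<le> 1 / (real n)\<^sup>2 * 1" for x
      by (intro mult_mono cos_coeff_bound elim) auto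
    thus ?case by (simp add: abs_mult)
  qed
  show "summable (\<lambda>n. 1 / (real n)\<^sup>2)" using inverse_power_summable[of 2, where 'a = real] by (simp add: inverse_eq_divide)
qed

text \<open>The series converges uniformly, hence is continuous and can be integrated termwise
  against cos (m x). Its difference from cos (\<alpha> x) is orthogonal to all cosines.\<close>

lemma cos_fourier:
  assumes "x \<in> {0..pi}"
  shows "cos (\<alpha> * x) = (\<Sum>n. cos_coeff \<alpha> n * cos (real n * x))"
proof -
  define S where "S = (\<lambda>x. \<Sum>n. cos_coeff \<alpha> n * cos (real n * x))"
  define h where "h = (\<lambda>x. cos (\<alpha> * x) - S x)"
  have uS: "uniform_limit {0..pi} (\<lambda>N x. \<Sum>n<N. cos_coeff \<alpha> n * cos (real n * x)) S sequentially"
    unfolding S_def by (rule uniform_limit_on_subset[OF cos_coeff_uniform]) simp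
  have contS: "continuous_on {0..pi} S"
    by (rule uniform_limit_theorem[OF _ uS]) (auto intro!: always_eventually continuous_intros)
  have conth: "continuous_on {0..pi} h" unfolding h_def by (intro continuous_intros contS)
  have "((\<lambda>x. h x * cos (real m * x)) has_integral 0) {0..pi}" for m
  proof -
    define F where "F = (\<lambda>N x. (cos (\<alpha> * x) - (\<Sum>n<N. cos_coeff \<alpha> n * cos (real n * x))) * cos (real m * x))"
    have bh: "bounded (h ` {0..pi})" by (rule compact_imp_bounded[OF compact_continuous_image[OF conth compact_Icc]])
    have bc: "bounded ((\<lambda>x. cos (real m * x)) ` {0..pi})"
      by (rule boundedI[of _ 1]) auto
    have "uniform_limit {0..pi} F (\<lambda>x. h x * cos (real m * x)) sequentially"
      unfolding F_def h_def
      by (rule uniform_lim_mult[OF uniform_limit_minus[OF uniform_limit_const uS] uniform_limit_const bh[unfolded h_def] bc])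
    moreover have "continuous_on {0..pi} (F N)" for N unfolding F_def by (intro continuous_intros)
    ultimately obtain I J where IJ: "\<And>N. (F N has_integral I N) {0..pi}"
      "((\<lambda>x. h x * cos (real m * x)) has_integral J) {0..pi}" "I \<longlonglongrightarrow> J"
      by (rule uniform_limit_integral) auto
    have I0: "I N = 0" if "N > m" for N
    proof -
      have "((\<lambda>x. cos (\<alpha> * x) * cos (real m * x) - (\<Sum>n<N. cos_coeff \<alpha> n * (cos (real n * x) * cos (real m * x)))) has_integral
              (cos_coeff \<alpha> m * cnorm m - (\<Sum>n<N. cos_coeff \<alpha> n * (if n = m then cnorm m else 0)))) {0..pi}"
      proof (rule has_integral_diff[OF integral_cos_cos_coeff has_integral_sum])
        show "((\<lambda>x. cos_coeff \<alpha> n * (cos (real n * x) * cos (real m * x))) has_integral cos_coeff \<alpha> n * (if n = m then cnorm m else 0)) {0..pi}" for n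
          by (rule has_integral_mult_right[OF integral_cos_nat_nat])
      qed simp
      also have "(\<Sum>n<N. cos_coeff \<alpha> n * (if n = m then cnorm m else 0)) = cos_coeff \<alpha> m * cnorm m"
        using that by (simp add: if_distrib[of "(*) _"] sum.delta cong: if_cong)
      also have "(\<lambda>x. cos (\<alpha> * x) * cos (real m * x) - (\<Sum>n<N. cos_coeff \<alpha> n * (cos (real n * x) * cos (real m * x)))) = F N"
        by (simp add: F_def fun_eq_iff left_diff_distrib sum_distrib_right mult.assoc)
      finally show ?thesis using has_integral_unique[OF IJ(1)[of N]] by simp
    qed
    have "\<forall>\<^sub>F N in sequentially. I N = 0" by (rule eventually_mono[OF eventually_gt_at_top[of m] I0])
    hence "I \<longlonglongrightarrow> 0" by (rule tendsto_eventually)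
    hence "J = 0" using IJ(3) LIMSEQ_unique by blast
    thus ?thesis using IJ(2) by simp
  qed
  from continuous_orthogonal_zero[OF conth this assms] show ?thesis by (simp add: h_def S_def)
qed

end

text \<open>With \<open>x = g * \<theta> - 2 * pi * k\<close> in \<open>{-pi..pi}\<close>, the point \<open>x / g\<close> is the
  representative of \<open>\<theta>\<close> modulo \<open>2 * pi / g\<close> closest to \<open>0\<close>.\<close>

lemma reduce_angle:
  fixes \<theta> :: real and g :: nat
  assumes g: "g > 0"
  obtains x where "\<bar>x\<bar> \<le> pi" "cos \<theta> \<le> cos (x / real g)" "\<And>l::nat. cos (real l * (real g * \<theta>)) = cos (real l * x)"
proof -
  have red: "\<exists>k::int. \<bar>t - 2 * pi * of_int k\<bar> \<le> pi" for t :: real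
  proof -
    define k where "k = round (t / (2 * pi))"
    have "\<bar>of_int k - t / (2 * pi)\<bar> \<le> 1/2" unfolding k_def by (rule of_int_round_abs_le)
    hence "\<bar>of_int k - t / (2 * pi)\<bar> * (2 * pi) \<le> 1/2 * (2 * pi)" by (intro mult_right_mono) auto
    also have "\<bar>of_int k - t / (2 * pi)\<bar> * (2 * pi) = \<bar>(of_int k - t / (2 * pi)) * (2 * pi)\<bar>" by (simp add: abs_mult)
    also have "(of_int k - t / (2 * pi)) * (2 * pi) = - (t - 2 * pi * of_int k)" by (simp add: field_simps)
    finally show ?thesis by (intro exI[of _ k]) simp
  qed
  have cos_shift: "cos (t - 2 * pi * of_int k) = cos t" for t :: real and k :: int
    using cos_int_2pin sin_int_2pin by (simp add: cos_diff)
  obtain k where k: "\<bar>real g * \<theta> - 2 * pi * of_int k\<bar> \<le> pi" using red by blast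
  obtain r where r: "\<bar>\<theta> - 2 * pi * of_int r\<bar> \<le> pi" using red by blast
  define x where "x = real g * \<theta> - 2 * pi * of_int k"
  define t where "t = \<theta> - 2 * pi * of_int r"
  \<comment> \<open>Otherwise x - g t would be an integer multiple of 2 pi of size below 2 pi, hence
    0, and then |x| = g |t|.\<close>
  have xg: "\<bar>x / real g\<bar> \<le> \<bar>t\<bar>"
  proof (rule ccontr)
    assume "\<not> ?thesis"
    hence lt: "real g * \<bar>t\<bar> < \<bar>x\<bar>" using g by (simp add: field_simps abs_mult)
    define j where "j = int g * r - k"
    have xj: "x - real g * t = 2 * pi * of_int j" by (simp add: x_def t_def j_def algebra_simps)
    have "\<bar>2 * pi * of_int j\<bar> \<le> \<bar>x\<bar> + real g * \<bar>t\<bar>" unfolding xj[symmetric] using abs_triangle_ineq4[of x "real g * t"] by (simp add: abs_mult)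
    also have "\<dots> < 2 * pi * 1" using lt k by (simp add: x_def)
    finally have "\<bar>of_int j :: real\<bar> < 1" by (simp add: abs_mult)
    hence "j = 0" by linarith
    hence "x = real g * t" using xj by simp
    thus False using lt by (simp add: abs_mult)
  qed
  have "cos \<theta> = cos \<bar>t\<bar>" unfolding t_def using cos_shift[of \<theta> r] by simp
  also have "\<dots> \<le> cos \<bar>x / real g\<bar>" using xg r by (intro cos_monotone_0_pi_le) (auto simp: t_def)
  finally have "cos \<theta> \<le> cos (x / real g)" by (simp only: cos_abs_real)
  moreover have "cos (real l * (real g * \<theta>)) = cos (real l * x)" for l :: nat
  proof -
    have "real l * x = real l * (real g * \<theta>) - 2 * pi * of_int (int l * k)" by (simp add: x_def algebra_simps)
    thus ?thesis using cos_shift by metis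
  qed
  ultimately show ?thesis using k by (intro that[of x]) (auto simp: x_def)
qed

text \<open>Uniform convergence permits truncation at an \<open>L\<close> depending only on g and
  \<eta>. For g = 1 the majorant is cos \<theta> + \<eta> itself. The last clause serves primes with
  chi(p) = 0: for g >= 3 the reduced angle x / g is at most pi / 3 in size, so its cosine is
  nonnegative.\<close>

lemma cos_majorant:
  assumes g: "odd g" and e: "\<eta> > (0::real)"
  shows "\<exists>(c :: nat \<Rightarrow> real) (L :: nat). (\<forall>l. odd l \<longrightarrow> c l \<ge> 0) \<and> (\<forall>l>0. even l \<longrightarrow> c l \<le> 0) \<and>
    (\<forall>\<theta>. cos \<theta> \<le> (1 - delta g) + (\<Sum>l=1..L. c l * cos (real l * (real g * \<theta>))) + \<eta>) \<and>
    (g \<noteq> 1 \<longrightarrow> (\<forall>\<theta>. 0 \<le> (1 - delta g) + (\<Sum>l=1..L. c l * cos (real l * (real g * \<theta>))) + \<eta>))"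
proof (cases "g = 1")
  case True
  show ?thesis
    by (rule exI[of _ "\<lambda>l. if l = 1 then 1 else 0"], rule exI[of _ 1]) (use e True in \<open>auto simp: delta_def\<close>)
next
  case False
  have g3: "g \<ge> 3" using g False by (cases g rule: nat.exhaust) (auto elim!: oddE)
  define \<alpha> where "\<alpha> = 1 / real g"
  have al: "0 < \<alpha>" "\<alpha> \<le> 1/2" using g3 by (auto simp: \<alpha>_def field_simps)
  have "\<forall>\<^sub>F N in sequentially. \<forall>x\<in>UNIV. dist (\<Sum>n<N. cos_coeff \<alpha> n * cos (real n * x)) (\<Sum>n. cos_coeff \<alpha> n * cos (real n * x)) < \<eta>"
    by (rule uniform_limitD[OF cos_coeff_uniform[OF al] e])
  from eventually_happens'[OF _ eventually_conj[OF this eventually_gt_at_top[of 0]]]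
  obtain N where N: "N > 0" "\<And>x. dist (\<Sum>n<N. cos_coeff \<alpha> n * cos (real n * x)) (\<Sum>n. cos_coeff \<alpha> n * cos (real n * x)) < \<eta>"
    by auto
  have f0: "cos_coeff \<alpha> 0 = 1 - delta g" using g3 by (simp add: cos_coeff_def \<alpha>_def delta_def power2_eq_square)
  have low: "cos (x / real g) \<le> (1 - delta g) + (\<Sum>l=1..N-1. cos_coeff \<alpha> l * cos (real l * x)) + \<eta>" if x: "\<bar>x\<bar> \<le> pi" for x
  proof -
    have "cos (\<alpha> * \<bar>x\<bar>) = (\<Sum>n. cos_coeff \<alpha> n * cos (real n * \<bar>x\<bar>))" by (rule cos_fourier[OF al]) (use x in auto)
    moreover have "cos (a * \<bar>x\<bar>) = cos (a * x)" for a by (cases "x \<ge> 0") auto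
    ultimately have "cos (\<alpha> * x) = (\<Sum>n. cos_coeff \<alpha> n * cos (real n * x))" by simp
    hence "cos (x / real g) \<le> (\<Sum>n<N. cos_coeff \<alpha> n * cos (real n * x)) + \<eta>"
      using N(2)[of x] by (simp add: \<alpha>_def dist_real_def)
    also have "{..<N} = insert 0 {1..N-1}" using N(1) by auto
    also have "(\<Sum>n\<in>insert 0 {1..N-1}. cos_coeff \<alpha> n * cos (real n * x)) = (1 - delta g) + (\<Sum>l=1..N-1. cos_coeff \<alpha> l * cos (real l * x))"
      by (subst sum.insert) (auto simp: f0)
    finally show ?thesis .
  qed
  show ?thesis
  proof (rule exI[of _ "cos_coeff \<alpha>"], rule exI[of _ "N - 1"], intro conjI allI impI)
    fix \<theta> :: real
    obtain x where x: "\<bar>x\<bar> \<le> pi" "cos \<theta> \<le> cos (x / real g)" "\<And>l::nat. cos (real l * (real g * \<theta>)) = cos (real l * x)"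
      using reduce_angle[of g \<theta>] g3 by auto
    show "cos \<theta> \<le> (1 - delta g) + (\<Sum>l=1..N-1. cos_coeff \<alpha> l * cos (real l * (real g * \<theta>))) + \<eta>"
      unfolding x(3) using x(2) low[OF x(1)] by linarith
    have "\<bar>x / real g\<bar> = \<bar>x\<bar> / real g" by (simp add: abs_divide)
    also have "\<dots> \<le> pi / 3" using x(1) g3 by (intro frac_le) auto
    also have "\<dots> \<le> pi / 2" by simp
    finally have "cos \<bar>x / real g\<bar> \<ge> 0" using abs_ge_zero[of "x / real g"] by (intro cos_ge_zero) linarith+
    hence "cos (x / real g) \<ge> 0" by (simp only: cos_abs_real)
    thus "0 \<le> (1 - delta g) + (\<Sum>l=1..N-1. cos_coeff \<alpha> l * cos (real l * (real g * \<theta>))) + \<eta>"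
      unfolding x(3) using low[OF x(1)] by linarith
  qed (use cos_coeff_odd[OF al] cos_coeff_even[OF al] in auto)
qed


section \<open>The pretentious distance\<close>

lemma delta_bounds: assumes "g > 0" shows "0 \<le> delta g" "delta g \<le> 1"
proof -
  have g: "real g \<ge> 1" using assms by simp
  have "sin (pi / real g) \<le> pi / real g" using g by (intro sin_x_le_x) auto
  hence "real g / pi * sin (pi / real g) \<le> real g / pi * (pi / real g)" by (intro mult_left_mono) auto
  thus "0 \<le> delta g" using g by (simp add: delta_def)
  have "pi / real g \<le> pi" using g by (simp add: divide_le_eq)
  hence "sin (pi / real g) \<ge> 0" by (intro sin_ge_zero) auto
  thus "delta g \<le> 1" by (simp add: delta_def)
qed

lemma primes_le_set: "{p. prime p \<and> real p \<le> y} = primes_le y" by (simp add: primes_le_def)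

lemma norm_twist_prime: "prime p \<Longrightarrow> norm (of_nat p powr (- (\<i> * of_real t)) :: complex) = 1"
  using norm_nat_powr[of p "\<i> * of_real t"] prime_gt_0_nat[of p] by simp

lemma powr_nat_power: "((of_nat p :: complex) powr (- (\<i> * of_real t))) ^ n = of_nat p powr (- (\<i> * of_real (real n * t)))"
  if "p > 0"
proof (induction n)
  case (Suc n)
  have e: "- (\<i> * of_real (real (Suc n) * t)) = - (\<i> * of_real t) + - (\<i> * of_real (real n * t))"
    by (simp add: algebra_simps)
  show ?case unfolding e powr_add power_Suc Suc ..
qed (use that in simp)

lemma Re_unit_power: assumes "norm v = 1" shows "Re (v ^ n) = cos (real n * Arg v)"
proof -
  have "v = cis (Arg v)" using assms rcis_cmod_Arg[of v] by (simp add: rcis_def)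
  hence "v ^ n = cis (Arg v) ^ n" by (rule arg_cong)
  also have "\<dots> = cis (real n * Arg v)" by (rule Complex.DeMoivre)
  finally show ?thesis by simp
qed

lemma pretentious_sum_nonneg:
  assumes "\<And>n. norm (h n) \<le> 1" shows "pretentious_sum h y t \<ge> 0"
  unfolding pretentious_sum_def
proof (rule sum_nonneg, clarify)
  fix p :: nat assume p: "prime p"
  have "norm (h p * of_nat p powr (- (\<i> * of_real t))) \<le> 1"
    using assms[of p] norm_twist_prime[OF p] by (simp add: norm_mult)
  hence "Re (h p * of_nat p powr (- (\<i> * of_real t))) \<le> 1" using complex_Re_le_cmod order_trans by blast
  thus "0 \<le> (1 - Re (h p * of_nat p powr (- (\<i> * of_real t)))) / real p" by simp
qed

context
  fixes g :: nat and \<eta> :: real and L :: nat and c :: "nat \<Rightarrow> real"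
  assumes maj: "\<And>\<theta>. cos \<theta> \<le> (1 - delta g) + (\<Sum>l=1..L. c l * cos (real l * (real g * \<theta>))) + \<eta>"
    and maj0: "\<And>\<theta>. g \<noteq> 1 \<Longrightarrow> 0 \<le> (1 - delta g) + (\<Sum>l=1..L. c l * cos (real l * (real g * \<theta>))) + \<eta>"
    and eta: "\<eta> > 0" and g: "g > 0"
begin

text \<open>Multiplying w by a g-th root of unity does not change w^(g l), so the majorant is
  evaluated at the argument of z w and no maximum over z has to be formed. The values w = 0 and z =
  0 come from primes dividing m and q.\<close>

lemma pointwise_majorant:
  assumes w: "w = 0 \<or> norm w = 1" and z: "z ^ g = 1 \<or> z = 0 \<and> g \<noteq> 1"
  shows "1 - Re (z * w) \<ge> delta g - (\<Sum>l=1..L. c l * Re (w ^ (g * l))) - \<eta>"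
proof (cases "w = 0")
  case True
  have "(\<Sum>l=1..L. c l * Re (w ^ (g * l))) = 0" using True g by (intro sum.neutral) auto
  thus ?thesis using True eta delta_bounds[OF g] by simp
next
  case False
  hence w1: "norm w = 1" using w by simp
  show ?thesis
  proof (cases "z = 0")
    case True
    have "Re (w ^ (g * l)) = cos (real l * (real g * Arg w))" for l
      using Re_unit_power[OF w1, of "g * l"] by (simp add: mult_ac)
    thus ?thesis using maj0[of "Arg w"] z True g by (cases "g = 1") auto
  next
    case False
    hence zg: "z ^ g = 1" using z by simp
    have "norm z ^ g = 1" using arg_cong[OF zg, of norm] by (simp add: norm_power)
    hence "norm z = 1" using g power_eq_imp_eq_base[of "norm z" g 1] by auto
    hence v1: "norm (z * w) = 1" using w1 by (simp add: norm_mult)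
    have "Re (w ^ (g * l)) = cos (real l * (real g * Arg (z * w)))" for l
    proof -
      have "w ^ (g * l) = (z * w) ^ (g * l)" by (simp add: power_mult_distrib power_mult zg)
      thus ?thesis using Re_unit_power[OF v1, of "g * l"] by (simp add: mult_ac)
    qed
    moreover have "Re (z * w) = cos (Arg (z * w))" using Re_unit_power[OF v1, of 1] by simp
    ultimately show ?thesis using maj[of "Arg (z * w)"] by simp
  qed
qed

lemma pretentious_sum_lower:
  assumes chi: "primitive_character q chi" "character_order q chi = g" and \<xi>: "dirichlet_character m \<xi>"
  shows "pretentious_sum (\<lambda>n. chi (int n) * cnj (\<xi> (int n))) y t
           \<ge> (delta g - \<eta>) * (\<Sum>p\<in>primes_le y. 1 / real p)
             - (\<Sum>l=1..L. c l * Re (\<Sum>p\<in>primes_le y. cnj (\<xi> (int p)) ^ (g * l) * of_nat p powr (- (\<i> * of_real (real (g * l) * t))) / of_nat p))"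
proof -
  have chd: "dirichlet_character q chi" using chi by (simp add: primitive_character_def)
  note ord = character_order_power[OF chd chi(2)]
  have z: "chi a ^ g = 1 \<or> chi a = 0 \<and> g \<noteq> 1" for a
  proof (cases "g = 1")
    case True
    hence "chi = principal_character q" using ord(1) by simp
    moreover from this have "q = 1" using primitive_principal chi(1) by metis
    ultimately show ?thesis by (simp add: principal_character_def)
  next
    case False
    have "chi a ^ g = principal_character q a" using fun_cong[OF ord(1), of a] by simp
    thus ?thesis using char_zero_iff[OF chd, of a] False by (auto simp: principal_character_def split: if_splits)
  qed
  define w where "w = (\<lambda>p::nat. cnj (\<xi> (int p)) * of_nat p powr (- (\<i> * of_real t)))"
  have pt: "(1 - Re (chi (int p) * cnj (\<xi> (int p)) * of_nat p powr (- (\<i> * of_real t)))) / real p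
              \<ge> (delta g - \<eta>) * (1 / real p) - (\<Sum>l=1..L. c l * Re (w p ^ (g * l) / of_nat p))"
    if p: "p \<in> primes_le y" for p
  proof -
    have pp: "prime p" using p by (simp add: primes_le_def)
    have "w p = 0 \<or> norm (w p) = 1"
      using char_norm_cases[OF \<xi>, of "int p"] norm_twist_prime[OF pp] by (auto simp: w_def norm_mult)
    from pointwise_majorant[OF this z[of "int p"]]
    have "1 - Re (chi (int p) * w p) \<ge> (delta g - \<eta>) - (\<Sum>l=1..L. c l * Re (w p ^ (g * l)))" by simp
    hence "(1 - Re (chi (int p) * w p)) / real p \<ge> ((delta g - \<eta>) - (\<Sum>l=1..L. c l * Re (w p ^ (g * l)))) / real p"
      by (rule divide_right_mono) simp
    also have "((delta g - \<eta>) - (\<Sum>l=1..L. c l * Re (w p ^ (g * l)))) / real p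
                 = (delta g - \<eta>) * (1 / real p) - (\<Sum>l=1..L. c l * Re (w p ^ (g * l) / of_nat p))"
      by (simp add: diff_divide_distrib sum_divide_distrib Re_divide_of_nat)
    finally show ?thesis by (simp add: w_def mult.assoc)
  qed
  have wl: "w p ^ (g * l) = cnj (\<xi> (int p)) ^ (g * l) * of_nat p powr (- (\<i> * of_real (real (g * l) * t)))"
    if "p \<in> primes_le y" for p l
    using that powr_nat_power[of p t "g * l"] by (simp only: w_def power_mult_distrib primes_le_def mem_Collect_eq prime_gt_0_nat)
  have "(\<Sum>p\<in>primes_le y. (delta g - \<eta>) * (1 / real p) - (\<Sum>l=1..L. c l * Re (w p ^ (g * l) / of_nat p)))
          \<le> pretentious_sum (\<lambda>n. chi (int n) * cnj (\<xi> (int n))) y t"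
    unfolding pretentious_sum_def primes_le_set by (rule sum_mono) (rule pt)
  also have "(\<Sum>p\<in>primes_le y. (delta g - \<eta>) * (1 / real p) - (\<Sum>l=1..L. c l * Re (w p ^ (g * l) / of_nat p)))
     = (delta g - \<eta>) * (\<Sum>p\<in>primes_le y. 1 / real p) - (\<Sum>l=1..L. c l * Re (\<Sum>p\<in>primes_le y. w p ^ (g * l) / of_nat p))"
    unfolding sum_subtractf sum_distrib_left Re_sum by (subst sum.swap) (rule refl)
  also have "(\<Sum>l=1..L. c l * Re (\<Sum>p\<in>primes_le y. w p ^ (g * l) / of_nat p))
     = (\<Sum>l=1..L. c l * Re (\<Sum>p\<in>primes_le y. cnj (\<xi> (int p)) ^ (g * l) * of_nat p powr (- (\<i> * of_real (real (g * l) * t))) / of_nat p))"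
    by (intro sum.cong refl arg_cong[where f = "\<lambda>x. _ * Re x"]) (simp add: wl)
  finally show ?thesis .
qed

end

text \<open>The quantifiers over q, chi, m, \<xi> and t stand inside the eventuality: the threshold
  for y depends only on g, A and \<epsilon>. Three equal shares \<eta> pay for the majorant, for the
  harmonics and for the error 58 in Mertens' estimate.\<close>

lemma pretentious_asymptotic:
  assumes g: "odd g" and A: "A > 0" and e: "\<epsilon> > (0::real)"
  shows "\<forall>\<^sub>F y in at_top. \<forall>q chi m \<xi> t. primitive_character q chi \<and> character_order q chi = g \<and>
           dirichlet_character m \<xi> \<and> odd_character \<xi> \<and> real m < ln y powr A \<and> \<bar>t\<bar> \<le> (ln y)\<^sup>2
           \<longrightarrow> pretentious_sum (\<lambda>n. chi (int n) * cnj (\<xi> (int n))) y t \<ge> (delta g - \<epsilon>) * ln (ln y)"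
proof -
  define \<eta> where "\<eta> = \<epsilon> / 3"
  have eta: "\<eta> > 0" using e by (simp add: \<eta>_def)
  have g0: "g > 0" using g by (rule odd_pos)
  obtain c :: "nat \<Rightarrow> real" and L :: nat where
    co: "\<forall>l. odd l \<longrightarrow> c l \<ge> 0" and ce: "\<forall>l>0. even l \<longrightarrow> c l \<le> 0" and
    maj: "\<forall>\<theta>. cos \<theta> \<le> (1 - delta g) + (\<Sum>l=1..L. c l * cos (real l * (real g * \<theta>))) + \<eta>" and
    maj0: "g \<noteq> 1 \<longrightarrow> (\<forall>\<theta>. 0 \<le> (1 - delta g) + (\<Sum>l=1..L. c l * cos (real l * (real g * \<theta>))) + \<eta>)"
    using cos_majorant[OF g eta] by (elim exE conjE)
  define C where "C = (\<Sum>l=1..L. \<bar>c l\<bar>)"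
  have C: "C \<ge> 0" by (simp add: C_def sum_nonneg)
  \<comment> \<open>Each harmonic may lose d * ln (ln y); the denominator C + 1 also covers the case
    that all coefficients vanish.\<close>
  define d where "d = \<eta> / (C + 1)"
  have d: "d > 0" "C * d \<le> \<eta>" using C eta by (auto simp: d_def field_simps)
  have "\<forall>\<^sub>F y in at_top. 58 * \<bar>delta g - \<eta>\<bar> \<le> \<eta> * ln (ln (y::real))" using eta by real_asymp
  \<comment> \<open>Guarantees g * l <= ln y, so the height g * l * t stays within (ln y)^3.\<close>
  moreover have "\<forall>\<^sub>F y in at_top. ln (y::real) \<ge> real (g * L) + 3" by real_asymp
  moreover have "\<forall>\<^sub>F y in at_top. (y::real) > 1" by (rule eventually_gt_at_top)
  ultimately show ?thesis using char_sum_lower[OF A d(1)] char_sum_upper[OF A d(1)]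
  proof eventually_elim
    case (elim y)
    note lo = elim(4)[rule_format] and up = elim(5)[rule_format]
    have ly: "ln y \<ge> 3" using elim(2) by (rule order_trans[rotated]) simp
    have lly: "ln (ln y) \<ge> 0" using ly by simp
    show ?case
    proof (intro allI impI, elim conjE)
      fix q :: nat and chi :: "int \<Rightarrow> complex" and m :: nat and \<xi> :: "int \<Rightarrow> complex" and t :: real
      assume chi: "primitive_character q chi" "character_order q chi = g" and \<xi>: "dirichlet_character m \<xi>" "odd_character \<xi>"
        and m: "real m < ln y powr A" and t: "\<bar>t\<bar> \<le> (ln y)\<^sup>2"
      define R where "R = (\<lambda>l. Re (\<Sum>p\<in>primes_le y. cnj (\<xi> (int p)) ^ (g * l) * of_nat p powr (- (\<i> * of_real (real (g * l) * t))) / of_nat p))"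
      have Rb: "c l * R l \<le> \<bar>c l\<bar> * (d * ln (ln y))" if l: "l \<in> {1..L}" for l
      proof -
        have gl: "g * l > 0" using g0 l by simp
        have ch: "dirichlet_character m (\<lambda>a. cnj (\<xi> a) ^ (g * l))"
          by (rule char_power_character[OF char_cnj_character[OF \<xi>(1)] gl])
        have u: "\<bar>real (g * l) * t\<bar> \<le> ln y ^ 3"
        proof -
          have "real (g * l) \<le> real (g * L)" using l by (intro of_nat_mono mult_le_mono2) auto
          also have "\<dots> \<le> ln y" using elim(2) by linarith
          finally have "real (g * l) * \<bar>t\<bar> \<le> ln y * (ln y)\<^sup>2" using t ly by (intro mult_mono) auto
          thus ?thesis by (simp add: abs_mult power2_eq_square power3_eq_cube)
        qed
        show ?thesis
        proof (cases "even l")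
          case True
          have "R l \<ge> - d * ln (ln y)" unfolding R_def
            using lo[of m "\<lambda>a. cnj (\<xi> a) ^ (g * l)" "real (g * l) * t"] ch m u by auto
          hence "c l * R l \<le> c l * (- d * ln (ln y))" using ce True l by (intro mult_left_mono_neg) auto
          also have "\<dots> = \<bar>c l\<bar> * (d * ln (ln y))" using ce True l by (simp add: abs_of_nonpos)
          finally show ?thesis .
        next
          case False
          have "cnj (\<xi> (-1)) ^ (g * l) = -1" using \<xi>(2) False g by (simp add: odd_character_def)
          moreover have "principal_character m (-1) = 1" by (simp add: principal_character_def)
          ultimately have np: "(\<lambda>a. cnj (\<xi> a) ^ (g * l)) \<noteq> principal_character m"
            by (metis one_neq_neg_one)
          have "R l \<le> d * ln (ln y)" unfolding R_def
            using up[of m "\<lambda>a. cnj (\<xi> a) ^ (g * l)" "real (g * l) * t"] ch np m u by auto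
          thus ?thesis using co False by (simp add: mult_left_mono)
        qed
      qed
      have "(\<Sum>l=1..L. c l * R l) \<le> (\<Sum>l=1..L. \<bar>c l\<bar> * (d * ln (ln y)))" by (rule sum_mono) (rule Rb)
      also have "\<dots> = C * d * ln (ln y)" by (simp add: C_def sum_distrib_right mult.assoc)
      also have "\<dots> \<le> \<eta> * ln (ln y)" using d lly by (intro mult_right_mono) auto
      finally have RR: "(\<Sum>l=1..L. c l * R l) \<le> \<eta> * ln (ln y)" .
      define S where "S = (\<Sum>p\<in>primes_le y. 1 / real p)"
      have "\<bar>S - ln (ln y)\<bar> \<le> 58" unfolding S_def by (rule sum_inverse_primes) (use ly elim(3) in auto)
      hence "\<bar>(delta g - \<eta>) * (S - ln (ln y))\<bar> \<le> \<bar>delta g - \<eta>\<bar> * 58" unfolding abs_mult by (intro mult_left_mono) auto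
      hence "(delta g - \<eta>) * S \<ge> (delta g - \<eta>) * ln (ln y) - \<eta> * ln (ln y)"
        using elim(1) by (simp add: right_diff_distrib)
      moreover have "pretentious_sum (\<lambda>n. chi (int n) * cnj (\<xi> (int n))) y t \<ge> (delta g - \<eta>) * S - (\<Sum>l=1..L. c l * R l)"
        unfolding S_def R_def by (rule pretentious_sum_lower[OF maj[rule_format] maj0[rule_format] eta g0 chi \<xi>(1)])
      moreover have "(delta g - \<epsilon>) * ln (ln y) = (delta g - \<eta>) * ln (ln y) - \<eta> * ln (ln y) - \<eta> * ln (ln y)"
        by (simp add: \<eta>_def algebra_simps)
      ultimately show "pretentious_sum (\<lambda>n. chi (int n) * cnj (\<xi> (int n))) y t \<ge> (delta g - \<epsilon>) * ln (ln y)"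
        using RR by linarith
    qed
  qed
qed

text \<open>The error at y is an admissible value within 1 / y of the infimum of all admissible
  ones, since the infimum need not be attained. \<open>ev\<close> forces these infima to 0, and
  \<open>ex\<close> makes the choice possible at every y >= 3.\<close>

lemma error_function_exists:
  fixes P :: "real \<Rightarrow> real \<Rightarrow> bool"
  assumes ev: "\<And>e. e > 0 \<Longrightarrow> \<forall>\<^sub>F y in at_top. P y e" and ex: "\<And>y. y \<ge> 3 \<Longrightarrow> \<exists>e\<ge>0. P y e"
  shows "\<exists>\<epsilon>. (\<epsilon> \<longlongrightarrow> 0) at_top \<and> (\<forall>y\<ge>3. P y (\<epsilon> y))"
proof -
  have "\<exists>e\<ge>0. P y e \<and> (\<forall>e'\<ge>0. P y e' \<longrightarrow> e < e' + 1 / y)" if y: "y \<ge> 3" for y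
  proof -
    let ?E = "{e. e \<ge> 0 \<and> P y e}"
    have ne: "?E \<noteq> {}" using ex[OF y] by blast
    have bdd: "bdd_below ?E" by (rule bdd_belowI[of _ 0]) simp
    have "Inf ?E < Inf ?E + 1 / y" using y by simp
    then obtain e where e: "e \<in> ?E" "e < Inf ?E + 1 / y" using cInf_lessD[OF ne] by blast
    have "Inf ?E \<le> e'" if "e' \<in> ?E" for e' by (rule cInf_lower[OF that bdd])
    thus ?thesis using e by (intro exI[of _ e]) force
  qed
  then obtain \<epsilon> where eps: "\<And>y. y \<ge> 3 \<Longrightarrow> \<epsilon> y \<ge> 0 \<and> P y (\<epsilon> y) \<and> (\<forall>e'\<ge>0. P y e' \<longrightarrow> \<epsilon> y < e' + 1 / y)" by metis
  have "(\<epsilon> \<longlongrightarrow> 0) at_top"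
  proof (rule tendstoI)
    fix e :: real assume e: "e > 0"
    hence "e / 2 > 0" by simp
    from ev[OF this] eventually_ge_at_top[of 3] eventually_ge_at_top[of "2 / e"]
    show "\<forall>\<^sub>F y in at_top. dist (\<epsilon> y) 0 < e"
    proof eventually_elim
      case (elim y)
      have "\<epsilon> y < e / 2 + 1 / y" using eps[of y] elim e by simp
      moreover have "1 / y \<le> e / 2" using elim e by (simp add: field_simps)
      ultimately show ?case using eps[of y] elim by (simp add: dist_real_def)
    qed
  qed
  thus ?thesis using eps by blast
qed

theorem theorem2p10:
  fixes g :: nat and A :: real
  assumes "odd g" and "A > 0"
  shows "\<exists>\<epsilon> :: real \<Rightarrow> real. (\<epsilon> \<longlongrightarrow> 0) at_top \<and>
    (\<forall>(y::real) (q::nat) (chi :: int \<Rightarrow> complex) (m::nat) (\<xi> :: int \<Rightarrow> complex).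
       y \<ge> 3 \<and>
       primitive_character q chi \<and> character_order q chi = g \<and>
       dirichlet_character m \<xi> \<and> odd_character \<xi> \<and> real m < ln y powr A
       \<longrightarrow> pretentious_min (\<lambda>n. chi (int n) * cnj (\<xi> (int n))) y ((ln y)\<^sup>2)
             \<ge> (delta g + \<epsilon> y) * ln (ln y))"
proof -
  define P where "P = (\<lambda>(y::real) e. \<forall>q chi m \<xi>. primitive_character q chi \<and> character_order q chi = g \<and>
       dirichlet_character m \<xi> \<and> odd_character \<xi> \<and> real m < ln y powr A
       \<longrightarrow> pretentious_min (\<lambda>n. chi (int n) * cnj (\<xi> (int n))) y ((ln y)\<^sup>2) \<ge> (delta g - e) * ln (ln y))"
  have min_ge: "pretentious_min h y T \<ge> b" if "T \<ge> 0" "\<And>t. \<bar>t\<bar> \<le> T \<Longrightarrow> pretentious_sum h y t \<ge> b" for h y T b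
    unfolding pretentious_min_def
  proof (rule cINF_greatest)
    show "{t. \<bar>t\<bar> \<le> T} \<noteq> {}" using that(1) by (auto intro!: exI[of _ 0])
  qed (use that(2) in auto)
  have "\<exists>\<epsilon>. (\<epsilon> \<longlongrightarrow> 0) at_top \<and> (\<forall>y\<ge>3. P y (\<epsilon> y))"
  proof (rule error_function_exists)
    fix e :: real assume "e > 0"
    from pretentious_asymptotic[OF assms this] show "\<forall>\<^sub>F y in at_top. P y e"
    proof eventually_elim
      case (elim y)
      show ?case unfolding P_def
        by (intro allI impI min_ge) (use elim in auto)
    qed
  next
    fix y :: real
    \<comment> \<open>With the error \<open>delta g\<close> the lower bound is 0, and the distance
      is nonnegative. This gives an admissible error for values of y below the asymptotic
      range.\<close>
    have "P y (delta g)"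
      unfolding P_def
    proof (intro allI impI, elim conjE)
      fix q :: nat and chi :: "int \<Rightarrow> complex" and m :: nat and \<xi> :: "int \<Rightarrow> complex"
      assume c: "primitive_character q chi" "dirichlet_character m \<xi>"
      have "norm (chi (int n) * cnj (\<xi> (int n))) \<le> 1" for n
        using c char_norm_le[of q chi "int n"] char_norm_le[of m \<xi> "int n"]
        by (auto simp: norm_mult primitive_character_def intro!: mult_le_one)
      thus "(delta g - delta g) * ln (ln y) \<le> pretentious_min (\<lambda>n. chi (int n) * cnj (\<xi> (int n))) y ((ln y)\<^sup>2)"
        by (auto intro!: min_ge pretentious_sum_nonneg)
    qed
    thus "\<exists>e\<ge>0. P y e" using delta_bounds[OF odd_pos[OF assms(1)]] by blast
  qed
  then obtain \<epsilon> where eps: "(\<epsilon> \<longlongrightarrow> 0) at_top" "\<And>y. y \<ge> 3 \<Longrightarrow> P y (\<epsilon> y)" by blast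
  \<comment> \<open>\<open>P\<close> subtracts the error, whereas the statement adds it.\<close>
  have "((\<lambda>y. - \<epsilon> y) \<longlongrightarrow> 0) at_top" using tendsto_minus[OF eps(1)] by simp
  thus ?thesis
    by (intro exI[of _ "\<lambda>y. - \<epsilon> y"] conjI) (use eps(2) in \<open>auto simp: P_def\<close>)
qed

end
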